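(* Let $M,P,Q,R$ be distinct points on the conic $\mathcal K$, and let $h\in\mathcal H^\circ$ be the map with $h(\mathbb A)=h(\mathbb B)=h(\mathbb C)=M$, $h(\mathbb D)=P$, $h(\mathbb E)=Q$, $h(\mathbb F)=R$. Let $s=\left\{\begin{array}{ccc}\mathbb A&\mathbb B&\mathbb C\\ x&y&z\end{array}\right\}$ be a Pascal symbol with $\{x,y,z\}=\{\mathbb D,\mathbb E,\mathbb F\}$. Then $q_s$ induces an isomorphism of the fibre $X_h=\beta^{-1}(h)$ with the pencil of lines through $M$.
   Context: Work over the complex numbers. Let $\mathcal K\subseteq\mathbb P^2$ be a nonsingular conic, let $L=\{\mathbb A,\mathbb B,\mathbb C,\mathbb D,\mathbb E,\mathbb F\}$ be a set of six letters, and let $\mathcal H=\mathcal K^{L}\simeq(\mathbb P^1)^6$ be the variety of all maps $h:L\to\mathcal K$. The type of a partition of $L$ is the list of its block sizes. For a partition $\pi$, the polydiagonal of type $\pi$ is $\Delta_\pi=\{h\in\mathcal H: h(x)=h(y)\text{ whenever }x,y\text{ are in the same block of }\pi\}$. A Pascal symbol is an array $s=\left\{\begin{array}{ccc} x_1&x_2&x_3\\ y_1&y_2&y_3\end{array}\right\}$ with $\{x_1,x_2,x_3,y_1,y_2,y_3\}=L$, considered up to permuting its rows and permuting its columns. For injective $h$, Pascal's theorem says that the three points $h(x_i)h(y_j)\cap h(x_j)h(y_i)$ ($1\le i<j\le 3$) are collinear, where $PQ$ denotes the line joining $P,Q$; the line containing them is the Pascal line. The assignment of the Pascal line to $h$ defines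 a rational map $p_s:\mathcal H\dashrightarrow(\mathbb P^2)^*$ to the space of lines in $\mathbb P^2$. Let $\mathcal H^\circ=\mathcal H\setminus\bigcup_\mu\Delta_\mu$, the union being over all partitions $\mu$ of type $(3,2,1)$ or $(4,1,1)$. For $\pi$ of type $(2,2,1,1)$, $(3,1,1,1)$ or $(2,2,2)$, put $\Delta_\pi^\circ=\mathcal H^\circ\cap\Delta_\pi$. Let $Z\subseteq\mathcal H^\circ$ be the union of all $\Delta^\circ_\pi$ with $\pi$ of type $(2,2,2)$, and $Y\subseteq\mathcal H^\circ$ the union of all $\Delta^\circ_\pi$ with $\pi$ of type $(2,2,1,1)$ or $(3,1,1,1)$. Let $\beta_1:\mathbb X'\to\mathcal H^\circ$ be the blow-up along $Z$, let $Y'\subseteq\mathbb X'$ be the proper transform of $Y$, let $\beta_2:\mathbb X\to\mathbb X'$ be the blow-up along $Y'$, and let $\beta=\beta_1\circ\beta_2:\mathbb X\to\mathcal H^\circ$. For every Pascal symbol $s$, $q_s:\mathbb X\to(\mathbb P^2)^*$ denotes the (unique, existing) regular morphism extending the rational map $p_s\circ\beta$. The pencil of lines through a point $T\in\mathbb P^2$ is the line in $(\mathbb P^2)^*$ consisting of all lines in $\mathbb P^2$ passing through $T$. *)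

theory Defs
  imports "HOL-Analysis.Analysis" "HOL-Library.Multiset" "HOL-Library.Disjoint_Sets"
begin

section \<open>Varieties as spaces with functions\<close>

text \<open>
  Complex varieties are treated classically (Serre, Kempf): a variety is its set of closed points
  with the Zariski topology and the sheaf of complex-valued regular functions.  A HOL function
  representing a section over \<open>U\<close> may take arbitrary values outside \<open>U\<close>.
\<close>

record 'a fspace =
  zar :: "'a topology"
  reg :: "'a set \<Rightarrow> ('a \<Rightarrow> complex) set"

definition space_with_functions :: "'a fspace \<Rightarrow> bool" where
  "space_with_functions X \<longleftrightarrow>
     (\<forall>U f. f \<in> reg X U \<longrightarrow> openin (zar X) U) \<and>
     (\<forall>U f g. f \<in> reg X U \<and> (\<forall>x\<in>U. g x = f x) \<longrightarrow> g \<in> reg X U) \<and>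
     (\<forall>U c. openin (zar X) U \<longrightarrow> (\<lambda>_. c) \<in> reg X U) \<and>
     (\<forall>U f g. f \<in> reg X U \<and> g \<in> reg X U \<longrightarrow>
        (\<lambda>x. f x + g x) \<in> reg X U \<and> (\<lambda>x. f x * g x) \<in> reg X U) \<and>
     (\<forall>U V f. f \<in> reg X U \<and> openin (zar X) V \<and> V \<subseteq> U \<longrightarrow> f \<in> reg X V) \<and>
     (\<forall>U f. openin (zar X) U \<and> (\<forall>x\<in>U. \<exists>V. x \<in> V \<and> V \<subseteq> U \<and> f \<in> reg X V) \<longrightarrow> f \<in> reg X U) \<and>
     (\<forall>U f. f \<in> reg X U \<longrightarrow> (\<lambda>x. inverse (f x)) \<in> reg X {x \<in> U. f x \<noteq> 0})"

definition fs_morphism :: "'a fspace \<Rightarrow> 'b fspace \<Rightarrow> ('a \<Rightarrow> 'b) \<Rightarrow> bool" where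
  "fs_morphism X Y f \<longleftrightarrow>
     continuous_map (zar X) (zar Y) f \<and>
     (\<forall>U. \<forall>g\<in>reg Y U. g \<circ> f \<in> reg X {x \<in> topspace (zar X). f x \<in> U})"

definition fs_isomorphism :: "'a fspace \<Rightarrow> 'b fspace \<Rightarrow> ('a \<Rightarrow> 'b) \<Rightarrow> bool" where
  "fs_isomorphism X Y f \<longleftrightarrow>
     fs_morphism X Y f \<and>
     (\<exists>g. fs_morphism Y X g \<and>
          (\<forall>x\<in>topspace (zar X). g (f x) = x) \<and> (\<forall>y\<in>topspace (zar Y). f (g y) = y))"

text \<open>
  The coarsest structure on \<open>S\<close> for which given partial functions \<open>(U, f)\<close> are regular: one closes
  them under the ring operations (on the intersection of the domains) and under inversion (off the
  zeros); the domains obtained form a basis of the topology, and the regular functions are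
  those agreeing locally with one obtained in this way.
\<close>

inductive_set partial_functions ::
    "'a set \<Rightarrow> ('a set \<times> ('a \<Rightarrow> complex)) set \<Rightarrow> ('a set \<times> ('a \<Rightarrow> complex)) set"
  for S :: "'a set" and G :: "('a set \<times> ('a \<Rightarrow> complex)) set" where
  generator: "(U, f) \<in> G \<Longrightarrow> (S \<inter> U, f) \<in> partial_functions S G"
| const: "(S, \<lambda>_. c) \<in> partial_functions S G"
| add: "\<lbrakk>(U, f) \<in> partial_functions S G; (V, g) \<in> partial_functions S G\<rbrakk>
    \<Longrightarrow> (U \<inter> V, \<lambda>x. f x + g x) \<in> partial_functions S G"
| mult: "\<lbrakk>(U, f) \<in> partial_functions S G; (V, g) \<in> partial_functions S G\<rbrakk>
    \<Longrightarrow> (U \<inter> V, \<lambda>x. f x * g x) \<in> partial_functions S G"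
| inv: "(U, f) \<in> partial_functions S G
    \<Longrightarrow> ({x \<in> U. f x \<noteq> 0}, \<lambda>x. inverse (f x)) \<in> partial_functions S G"

definition generated_fspace :: "'a set \<Rightarrow> ('a set \<times> ('a \<Rightarrow> complex)) set \<Rightarrow> 'a fspace" where
  "generated_fspace S G =
     (let T = topology_generated_by (fst ` partial_functions S G) in
      \<lparr> zar = T,
        reg = (\<lambda>U. {f. openin T U \<and>
                 (\<forall>x\<in>U. \<exists>(V, g)\<in>partial_functions S G. x \<in> V \<and> V \<subseteq> U \<and> (\<forall>y\<in>V. f y = g y))}) \<rparr>)"

definition fs_sub :: "'a fspace \<Rightarrow> 'a set \<Rightarrow> 'a fspace" where
  "fs_sub X S = generated_fspace S {(U, f). f \<in> reg X U}"

definition fs_prod :: "'a fspace \<Rightarrow> 'b fspace \<Rightarrow> ('a \<times> 'b) fspace" where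
  "fs_prod X Y = generated_fspace (topspace (zar X) \<times> topspace (zar Y))
     ({(fst -` U, f \<circ> fst) | U f. f \<in> reg X U} \<union> {(snd -` V, g \<circ> snd) | V g. g \<in> reg Y V})"

definition fs_power :: "'a fspace \<Rightarrow> ('i \<Rightarrow> 'a) fspace" where
  "fs_power X = generated_fspace {h. \<forall>i. h i \<in> topspace (zar X)}
     {({h. h i \<in> U}, \<lambda>h. f (h i)) | i U f. f \<in> reg X U}"


section \<open>Projective space\<close>

text \<open>
  A point of projective \<open>n\<close>-space is the class, up to nonzero scalars, of a nonzero vector
  \<open>(v 0, \<dots>, v n)\<close>, the vector being extended by zero; \<open>hc p\<close> is some vector of
  homogeneous coordinates of \<open>p\<close>.
\<close>

type_synonym pt = "(nat \<Rightarrow> complex) set"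

definition proj_pt :: "(nat \<Rightarrow> complex) \<Rightarrow> pt" where
  "proj_pt v = {(\<lambda>i. c * v i) | c. c \<noteq> 0}"

definition proj_points :: "nat \<Rightarrow> pt set" where
  "proj_points n = {proj_pt v | v. (\<forall>i>n. v i = 0) \<and> (\<exists>i\<le>n. v i \<noteq> 0)}"

definition hc :: "pt \<Rightarrow> nat \<Rightarrow> complex" where
  "hc p = (SOME v. v \<in> p)"

definition proj_space :: "nat \<Rightarrow> pt fspace" where
  "proj_space n = generated_fspace (proj_points n)
     {({p. hc p j \<noteq> 0}, \<lambda>p. hc p i / hc p j) | i j. i \<le> n \<and> j \<le> n}"

text \<open>The line with equation \<open>l 0 * v 0 + l 1 * v 1 + l 2 * v 2 = 0\<close> is the point \<open>[l 0 : l 1 : l 2]\<close>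
  of the dual plane, which is again a copy of \<open>proj_space 2\<close>.\<close>

abbreviation plane :: "pt fspace" where "plane \<equiv> proj_space 2"
abbreviation dual_plane :: "pt fspace" where "dual_plane \<equiv> proj_space 2"

definition incident :: "pt \<Rightarrow> pt \<Rightarrow> bool" where
  "incident p l \<longleftrightarrow> (\<Sum>i\<le>2. hc l i * hc p i) = 0"

definition join :: "pt \<Rightarrow> pt \<Rightarrow> pt" where
  "join p q = (THE l. l \<in> topspace (zar dual_plane) \<and> incident p l \<and> incident q l)"

definition meet :: "pt \<Rightarrow> pt \<Rightarrow> pt" where
  "meet l m = (THE p. p \<in> topspace (zar plane) \<and> incident p l \<and> incident p m)"

definition pencil :: "pt \<Rightarrow> pt set" where
  "pencil p = {l \<in> topspace (zar dual_plane). incident p l}"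

definition conic :: "(nat \<Rightarrow> nat \<Rightarrow> complex) \<Rightarrow> pt set" where
  "conic a = {p \<in> topspace (zar plane). (\<Sum>i\<le>2. \<Sum>j\<le>2. a i j * hc p i * hc p j) = 0}"

text \<open>Jacobian criterion: the partial derivatives of \<open>\<Sum>i j. a i j * v i * v j\<close> are
  \<open>\<Sum>j. (a i j + a j i) * v j\<close>.\<close>

definition nonsingular_conic :: "pt set \<Rightarrow> bool" where
  "nonsingular_conic K \<longleftrightarrow>
     (\<exists>a. K = conic a \<and> (\<forall>p\<in>K. \<exists>i\<le>2. (\<Sum>j\<le>2. (a i j + a j i) * hc p j) \<noteq> 0))"


section \<open>Blow-ups\<close>

text \<open>The functions \<open>f 0, \<dots>, f r\<close> on the open set \<open>U\<close> generate the ideal sheaf of \<open>Z\<close> over \<open>U\<close>.\<close>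

definition generates_ideal ::
    "'a fspace \<Rightarrow> 'a set \<Rightarrow> 'a set \<Rightarrow> nat \<Rightarrow> (nat \<Rightarrow> 'a \<Rightarrow> complex) \<Rightarrow> bool" where
  "generates_ideal X Z U r f \<longleftrightarrow>
     (\<forall>i\<le>r. f i \<in> reg X U \<and> (\<forall>x\<in>U \<inter> Z. f i x = 0)) \<and>
     (\<forall>V g. V \<subseteq> U \<and> g \<in> reg X V \<and> (\<forall>x\<in>V \<inter> Z. g x = 0) \<longrightarrow>
        (\<forall>x\<in>V. \<exists>W a. x \<in> W \<and> W \<subseteq> V \<and> (\<forall>i\<le>r. a i \<in> reg X W) \<and>
           (\<forall>y\<in>W. g y = (\<Sum>i\<le>r. a i y * f i y))))"

text \<open>The closure, in \<open>U\<close> times projective \<open>r\<close>-space, of the graph of \<open>[f 0 : \<dots> : f r]\<close>.\<close>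

definition blowup_model ::
    "'a fspace \<Rightarrow> 'a set \<Rightarrow> nat \<Rightarrow> (nat \<Rightarrow> 'a \<Rightarrow> complex) \<Rightarrow> ('a \<times> pt) fspace" where
  "blowup_model X U r f =
     (let P = fs_prod (fs_sub X U) (proj_space r) in
      fs_sub P (zar P closure_of
        {(x, proj_pt (\<lambda>i. if i \<le> r then f i x else 0)) | x. x \<in> U \<and> (\<exists>i\<le>r. f i x \<noteq> 0)}))"

text \<open>Over a small open set the closure of the graph does not depend on the
  chosen generators up to unique isomorphism over the base, so the local condition below
  determines the blow-up up to unique isomorphism over \<open>X\<close>.\<close>

definition is_blowup :: "'a fspace \<Rightarrow> 'a set \<Rightarrow> 'b fspace \<Rightarrow> ('b \<Rightarrow> 'a) \<Rightarrow> bool" where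
  "is_blowup X Z X' \<beta> \<longleftrightarrow>
     closedin (zar X) Z \<and> space_with_functions X' \<and> fs_morphism X' X \<beta> \<and>
     (\<forall>x\<in>topspace (zar X). \<exists>U r f \<phi>.
        openin (zar X) U \<and> x \<in> U \<and> generates_ideal X Z U r f \<and>
        fs_isomorphism (fs_sub X' {\<xi> \<in> topspace (zar X'). \<beta> \<xi> \<in> U}) (blowup_model X U r f) \<phi> \<and>
        (\<forall>\<xi>\<in>topspace (zar X'). \<beta> \<xi> \<in> U \<longrightarrow> fst (\<phi> \<xi>) = \<beta> \<xi>))"

definition proper_transform ::
    "'b fspace \<Rightarrow> ('b \<Rightarrow> 'a) \<Rightarrow> 'a set \<Rightarrow> 'a set \<Rightarrow> 'b set" where
  "proper_transform X' \<beta> Z Y =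
     zar X' closure_of {\<xi> \<in> topspace (zar X'). \<beta> \<xi> \<in> Y - Z}"


section \<open>Sextuples on a conic and Pascal lines\<close>

datatype letter = \<A> | \<B> | \<C> | \<D> | \<E> | \<F>

definition conic_power :: "pt set \<Rightarrow> (letter \<Rightarrow> pt) fspace" where
  "conic_power K = fs_power (fs_sub plane K)"

definition has_type :: "letter set set \<Rightarrow> nat multiset \<Rightarrow> bool" where
  "has_type \<pi> t \<longleftrightarrow> partition_on UNIV \<pi> \<and> image_mset card (mset_set \<pi>) = t"

definition polydiagonal :: "pt set \<Rightarrow> letter set set \<Rightarrow> (letter \<Rightarrow> pt) set" where
  "polydiagonal K \<pi> =
     {h \<in> topspace (zar (conic_power K)). \<forall>B\<in>\<pi>. \<forall>x\<in>B. \<forall>y\<in>B. h x = h y}"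

definition H_open_set :: "pt set \<Rightarrow> (letter \<Rightarrow> pt) set" where
  "H_open_set K = topspace (zar (conic_power K)) -
     (\<Union>\<mu>\<in>{\<mu>. has_type \<mu> {#3, 2, 1#} \<or> has_type \<mu> {#4, 1, 1#}}. polydiagonal K \<mu>)"

definition H_open :: "pt set \<Rightarrow> (letter \<Rightarrow> pt) fspace" where
  "H_open K = fs_sub (conic_power K) (H_open_set K)"

definition Z_locus :: "pt set \<Rightarrow> (letter \<Rightarrow> pt) set" where
  "Z_locus K = (\<Union>\<pi>\<in>{\<pi>. has_type \<pi> {#2, 2, 2#}}. H_open_set K \<inter> polydiagonal K \<pi>)"

definition Y_locus :: "pt set \<Rightarrow> (letter \<Rightarrow> pt) set" where
  "Y_locus K = (\<Union>\<pi>\<in>{\<pi>. has_type \<pi> {#2, 2, 1, 1#} \<or> has_type \<pi> {#3, 1, 1, 1#}}.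
     H_open_set K \<inter> polydiagonal K \<pi>)"

text \<open>An array up to permuting columns is the set \<open>C\<close> of its columns; exchanging
  the rows replaces \<open>C\<close> by its converse.  A Pascal symbol is the set \<open>{C, C\<inverse>}\<close>.\<close>

type_synonym pascal_symbol = "(letter \<times> letter) set set"

definition symbol ::
    "letter \<Rightarrow> letter \<Rightarrow> letter \<Rightarrow> letter \<Rightarrow> letter \<Rightarrow> letter \<Rightarrow> pascal_symbol" where
  "symbol x1 x2 x3 y1 y2 y3 =
     (let C = {(x1, y1), (x2, y2), (x3, y3)} in {C, C\<inverse>})"

text \<open>Meaningful only for injective \<open>h\<close> on a nonsingular conic, when the line exists and is unique.\<close>

definition pascal_line :: "pascal_symbol \<Rightarrow> (letter \<Rightarrow> pt) \<Rightarrow> pt" where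
  "pascal_line s h = (THE l. l \<in> topspace (zar dual_plane) \<and>
     (\<forall>C\<in>s. \<forall>(x, y)\<in>C. \<forall>(x', y')\<in>C. (x, y) \<noteq> (x', y') \<longrightarrow>
        incident (meet (join (h x) (h y')) (join (h x') (h y))) l))"

text \<open>\<open>q\<close> is a regular extension of \<open>p\<^sub>s \<circ> \<beta>\<close>, the rational map \<open>p\<^sub>s\<close> being given by
  the Pascal line on the dense open set of injective maps.\<close>

definition extends_pascal ::
    "pascal_symbol \<Rightarrow> 'b fspace \<Rightarrow> ('b \<Rightarrow> letter \<Rightarrow> pt) \<Rightarrow> ('b \<Rightarrow> pt) \<Rightarrow> bool" where
  "extends_pascal s X \<beta> q \<longleftrightarrow> fs_morphism X dual_plane q \<and>
     (\<forall>\<xi>\<in>topspace (zar X). inj (\<beta> \<xi>) \<longrightarrow> q \<xi> = pascal_line s (\<beta> \<xi>))"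

end

(* Near h the six points have finite parameters t_A, ..., t_F on the conic, the centre Z is empty and
   Y is the diagonal t_A = t_B = t_C.  So there X is the blow-up of affine 6-space along that diagonal,
   and its fibre over h is the line of directions [u : v] of (t_A - t_B, t_A - t_C).  The Pascal line
   cuts the conic in the fixed points of the homography taking the upper to the lower row of the
   symbol.  Normalise t_M = 0 and let t_B, t_C tend to t_A = 0 in the direction (- u, - v): divided by
   the common factor, the coefficients of the Pascal line tend to those of a line through M that
   depend linearly and invertibly on (u, v), with determinant (b3 - b1) (b2 - b1) (b2 - b3) in the
   parameters b1, b2, b3 of the lower row. *)
theory Submission
  imports Defs
begin

text \<open>Of a blow-up only \<open>is_blowup\<close> is known: the neighbourhood, the number of
  generators and the generators themselves are given, not chosen. So the fibre cannot be read off
  from the standard blow-up of a linear subspace. Instead the given generators are compared with the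
  two coordinate differences: each family is a combination of the other, and the matrix of leading
  coefficients at the base point has a left inverse. It embeds the projective line of directions
  into the projective space of the local model, with the fibre as image. Density and limits are
  handled without dimension theory, by curves that are continuous for the classical topology and
  start in the fibre. For small nonzero parameter their sextuples are injective. This puts points
  into Zariski closures, and it determines \<open>q\<close> on the fibre, where the hypothesis on
  \<open>q\<close> prescribes no value and only continuity helps. The inverse of \<open>q\<close>
  has to be a morphism as well. It is composed of two explicit morphisms: from the pencil to the
  projective line, by solving a linear system, and from there to \<open>X\<close>.\<close>

abbreviation points :: "'a fspace \<Rightarrow> 'a set" where
  "points X \<equiv> topspace (zar X)"

section \<open>Spaces with functions\<close>

context
  fixes X :: "'a fspace"
  assumes X: "space_with_functions X"
begin

lemmas swf = X[unfolded space_with_functions_def]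
lemmas swf_openin = swf[THEN conjunct1, rule_format]
lemmas swf2 = swf[THEN conjunct2]
lemmas swf_cong = swf2[THEN conjunct1, rule_format, OF conjI]
lemmas swf3 = swf2[THEN conjunct2]
lemmas swf_const = swf3[THEN conjunct1, rule_format]
lemmas swf4 = swf3[THEN conjunct2]
lemmas swf_ring = swf4[THEN conjunct1, rule_format, OF conjI]
lemmas swf5 = swf4[THEN conjunct2]
lemmas swf_subset = swf5[THEN conjunct1, rule_format, OF conjI[OF _ conjI]]
lemmas swf6 = swf5[THEN conjunct2]
lemmas swf_glue = swf6[THEN conjunct1, rule_format, OF conjI]
lemmas swf_inverse = swf6[THEN conjunct2, rule_format]

lemma reg_openin: "f \<in> reg X U \<Longrightarrow> openin (zar X) U"
  by (rule swf_openin)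

lemma reg_cong: "f \<in> reg X U \<Longrightarrow> (\<And>x. x \<in> U \<Longrightarrow> g x = f x) \<Longrightarrow> g \<in> reg X U"
  by (rule swf_cong) auto

lemma reg_const: "openin (zar X) U \<Longrightarrow> (\<lambda>_. c) \<in> reg X U"
  by (rule swf_const)

lemma reg_add: "f \<in> reg X U \<Longrightarrow> g \<in> reg X U \<Longrightarrow> (\<lambda>x. f x + g x) \<in> reg X U"
  by (rule swf_ring[THEN conjunct1])

lemma reg_mult: "f \<in> reg X U \<Longrightarrow> g \<in> reg X U \<Longrightarrow> (\<lambda>x. f x * g x) \<in> reg X U"
  by (rule swf_ring[THEN conjunct2])

lemma reg_subset: "f \<in> reg X U \<Longrightarrow> openin (zar X) V \<Longrightarrow> V \<subseteq> U \<Longrightarrow> f \<in> reg X V"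
  by (rule swf_subset)

text \<open>The domains of the given sections cover \<open>U\<close> by open sets contained in it,
  so \<open>U\<close> is open and the gluing axiom applies.\<close>

lemma reg_glue:
  assumes "\<And>x. x \<in> U \<Longrightarrow> \<exists>V. x \<in> V \<and> V \<subseteq> U \<and> f \<in> reg X V"
  shows "f \<in> reg X U"
proof -
  have "openin (zar X) U"
    by (subst openin_subopen) (use assms reg_openin in blast)
  then show ?thesis
    by (rule swf_glue) (use assms in blast)
qed

lemma reg_inverse: "f \<in> reg X U \<Longrightarrow> (\<lambda>x. inverse (f x)) \<in> reg X {x \<in> U. f x \<noteq> 0}"
  by (rule swf_inverse)

lemma reg_nonzero_openin: "f \<in> reg X U \<Longrightarrow> openin (zar X) {x \<in> U. f x \<noteq> 0}"
  by (rule reg_openin[OF reg_inverse])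

lemma reg_diff:
  assumes "f \<in> reg X U" "g \<in> reg X U"
  shows "(\<lambda>x. f x - g x) \<in> reg X U"
proof -
  have "(\<lambda>x. f x + (-1) * g x) \<in> reg X U"
    using assms by (intro reg_add reg_mult reg_const) (auto dest: reg_openin)
  then show ?thesis
    by simp
qed

lemma reg_divide:
  assumes "f \<in> reg X U" "g \<in> reg X U" "\<And>x. x \<in> U \<Longrightarrow> g x \<noteq> 0"
  shows "(\<lambda>x. f x / g x) \<in> reg X U"
proof -
  have "{x \<in> U. g x \<noteq> 0} = U"
    using assms(3) by blast
  then show ?thesis
    using reg_mult[OF assms(1)] reg_inverse[OF assms(2)] by (simp add: divide_inverse)
qed

lemma reg_sum:
  assumes "openin (zar X) U" "\<And>i. i \<in> I \<Longrightarrow> f i \<in> reg X U"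
  shows "(\<lambda>x. \<Sum>i\<in>I. f i x) \<in> reg X U"
proof (cases "finite I")
  case True
  then show ?thesis
    using assms(2)
  proof (induction I rule: finite_induct)
    case empty
    show ?case
      unfolding sum.empty by (rule reg_const[OF assms(1)])
  next
    case (insert i I)
    show ?case
      unfolding sum.insert[OF insert.hyps] by (intro reg_add insert) auto
  qed
next
  case False
  \<comment> \<open>A sum over an infinite set is 0 by convention, hence a constant section.\<close>
  then have "(\<Sum>i\<in>I. f i x) = 0" for x
    by simp
  then show ?thesis
    by (simp only: reg_const[OF assms(1)])
qed

end

lemma morphism_continuous: "fs_morphism X Y f \<Longrightarrow> continuous_map (zar X) (zar Y) f"
  unfolding fs_morphism_def by (rule conjunct1)

lemma morphism_in_points: "fs_morphism X Y f \<Longrightarrow> x \<in> points X \<Longrightarrow> f x \<in> points Y"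
  by (drule morphism_continuous) (auto simp: continuous_map_def)

lemma morphism_openin:
  "fs_morphism X Y f \<Longrightarrow> openin (zar Y) U \<Longrightarrow> openin (zar X) {x \<in> points X. f x \<in> U}"
  by (drule morphism_continuous) (rule openin_continuous_map_preimage)

lemma morphism_reg:
  assumes "fs_morphism X Y f" "g \<in> reg Y U"
  shows "(\<lambda>x. g (f x)) \<in> reg X {x \<in> points X. f x \<in> U}"
  using assms(1)[unfolded fs_morphism_def, THEN conjunct2, rule_format, OF assms(2)]
  unfolding comp_def .

lemma morphismI:
  assumes "continuous_map (zar X) (zar Y) f"
    and "\<And>U g. g \<in> reg Y U \<Longrightarrow> (\<lambda>x. g (f x)) \<in> reg X {x \<in> points X. f x \<in> U}"
  shows "fs_morphism X Y f"
  unfolding fs_morphism_def comp_def using assms by (intro conjI allI ballI)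

text \<open>Continuity comes with the pullback of sections: an open \<open>U\<close> is the domain
  of the constant section 0, the pullback of this section lives on the preimage of \<open>U\<close>,
  and domains of sections are open.\<close>

lemma morphism_regI:
  assumes X: "space_with_functions X" and Y: "space_with_functions Y"
    and m: "\<And>x. x \<in> points X \<Longrightarrow> f x \<in> points Y"
    and r: "\<And>U g. g \<in> reg Y U \<Longrightarrow> (\<lambda>x. g (f x)) \<in> reg X {x \<in> points X. f x \<in> U}"
  shows "fs_morphism X Y f"
proof (rule morphismI[OF _ r])
  show "continuous_map (zar X) (zar Y) f"
    unfolding continuous_map_def
  proof (intro conjI allI impI)
    show "f \<in> points X \<rightarrow> points Y"
      using m by blast
    fix U
    assume "openin (zar Y) U"
    then show "openin (zar X) {x \<in> points X. f x \<in> U}"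
      by (rule reg_openin[OF X r[OF reg_const[OF Y, of U 0]]])
  qed
qed

lemma morphism_comp:
  assumes f: "fs_morphism X Y f" and g: "fs_morphism Y W g"
  shows "fs_morphism X W (\<lambda>x. g (f x))"
proof (rule morphismI)
  show "continuous_map (zar X) (zar W) (\<lambda>x. g (f x))"
    using continuous_map_compose[OF morphism_continuous[OF f] morphism_continuous[OF g]]
    unfolding comp_def .
  fix U k
  assume "k \<in> reg W U"
  from morphism_reg[OF f morphism_reg[OF g this]]
  have "(\<lambda>x. k (g (f x))) \<in> reg X {x \<in> points X. f x \<in> {y \<in> points Y. g y \<in> U}}" .
  moreover have "{x \<in> points X. f x \<in> {y \<in> points Y. g y \<in> U}} = {x \<in> points X. g (f x) \<in> U}"
    using morphism_in_points[OF f] by blast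
  ultimately show "(\<lambda>x. k (g (f x))) \<in> reg X {x \<in> points X. g (f x) \<in> U}"
    by (simp only:)
qed

subsection \<open>Generated structures\<close>

lemma partial_functions_subset: "(U, f) \<in> partial_functions S G \<Longrightarrow> U \<subseteq> S"
  by (induction rule: partial_functions.induct) auto

text \<open>Multiplication by 0 forgets \<open>f\<close> but keeps its domain. So each domain
  carries every constant, and adding the constant 0 of another domain restricts a function to the
  intersection.\<close>

lemma partial_functions_const:
  assumes "(U, f) \<in> partial_functions S G"
  shows "(U, \<lambda>_. c) \<in> partial_functions S G"
proof -
  have "(U \<inter> S \<inter> S, \<lambda>x. f x * 0 + c) \<in> partial_functions S G"
    by (intro partial_functions.intros assms)
  moreover have "U \<inter> S \<inter> S = U"
    using partial_functions_subset[OF assms] by blast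
  ultimately show ?thesis
    by simp
qed

lemma partial_functions_restrict:
  assumes "(U, f) \<in> partial_functions S G" "(V, g) \<in> partial_functions S G"
  shows "(U \<inter> V, f) \<in> partial_functions S G"
  using partial_functions.add[OF assms(1) partial_functions_const[OF assms(2), of 0]] by simp

text \<open>The domains of partial functions are closed under binary intersection, so they are a
  basis, where \<open>topology_generated_by\<close> by itself only promises a subbasis.\<close>

lemma openin_generated_fspace:
  "openin (zar (generated_fspace S G)) U \<longleftrightarrow>
     (\<forall>x\<in>U. \<exists>V g. (V, g) \<in> partial_functions S G \<and> x \<in> V \<and> V \<subseteq> U)"
proof
  assume "openin (zar (generated_fspace S G)) U"
  then have "generate_topology_on (fst ` partial_functions S G) U"
    by (simp add: generated_fspace_def Let_def openin_topology_generated_by_iff)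
  then show "\<forall>x\<in>U. \<exists>V g. (V, g) \<in> partial_functions S G \<and> x \<in> V \<and> V \<subseteq> U"
  proof (induction rule: generate_topology_on.induct)
    case Empty
    show ?case
      by simp
  next
    case (Int A B)
    show ?case
    proof
      fix x
      assume x: "x \<in> A \<inter> B"
      then obtain V f where V: "(V, f) \<in> partial_functions S G" "x \<in> V" "V \<subseteq> A"
        using Int.IH(1) by blast
      from x obtain W g where W: "(W, g) \<in> partial_functions S G" "x \<in> W" "W \<subseteq> B"
        using Int.IH(2) by blast
      show "\<exists>V g. (V, g) \<in> partial_functions S G \<and> x \<in> V \<and> V \<subseteq> A \<inter> B"
        by (rule exI[of _ "V \<inter> W"], rule exI[of _ f])
          (use V W partial_functions_restrict[OF V(1) W(1)] in auto)
    qed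
  next
    case (UN K)
    show ?case
    proof
      fix x
      assume "x \<in> \<Union>K"
      then obtain k where k: "k \<in> K" "x \<in> k"
        by blast
      then obtain V g where "(V, g) \<in> partial_functions S G" "x \<in> V" "V \<subseteq> k"
        using UN.IH by blast
      then show "\<exists>V g. (V, g) \<in> partial_functions S G \<and> x \<in> V \<and> V \<subseteq> \<Union>K"
        using k(1) by blast
    qed
  next
    case (Basis s)
    then obtain g where "(s, g) \<in> partial_functions S G"
      by (metis imageE prod.collapse)
    then show ?case
      by blast
  qed
next
  assume *: "\<forall>x\<in>U. \<exists>V g. (V, g) \<in> partial_functions S G \<and> x \<in> V \<and> V \<subseteq> U"
  have "openin (zar (generated_fspace S G)) V" if "(V, g) \<in> partial_functions S G" for V g
    unfolding generated_fspace_def Let_def fspace.simps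
    by (rule topology_generated_by_Basis, rule image_eqI[OF _ that]) simp
  with * show "openin (zar (generated_fspace S G)) U"
    by (subst openin_subopen) blast
qed

lemma reg_generated_fspace:
  "f \<in> reg (generated_fspace S G) U \<longleftrightarrow>
     (\<forall>x\<in>U. \<exists>V g. (V, g) \<in> partial_functions S G \<and> x \<in> V \<and> V \<subseteq> U \<and> (\<forall>y\<in>V. f y = g y))"
proof -
  have "f \<in> reg (generated_fspace S G) U \<longleftrightarrow> openin (zar (generated_fspace S G)) U \<and>
     (\<forall>x\<in>U. \<exists>V g. (V, g) \<in> partial_functions S G \<and> x \<in> V \<and> V \<subseteq> U \<and> (\<forall>y\<in>V. f y = g y))"
    by (simp add: generated_fspace_def Let_def Bex_def split_paired_Ex)
  moreover have "openin (zar (generated_fspace S G)) U"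
    if "\<forall>x\<in>U. \<exists>V g. (V, g) \<in> partial_functions S G \<and> x \<in> V \<and> V \<subseteq> U \<and> (\<forall>y\<in>V. f y = g y)"
    unfolding openin_generated_fspace using that by blast
  ultimately show ?thesis
    by blast
qed

lemma reg_generatedD:
  assumes "f \<in> reg (generated_fspace S G) U" "x \<in> U"
  shows "\<exists>V g. (V, g) \<in> partial_functions S G \<and> x \<in> V \<and> V \<subseteq> U \<and> (\<forall>y\<in>V. f y = g y)"
  using assms(1)[unfolded reg_generated_fspace] assms(2) by (rule bspec)

lemma openin_generatedD:
  assumes "openin (zar (generated_fspace S G)) U" "x \<in> U"
  shows "\<exists>V g. (V, g) \<in> partial_functions S G \<and> x \<in> V \<and> V \<subseteq> U"
  using assms(1)[unfolded openin_generated_fspace] assms(2) by (rule bspec)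

lemma partial_functions_openin:
  "(V, g) \<in> partial_functions S G \<Longrightarrow> openin (zar (generated_fspace S G)) V"
  unfolding openin_generated_fspace by blast

lemma reg_generatedI:
  assumes "\<And>x. x \<in> U \<Longrightarrow>
    \<exists>V g. (V, g) \<in> partial_functions S G \<and> x \<in> V \<and> V \<subseteq> U \<and> (\<forall>y\<in>V. f y = g y)"
  shows "f \<in> reg (generated_fspace S G) U"
  unfolding reg_generated_fspace by (rule ballI) (rule assms)

lemma partial_functions_reg:
  assumes "(V, g) \<in> partial_functions S G"
  shows "g \<in> reg (generated_fspace S G) V"
  by (rule reg_generatedI, rule exI[of _ V], rule exI[of _ g]) (simp add: assms)

lemma points_generated_fspace [simp]: "points (generated_fspace S G) = S"
proof
  show "points (generated_fspace S G) \<subseteq> S"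
  proof
    fix x
    assume "x \<in> points (generated_fspace S G)"
    from openin_generatedD[OF openin_topspace this]
    obtain V g where V: "(V, g) \<in> partial_functions S G" "x \<in> V"
      by (elim exE conjE) (rule that)
    show "x \<in> S"
      by (rule subsetD[OF partial_functions_subset[OF V(1)] V(2)])
  qed
  show "S \<subseteq> points (generated_fspace S G)"
    by (rule openin_subset[OF partial_functions_openin[OF partial_functions.const]])
qed

text \<open>Near a point, two sections are represented on one common domain, so that their sum and
  product can be formed there.\<close>

lemma reg_generated_common:
  assumes "f \<in> reg (generated_fspace S G) U" "g \<in> reg (generated_fspace S G) U" "x \<in> U"
  obtains V f' g' where "(V, f') \<in> partial_functions S G" "(V, g') \<in> partial_functions S G"
    "x \<in> V" "V \<subseteq> U" "\<forall>y\<in>V. f y = f' y" "\<forall>y\<in>V. g y = g' y"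
proof -
  obtain V f' where V: "(V, f') \<in> partial_functions S G" "x \<in> V" "V \<subseteq> U" "\<forall>y\<in>V. f y = f' y"
    using reg_generatedD[OF assms(1,3)] by (elim exE conjE) (rule that)
  obtain W g' where W: "(W, g') \<in> partial_functions S G" "x \<in> W" "W \<subseteq> U" "\<forall>y\<in>W. g y = g' y"
    using reg_generatedD[OF assms(2,3)] by (elim exE conjE) (rule that)
  show thesis
  proof (rule that)
    show "(V \<inter> W, f') \<in> partial_functions S G"
      by (rule partial_functions_restrict[OF V(1) W(1)])
    show "(V \<inter> W, g') \<in> partial_functions S G"
      by (subst Int_commute) (rule partial_functions_restrict[OF W(1) V(1)])
  qed (use V W in auto)
qed

lemma swf_generated [simp]: "space_with_functions (generated_fspace S G)"
proof -
  let ?X = "generated_fspace S G"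
  have 1: "openin (zar ?X) U" if f: "f \<in> reg ?X U" for f U
    unfolding openin_generated_fspace
  proof
    fix x
    assume "x \<in> U"
    then obtain V g where "(V, g) \<in> partial_functions S G" "x \<in> V" "V \<subseteq> U"
      using reg_generatedD[OF f] by blast
    then show "\<exists>V g. (V, g) \<in> partial_functions S G \<and> x \<in> V \<and> V \<subseteq> U"
      by blast
  qed
  have 2: "g \<in> reg ?X U" if f: "f \<in> reg ?X U" and "\<forall>x\<in>U. g x = f x" for f g U
  proof (rule reg_generatedI)
    fix x
    assume "x \<in> U"
    then obtain V k where V: "(V, k) \<in> partial_functions S G" "x \<in> V" "V \<subseteq> U"
      "\<forall>y\<in>V. f y = k y"
      using reg_generatedD[OF f \<open>x \<in> U\<close>] by (elim exE conjE) (rule that)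
    then have "\<forall>y\<in>V. g y = k y"
      using that(2) by auto
    with V(1-3) show "\<exists>V k. (V, k) \<in> partial_functions S G \<and> x \<in> V \<and> V \<subseteq> U \<and> (\<forall>y\<in>V. g y = k y)"
      by (intro exI conjI)
  qed
  have 3: "(\<lambda>_. c) \<in> reg ?X U" if U: "openin (zar ?X) U" for U c
  proof (rule reg_generatedI)
    fix x
    assume "x \<in> U"
    from openin_generatedD[OF U this]
    obtain V k where "(V, k) \<in> partial_functions S G" "x \<in> V" "V \<subseteq> U"
      by (elim exE conjE) (rule that)
    then show "\<exists>V k. (V, k) \<in> partial_functions S G \<and> x \<in> V \<and> V \<subseteq> U \<and> (\<forall>y\<in>V. c = k y)"
      using partial_functions_const[of V k S G c] by (intro exI[of _ V] exI[of _ "\<lambda>_. c"]) simp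
  qed
  have 4: "(\<lambda>x. f x + g x) \<in> reg ?X U \<and> (\<lambda>x. f x * g x) \<in> reg ?X U"
    if f: "f \<in> reg ?X U" and g: "g \<in> reg ?X U" for f g U
  proof (intro conjI; rule reg_generatedI)
    fix x
    assume "x \<in> U"
    then obtain V f' g' where V: "(V, f') \<in> partial_functions S G" "(V, g') \<in> partial_functions S G"
      "x \<in> V" "V \<subseteq> U" "\<forall>y\<in>V. f y = f' y" "\<forall>y\<in>V. g y = g' y"
      by (rule reg_generated_common[OF f g])
    show "\<exists>V k. (V, k) \<in> partial_functions S G \<and> x \<in> V \<and> V \<subseteq> U \<and> (\<forall>y\<in>V. f y + g y = k y)"
      by (rule exI[of _ V], rule exI[of _ "\<lambda>x. f' x + g' x"])
        (use partial_functions.add[OF V(1,2)] V in simp)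
    show "\<exists>V k. (V, k) \<in> partial_functions S G \<and> x \<in> V \<and> V \<subseteq> U \<and> (\<forall>y\<in>V. f y * g y = k y)"
      by (rule exI[of _ V], rule exI[of _ "\<lambda>x. f' x * g' x"])
        (use partial_functions.mult[OF V(1,2)] V in simp)
  qed
  have 5: "f \<in> reg ?X V" if f: "f \<in> reg ?X U" and V: "openin (zar ?X) V" "V \<subseteq> U" for U V f
  proof (rule reg_generatedI)
    fix x
    assume x: "x \<in> V"
    obtain A k where A: "(A, k) \<in> partial_functions S G" "x \<in> A" "A \<subseteq> U" "\<forall>y\<in>A. f y = k y"
      using reg_generatedD[OF f subsetD[OF V(2) x]] by (elim exE conjE) (rule that)
    obtain B l where B: "(B, l) \<in> partial_functions S G" "x \<in> B" "B \<subseteq> V"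
      using openin_generatedD[OF V(1) x] by (elim exE conjE) (rule that)
    show "\<exists>V' k. (V', k) \<in> partial_functions S G \<and> x \<in> V' \<and> V' \<subseteq> V \<and> (\<forall>y\<in>V'. f y = k y)"
      by (rule exI[of _ "A \<inter> B"], rule exI[of _ k])
        (use A B partial_functions_restrict[OF A(1) B(1)] in auto)
  qed
  have 6: "f \<in> reg ?X U" if *: "\<forall>x\<in>U. \<exists>V. x \<in> V \<and> V \<subseteq> U \<and> f \<in> reg ?X V" for U f
  proof (rule reg_generatedI)
    fix x
    assume "x \<in> U"
    then obtain W where W: "x \<in> W" "W \<subseteq> U" "f \<in> reg ?X W"
      using * by blast
    then obtain V k where "(V, k) \<in> partial_functions S G" "x \<in> V" "V \<subseteq> W"
      "\<forall>y\<in>V. f y = k y"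
      using reg_generatedD[OF W(3,1)] by (elim exE conjE) (rule that)
    then show "\<exists>V k. (V, k) \<in> partial_functions S G \<and> x \<in> V \<and> V \<subseteq> U \<and> (\<forall>y\<in>V. f y = k y)"
      using W(2) by (intro exI conjI) (assumption | rule order_trans)+
  qed
  have 7: "(\<lambda>x. inverse (f x)) \<in> reg ?X {x \<in> U. f x \<noteq> 0}" if f: "f \<in> reg ?X U" for U f
  proof (rule reg_generatedI)
    fix x
    assume x: "x \<in> {x \<in> U. f x \<noteq> 0}"
    then have "x \<in> U"
      by simp
    from reg_generatedD[OF f this]
    obtain A k where A: "(A, k) \<in> partial_functions S G" "x \<in> A" "A \<subseteq> U" "\<forall>y\<in>A. f y = k y"
      by (elim exE conjE) (rule that)
    show "\<exists>V k. (V, k) \<in> partial_functions S G \<and> x \<in> V \<and> V \<subseteq> {x \<in> U. f x \<noteq> 0} \<and>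
            (\<forall>y\<in>V. inverse (f y) = k y)"
      by (rule exI[of _ "{x \<in> A. k x \<noteq> 0}"], rule exI[of _ "\<lambda>x. inverse (k x)"])
        (use A x partial_functions.inv[OF A(1)] in auto)
  qed
  show ?thesis
    unfolding space_with_functions_def
    by (intro conjI allI impI; (elim conjE)?; (rule 1 2 3 4[THEN conjunct1] 4[THEN conjunct2] 5 6 7; assumption))
qed

lemma generator_reg: "(U, f) \<in> G \<Longrightarrow> f \<in> reg (generated_fspace S G) (S \<inter> U)"
  by (intro partial_functions_reg partial_functions.generator)

lemma preimage_Int: "{x \<in> A. m x \<in> U} \<inter> {x \<in> A. m x \<in> V} = {x \<in> A. m x \<in> U \<inter> V}"
  by blast

text \<open>The universal property of the generated structure. Pulling back commutes with sums,
  products and inverses, so regularity passes from the generators to all partial functions by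
  induction, and by gluing to the sections, which are locally of this kind.\<close>

lemma morphism_generatedI:
  assumes X: "space_with_functions X"
    and m: "\<And>x. x \<in> points X \<Longrightarrow> m x \<in> S"
    and G: "\<And>U g. (U, g) \<in> G \<Longrightarrow> (\<lambda>x. g (m x)) \<in> reg X {x \<in> points X. m x \<in> U}"
  shows "fs_morphism X (generated_fspace S G) m"
proof -
  have *: "(\<lambda>x. g (m x)) \<in> reg X {x \<in> points X. m x \<in> U}" if "(U, g) \<in> partial_functions S G" for U g
    using that
  proof (induction rule: partial_functions.induct)
    case (generator U f)
    have "{x \<in> points X. m x \<in> S \<inter> U} = {x \<in> points X. m x \<in> U}"
      using m by blast
    then show ?case
      using G[OF generator] by (simp only:)
  next
    case (const c)
    have "{x \<in> points X. m x \<in> S} = points X"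
      using m by blast
    then show ?case
      by (simp add: reg_const[OF X])
  next
    case (add U f V g)
    have 1: "openin (zar X) {x \<in> points X. m x \<in> U \<inter> V}"
      using openin_Int[OF add.IH[THEN reg_openin[OF X]]] unfolding preimage_Int .
    show ?case
      by (rule reg_add[OF X]; rule reg_subset[OF X _ 1]) (use add.IH in auto)
  next
    case (mult U f V g)
    have 1: "openin (zar X) {x \<in> points X. m x \<in> U \<inter> V}"
      using openin_Int[OF mult.IH[THEN reg_openin[OF X]]] unfolding preimage_Int .
    show ?case
      by (rule reg_mult[OF X]; rule reg_subset[OF X _ 1]) (use mult.IH in auto)
  next
    case (inv U f)
    have "{x \<in> {x \<in> points X. m x \<in> U}. f (m x) \<noteq> 0} = {x \<in> points X. m x \<in> {x \<in> U. f x \<noteq> 0}}"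
      by blast
    with reg_inverse[OF X inv.IH] show ?case
      by simp
  qed
  show ?thesis
  proof (rule morphism_regI[OF X swf_generated])
    show "m x \<in> points (generated_fspace S G)" if "x \<in> points X" for x
      using m[OF that] by simp
    fix U g
    assume g: "g \<in> reg (generated_fspace S G) U"
    show "(\<lambda>x. g (m x)) \<in> reg X {x \<in> points X. m x \<in> U}"
    proof (rule reg_glue[OF X])
      fix x
      assume x: "x \<in> {x \<in> points X. m x \<in> U}"
      then have "m x \<in> U"
        by simp
      from reg_generatedD[OF g this]
      obtain V k where V: "(V, k) \<in> partial_functions S G" "m x \<in> V" "V \<subseteq> U"
        "\<forall>y\<in>V. g y = k y"
        by (elim exE conjE) (rule that)
      have "(\<lambda>x. g (m x)) \<in> reg X {x \<in> points X. m x \<in> V}"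
        by (rule reg_cong[OF X *[OF V(1)]]) (use V(4) in auto)
      then show "\<exists>V. x \<in> V \<and> V \<subseteq> {x \<in> points X. m x \<in> U} \<and> (\<lambda>x. g (m x)) \<in> reg X V"
        by (intro exI[of _ "{x \<in> points X. m x \<in> V}"]) (use x V in auto)
    qed
  qed
qed

subsection \<open>Subspaces, products and powers\<close>

lemma points_fs_sub [simp]: "points (fs_sub X S) = S"
  by (simp add: fs_sub_def)

lemma swf_sub [simp]: "space_with_functions (fs_sub X S)"
  by (simp add: fs_sub_def)

lemma reg_fs_subI: "f \<in> reg X U \<Longrightarrow> f \<in> reg (fs_sub X S) (S \<inter> U)"
  unfolding fs_sub_def by (rule generator_reg) simp

lemma fs_sub_inclusion:
  assumes X: "space_with_functions X" and S: "S \<subseteq> points X"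
  shows "fs_morphism (fs_sub X S) X (\<lambda>x. x)"
proof (rule morphism_regI[OF swf_sub X])
  show "x \<in> points X" if "x \<in> points (fs_sub X S)" for x
    using that S by auto
  fix U g
  assume "g \<in> reg X U"
  moreover have "{x \<in> points (fs_sub X S). x \<in> U} = S \<inter> U"
    by auto
  ultimately show "g \<in> reg (fs_sub X S) {x \<in> points (fs_sub X S). x \<in> U}"
    using reg_fs_subI by (simp only:)
qed

lemma morphism_into_sub:
  assumes W: "space_with_functions W" and m: "fs_morphism W X m"
    and S: "\<And>w. w \<in> points W \<Longrightarrow> m w \<in> S"
  shows "fs_morphism W (fs_sub X S) m"
  unfolding fs_sub_def
proof (rule morphism_generatedI[OF W S])
  fix U g
  assume "(U, g) \<in> {(U, f). f \<in> reg X U}"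
  then show "(\<lambda>x. g (m x)) \<in> reg W {x \<in> points W. m x \<in> U}"
    by (intro morphism_reg[OF m]) simp
qed

lemma morphism_restrict:
  assumes "space_with_functions X" "S \<subseteq> points X" "fs_morphism X Y f"
  shows "fs_morphism (fs_sub X S) Y f"
  using morphism_comp[OF fs_sub_inclusion[OF assms(1,2)] assms(3)] .

text \<open>Sections of a subspace are built from restrictions of sections of \<open>X\<close>. When
  \<open>S\<close> is open these restrictions are sections of \<open>X\<close> again, and the ring
  operations, inversion and gluing do not lead out of them.\<close>

lemma reg_fs_sub_openD:
  assumes X: "space_with_functions X" and S: "openin (zar X) S" and f: "f \<in> reg (fs_sub X S) U"
  shows "f \<in> reg X U"
proof -
  let ?G = "{(U, f). f \<in> reg X U}"
  have *: "g \<in> reg X V" if "(V, g) \<in> partial_functions S ?G" for V g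
    using that
  proof (induction rule: partial_functions.induct)
    case (generator U f)
    then have f: "f \<in> reg X U"
      by simp
    show ?case
      by (rule reg_subset[OF X f openin_Int[OF S reg_openin[OF X f]]]) simp
  next
    case (const c)
    show ?case
      by (rule reg_const[OF X S])
  next
    case (add U f V g)
    have 1: "openin (zar X) (U \<inter> V)"
      by (rule openin_Int[OF add.IH[THEN reg_openin[OF X]]])
    show ?case
      by (rule reg_add[OF X]; rule reg_subset[OF X _ 1]) (use add.IH in auto)
  next
    case (mult U f V g)
    have 1: "openin (zar X) (U \<inter> V)"
      by (rule openin_Int[OF mult.IH[THEN reg_openin[OF X]]])
    show ?case
      by (rule reg_mult[OF X]; rule reg_subset[OF X _ 1]) (use mult.IH in auto)
  next
    case (inv U f)
    show ?case
      by (rule reg_inverse[OF X inv.IH])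
  qed
  show ?thesis
  proof (rule reg_glue[OF X])
    fix x
    assume "x \<in> U"
    from reg_generatedD[OF f[unfolded fs_sub_def] this]
    obtain V g where V: "(V, g) \<in> partial_functions S ?G" "x \<in> V" "V \<subseteq> U" "\<forall>y\<in>V. f y = g y"
      by (elim exE conjE) (rule that)
    have "f \<in> reg X V"
      by (rule reg_cong[OF X *[OF V(1)]]) (use V(4) in auto)
    then show "\<exists>V. x \<in> V \<and> V \<subseteq> U \<and> f \<in> reg X V"
      using V(2,3) by (intro exI[of _ V] conjI)
  qed
qed

lemma openin_fs_sub_openD:
  assumes X: "space_with_functions X" and S: "openin (zar X) S" and U: "openin (zar (fs_sub X S)) U"
  shows "openin (zar X) U"
  by (rule reg_openin[OF X reg_fs_sub_openD[OF X S reg_const[OF swf_sub U, of 0]]])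

lemma morphism_sub_openin:
  assumes "space_with_functions X" "openin (zar X) S" "fs_morphism (fs_sub X S) Y f" "openin (zar Y) U"
  shows "openin (zar X) {x \<in> S. f x \<in> U}"
  using openin_fs_sub_openD[OF assms(1,2) morphism_openin[OF assms(3,4)]] by simp

lemma morphism_sub_reg:
  assumes "space_with_functions X" "openin (zar X) S" "fs_morphism (fs_sub X S) Y f" "g \<in> reg Y U"
  shows "(\<lambda>x. g (f x)) \<in> reg X {x \<in> S. f x \<in> U}"
  using reg_fs_sub_openD[OF assms(1,2) morphism_reg[OF assms(3,4)]] by simp

lemma reg_fs_sub_subset:
  assumes "f \<in> reg X U" "U \<subseteq> S"
  shows "f \<in> reg (fs_sub X S) U"
  using reg_fs_subI[OF assms(1), of S] assms(2) by (simp add: Int_absorb1)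

lemma points_fs_prod [simp]: "points (fs_prod X Y) = points X \<times> points Y"
  by (simp add: fs_prod_def)

lemma swf_prod [simp]: "space_with_functions (fs_prod X Y)"
  by (simp add: fs_prod_def)

lemma morphism_fst:
  assumes X: "space_with_functions X"
  shows "fs_morphism (fs_prod X Y) X fst"
proof (rule morphism_regI[OF swf_prod X])
  fix U f
  assume "f \<in> reg X U"
  then have "(f \<circ> fst) \<in> reg (fs_prod X Y) (points X \<times> points Y \<inter> fst -` U)"
    unfolding fs_prod_def by (intro generator_reg) auto
  moreover have "points X \<times> points Y \<inter> fst -` U = {p \<in> points (fs_prod X Y). fst p \<in> U}"
    by auto
  ultimately show "(\<lambda>p. f (fst p)) \<in> reg (fs_prod X Y) {p \<in> points (fs_prod X Y). fst p \<in> U}"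
    by (simp only: comp_def)
qed auto

lemma morphism_snd:
  assumes Y: "space_with_functions Y"
  shows "fs_morphism (fs_prod X Y) Y snd"
proof (rule morphism_regI[OF swf_prod Y])
  fix U f
  assume "f \<in> reg Y U"
  then have "(f \<circ> snd) \<in> reg (fs_prod X Y) (points X \<times> points Y \<inter> snd -` U)"
    unfolding fs_prod_def by (intro generator_reg) auto
  moreover have "points X \<times> points Y \<inter> snd -` U = {p \<in> points (fs_prod X Y). snd p \<in> U}"
    by auto
  ultimately show "(\<lambda>p. f (snd p)) \<in> reg (fs_prod X Y) {p \<in> points (fs_prod X Y). snd p \<in> U}"
    by (simp only: comp_def)
qed auto

lemma morphism_Pair:
  assumes W: "space_with_functions W" and f: "fs_morphism W X f" and g: "fs_morphism W Y g"
  shows "fs_morphism W (fs_prod X Y) (\<lambda>w. (f w, g w))"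
  unfolding fs_prod_def
proof (rule morphism_generatedI[OF W])
  show "(f w, g w) \<in> points X \<times> points Y" if "w \<in> points W" for w
    using morphism_in_points[OF f that] morphism_in_points[OF g that] by simp
  fix U k
  assume "(U, k) \<in> {(fst -` U, f \<circ> fst) | U f. f \<in> reg X U} \<union> {(snd -` V, g \<circ> snd) | V g. g \<in> reg Y V}"
  then consider A l where "U = fst -` A" "k = l \<circ> fst" "l \<in> reg X A"
    | A l where "U = snd -` A" "k = l \<circ> snd" "l \<in> reg Y A"
    by blast
  then show "(\<lambda>x. k (f x, g x)) \<in> reg W {x \<in> points W. (f x, g x) \<in> U}"
  proof cases
    case 1
    then show ?thesis
      using morphism_reg[OF f 1(3)] by (simp add: vimage_def)
  next
    case 2
    then show ?thesis
      using morphism_reg[OF g 2(3)] by (simp add: vimage_def)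
  qed
qed

lemma points_fs_power [simp]: "points (fs_power X) = {h. \<forall>i. h i \<in> points X}"
  by (simp add: fs_power_def)

lemma swf_power [simp]: "space_with_functions (fs_power X)"
  by (simp add: fs_power_def)

lemma morphism_power_component:
  assumes X: "space_with_functions X"
  shows "fs_morphism (fs_power X) X (\<lambda>h. h i)"
proof (rule morphism_regI[OF swf_power X])
  fix U f
  assume "f \<in> reg X U"
  then have "(\<lambda>h. f (h i)) \<in> reg (fs_power X) ({h. \<forall>i. h i \<in> points X} \<inter> {h. h i \<in> U})"
    unfolding fs_power_def by (intro generator_reg) auto
  moreover have "{h. \<forall>i. h i \<in> points X} \<inter> {h. h i \<in> U} = {h \<in> points (fs_power X). h i \<in> U}"
    by auto
  ultimately show "(\<lambda>h. f (h i)) \<in> reg (fs_power X) {h \<in> points (fs_power X). h i \<in> U}"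
    by (simp only:)
qed auto

lemma morphism_into_power:
  fixes m :: "'w \<Rightarrow> 'i \<Rightarrow> 'a"
  assumes W: "space_with_functions W" and m: "\<And>i. fs_morphism W X (\<lambda>w. m w i)"
  shows "fs_morphism W (fs_power X) m"
  unfolding fs_power_def
proof (rule morphism_generatedI[OF W])
  show "m w \<in> {h. \<forall>i. h i \<in> points X}" if "w \<in> points W" for w
    using morphism_in_points[OF m that] by simp
  fix U :: "('i \<Rightarrow> 'a) set" and k
  assume "(U, k) \<in> {({h. h i \<in> U}, \<lambda>h. f (h i)) | i U f. f \<in> reg X U}"
  then obtain i A f where "U = {h. h i \<in> A}" "k = (\<lambda>h. f (h i))" "f \<in> reg X A"
    by blast
  then show "(\<lambda>w. k (m w)) \<in> reg W {w \<in> points W. m w \<in> U}"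
    using morphism_reg[OF m] by simp
qed

subsection \<open>Affine and projective space\<close>

text \<open>With the coordinates as generators, defined everywhere, the sections are locally
  quotients of polynomials.\<close>

definition affine_space :: "('i \<Rightarrow> complex) fspace" where
  "affine_space = generated_fspace UNIV {(UNIV, \<lambda>x. x i) | i. True}"

lemma points_affine_space [simp]: "points affine_space = UNIV"
  by (simp add: affine_space_def)

lemma swf_affine [simp]: "space_with_functions affine_space"
  by (simp add: affine_space_def)

lemma reg_affine_component: "(\<lambda>x. x i) \<in> reg affine_space UNIV"
  using generator_reg[of UNIV "\<lambda>x. x i" "{(UNIV, \<lambda>x. x i) | i. True}" UNIV]
  by (auto simp: affine_space_def)

lemma morphism_into_affine:
  fixes m :: "'w \<Rightarrow> 'i \<Rightarrow> complex"
  assumes W: "space_with_functions W" and m: "\<And>i. (\<lambda>w. m w i) \<in> reg W (points W)"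
  shows "fs_morphism W affine_space m"
  unfolding affine_space_def
proof (rule morphism_generatedI[OF W])
  fix U :: "('i \<Rightarrow> complex) set" and g :: "('i \<Rightarrow> complex) \<Rightarrow> complex"
  assume "(U, g) \<in> {(UNIV, \<lambda>x. x i) | i. True}"
  then obtain i where "U = UNIV" "g = (\<lambda>x. x i)"
    by blast
  then show "(\<lambda>x. g (m x)) \<in> reg W {x \<in> points W. m x \<in> U}"
    using m[of i] by simp
qed simp

text \<open>\<open>hc\<close> picks a representative by choice, so it is known only up to a scalar;
  later computations carry this unknown \<open>c\<close> along until it cancels.\<close>

lemma hc_proj_pt: "\<exists>c. c \<noteq> 0 \<and> hc (proj_pt v) = (\<lambda>i. c * v i)"
proof -
  have "v \<in> proj_pt v"
    unfolding proj_pt_def by (auto intro!: exI[of _ 1])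
  then have "hc (proj_pt v) \<in> proj_pt v"
    unfolding hc_def by (rule someI[where P = "\<lambda>w. w \<in> proj_pt v"])
  then show ?thesis
    unfolding proj_pt_def by blast
qed

lemma proj_pt_scale:
  assumes "c \<noteq> 0"
  shows "proj_pt (\<lambda>i. c * v i) = proj_pt v"
proof -
  have "\<exists>d. w = (\<lambda>i. d * v i) \<and> d \<noteq> 0" if "w = (\<lambda>i. d * (c * v i))" "d \<noteq> 0" for w d
    using that assms by (intro exI[of _ "d * c"]) (simp add: mult.assoc)
  moreover have "\<exists>d. w = (\<lambda>i. d * (c * v i)) \<and> d \<noteq> 0" if "w = (\<lambda>i. d * v i)" "d \<noteq> 0" for w d
    using that assms by (intro exI[of _ "d / c"]) simp
  ultimately show ?thesis
    unfolding proj_pt_def by blast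
qed

lemma points_proj_space [simp]: "points (proj_space n) = proj_points n"
  by (simp add: proj_space_def)

lemma swf_proj [simp]: "space_with_functions (proj_space n)"
  by (simp add: proj_space_def)

lemma proj_pt_in_points:
  "(\<And>i. i > n \<Longrightarrow> v i = 0) \<Longrightarrow> i \<le> n \<Longrightarrow> v i \<noteq> 0 \<Longrightarrow> proj_pt v \<in> proj_points n"
  unfolding proj_points_def by blast

lemma proj_pt_hc:
  assumes "p \<in> proj_points n"
  shows "proj_pt (hc p) = p"
proof -
  obtain v where v: "p = proj_pt v"
    using assms unfolding proj_points_def by blast
  obtain c where c: "c \<noteq> 0" "hc (proj_pt v) = (\<lambda>i. c * v i)"
    using hc_proj_pt by blast
  show ?thesis
    unfolding v c(2) by (rule proj_pt_scale[OF c(1)])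
qed

lemma hc_proj_points:
  assumes "p \<in> proj_points n"
  shows "i > n \<Longrightarrow> hc p i = 0" "\<exists>i\<le>n. hc p i \<noteq> 0"
proof -
  obtain v where v: "p = proj_pt v" "\<forall>i>n. v i = 0" "\<exists>i\<le>n. v i \<noteq> 0"
    using assms unfolding proj_points_def by blast
  obtain c where c: "c \<noteq> 0" "hc (proj_pt v) = (\<lambda>i. c * v i)"
    using hc_proj_pt by blast
  show "i > n \<Longrightarrow> hc p i = 0" "\<exists>i\<le>n. hc p i \<noteq> 0"
    using v c by auto
qed

lemma hc_P1_nonzero: "p \<in> proj_points 1 \<Longrightarrow> hc p 0 \<noteq> 0 \<or> hc p 1 \<noteq> 0"
  using hc_proj_points(2)[of p 1] by (auto simp: le_Suc_eq)

lemma hc_ratio_reg: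
  assumes "i \<le> n" "j \<le> n"
  shows "(\<lambda>p. hc p i / hc p j) \<in> reg (proj_space n) (proj_points n \<inter> {p. hc p j \<noteq> 0})"
  unfolding proj_space_def by (rule generator_reg) (use assms in blast)

lemma morphism_hc_ratio_reg:
  assumes g: "fs_morphism W (proj_space n) g" and "i \<le> n" "j \<le> n"
  shows "(\<lambda>w. hc (g w) i / hc (g w) j) \<in> reg W {w \<in> points W. hc (g w) j \<noteq> 0}"
proof -
  have "{w \<in> points W. g w \<in> proj_points n \<inter> {p. hc p j \<noteq> 0}} = {w \<in> points W. hc (g w) j \<noteq> 0}"
    using morphism_in_points[OF g] by auto
  then show ?thesis
    using morphism_reg[OF g hc_ratio_reg[OF assms(2,3)]] by (simp only:)
qed

text \<open>The quotient is homogeneous of degree 0 in \<open>hc (g w)\<close>. Near a given point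
  some \<open>hc (g w) k\<close> is nonzero, and numerator and denominator become regular once
  divided by it. The case \<open>a = b\<close> shows that the locus where such a form is nonzero is
  open.\<close>

lemma linear_ratio_reg:
  assumes W: "space_with_functions W" and g: "fs_morphism W (proj_space n) g"
    and V: "openin (zar W) V"
    and a: "\<And>i. i \<le> n \<Longrightarrow> a i \<in> reg W V" and b: "\<And>i. i \<le> n \<Longrightarrow> b i \<in> reg W V"
  shows "(\<lambda>w. (\<Sum>i\<le>n. a i w * hc (g w) i) / (\<Sum>i\<le>n. b i w * hc (g w) i)) \<in>
    reg W {w \<in> V. (\<Sum>i\<le>n. b i w * hc (g w) i) \<noteq> 0}"
proof (rule reg_glue[OF W])
  let ?A = "\<lambda>w. \<Sum>i\<le>n. a i w * hc (g w) i" and ?B = "\<lambda>w. \<Sum>i\<le>n. b i w * hc (g w) i"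
  fix w
  assume w: "w \<in> {w \<in> V. ?B w \<noteq> 0}"
  have "w \<in> points W"
    using w openin_subset[OF V] by blast
  then have "g w \<in> proj_points n"
    using morphism_in_points[OF g] by simp
  then obtain k where k: "k \<le> n" "hc (g w) k \<noteq> 0"
    using hc_proj_points(2) by blast
  define D where "D = {w \<in> points W. hc (g w) k \<noteq> 0} \<inter> V"
  have ratio: "(\<lambda>w. hc (g w) i / hc (g w) k) \<in> reg W {w \<in> points W. hc (g w) k \<noteq> 0}" if "i \<le> n" for i
    by (rule morphism_hc_ratio_reg[OF g that k(1)])
  have D: "openin (zar W) D"
    unfolding D_def by (rule openin_Int[OF reg_openin[OF W ratio[OF k(1)]] V])
  have lin: "(\<lambda>w. \<Sum>i\<le>n. c i w * (hc (g w) i / hc (g w) k)) \<in> reg W D"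
    if "\<And>i. i \<le> n \<Longrightarrow> c i \<in> reg W V" for c
  proof (rule reg_sum[OF W D])
    fix i
    assume "i \<in> {..n}"
    then have i: "i \<le> n"
      by simp
    show "(\<lambda>w. c i w * (hc (g w) i / hc (g w) k)) \<in> reg W D"
      by (rule reg_mult[OF W reg_subset[OF W that[OF i] D] reg_subset[OF W ratio[OF i] D]])
        (auto simp: D_def)
  qed
  have eq: "(\<Sum>i\<le>n. c i w * (hc (g w) i / hc (g w) k)) = (\<Sum>i\<le>n. c i w * hc (g w) i) / hc (g w) k" for c w
    by (simp add: sum_divide_distrib)
  let ?b = "\<lambda>w. \<Sum>i\<le>n. b i w * (hc (g w) i / hc (g w) k)"
  define E where "E = {w \<in> D. ?b w \<noteq> 0}"
  have E: "openin (zar W) E"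
    unfolding E_def by (rule reg_nonzero_openin[OF W lin[OF b]])
  have "(\<lambda>w. (\<Sum>i\<le>n. a i w * (hc (g w) i / hc (g w) k)) / ?b w) \<in> reg W E"
    by (rule reg_divide[OF W reg_subset[OF W lin[OF a] E] reg_subset[OF W lin[OF b] E]])
      (auto simp: E_def)
  then have "(\<lambda>w. ?A w / ?B w) \<in> reg W E"
    by (rule reg_cong[OF W]) (auto simp: E_def D_def simp flip: sum_divide_distrib)
  moreover have "w \<in> E"
    unfolding E_def D_def eq using w k \<open>w \<in> points W\<close> by simp
  moreover have "E \<subseteq> {w \<in> V. ?B w \<noteq> 0}"
    unfolding E_def D_def eq by auto
  ultimately show "\<exists>E. w \<in> E \<and> E \<subseteq> {w \<in> V. ?B w \<noteq> 0} \<and> (\<lambda>w. ?A w / ?B w) \<in> reg W E"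
    by (intro exI[of _ E] conjI)
qed

lemma morphism_into_proj:
  assumes W: "space_with_functions W" and v: "\<And>i. i \<le> n \<Longrightarrow> (\<lambda>w. v w i) \<in> reg W (points W)"
    and zero: "\<And>w i. w \<in> points W \<Longrightarrow> i > n \<Longrightarrow> v w i = 0"
    and nz: "\<And>w. w \<in> points W \<Longrightarrow> \<exists>i\<le>n. v w i \<noteq> 0"
  shows "fs_morphism W (proj_space n) (\<lambda>w. proj_pt (v w))"
  unfolding proj_space_def
proof (rule morphism_generatedI[OF W])
  show "proj_pt (v w) \<in> proj_points n" if w: "w \<in> points W" for w
    using nz[OF w] proj_pt_in_points[OF zero[OF w]] by (elim exE conjE)
  fix U k
  assume "(U, k) \<in> {({p. hc p j \<noteq> 0}, \<lambda>p. hc p i / hc p j) | i j. i \<le> n \<and> j \<le> n}"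
  then obtain i j where ij: "U = {p. hc p j \<noteq> 0}" "k = (\<lambda>p. hc p i / hc p j)" "i \<le> n" "j \<le> n"
    by blast
  have hc: "(hc (proj_pt (v w)) j \<noteq> 0 \<longleftrightarrow> v w j \<noteq> 0) \<and>
      hc (proj_pt (v w)) i / hc (proj_pt (v w)) j = v w i / v w j" for w
  proof -
    obtain c where "c \<noteq> 0" "hc (proj_pt (v w)) = (\<lambda>i. c * v w i)"
      using hc_proj_pt by blast
    then show ?thesis
      by simp
  qed
  have "openin (zar W) {w \<in> points W. v w j \<noteq> 0}"
    by (rule reg_nonzero_openin[OF W v[OF ij(4)]])
  then have "(\<lambda>w. v w i / v w j) \<in> reg W {w \<in> points W. v w j \<noteq> 0}"
    by (intro reg_divide[OF W] reg_subset[OF W v] ij) auto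
  then show "(\<lambda>w. k (proj_pt (v w))) \<in> reg W {w \<in> points W. proj_pt (v w) \<in> U}"
    unfolding ij(1,2) using hc by simp
qed

text \<open>An equation that is linear in the projective coordinates, with regular coefficients, is
  a closed condition over \<open>V\<close>, so it passes from \<open>A\<close> to its closure. It
  fails exactly on \<open>T\<close>, which is open as the domain of the form divided by
  itself.\<close>

lemma closure_linear_condition:
  assumes X: "space_with_functions X" and V: "openin (zar X) V" "V \<subseteq> U"
    and m: "\<And>j. j \<le> r \<Longrightarrow> m j \<in> reg X V" and UX: "U \<subseteq> points X"
    and A: "\<And>y w. (y, w) \<in> A \<Longrightarrow> y \<in> V \<Longrightarrow> (\<Sum>j\<le>r. m j y * hc w j) = 0"
    and p: "(y, w) \<in> zar (fs_prod (fs_sub X U) (proj_space r)) closure_of A" "y \<in> V"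
  shows "(\<Sum>j\<le>r. m j y * hc w j) = 0"
proof (rule ccontr)
  let ?P = "fs_prod (fs_sub X U) (proj_space r)"
  assume nz: "(\<Sum>j\<le>r. m j y * hc w j) \<noteq> 0"
  have fst: "fs_morphism ?P X fst"
    by (rule morphism_comp[OF morphism_fst fs_sub_inclusion[OF X UX]]) simp
  have snd: "fs_morphism ?P (proj_space r) snd"
    by (rule morphism_snd) simp
  have V': "openin (zar ?P) {p \<in> points ?P. fst p \<in> V}"
    by (rule morphism_openin[OF fst V(1)])
  have m': "(\<lambda>p. m j (fst p)) \<in> reg ?P {p \<in> points ?P. fst p \<in> V}" if "j \<le> r" for j
    by (rule morphism_reg[OF fst m[OF that]])
  define T where "T = {p \<in> {p \<in> points ?P. fst p \<in> V}. (\<Sum>j\<le>r. m j (fst p) * hc (snd p) j) \<noteq> 0}"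
  have "openin (zar ?P) T"
    unfolding T_def
    by (rule reg_openin[OF swf_prod
          linear_ratio_reg[OF swf_prod snd V' m' m']])
  moreover have "(y, w) \<in> T"
    using p nz unfolding T_def by (auto simp: in_closure_of)
  ultimately obtain p where p: "p \<in> A" "p \<in> T"
    using p(1) unfolding in_closure_of by blast
  then have "(fst p, snd p) \<in> A" "fst p \<in> V" "(\<Sum>j\<le>r. m j (fst p) * hc (snd p) j) \<noteq> 0"
    unfolding T_def by auto
  then show False
    using A by blast
qed

subsection \<open>Continuous curves\<close>

text \<open>Maps out of this space are continuous curves for the classical topology; they replace
  density arguments in the Zariski topology.\<close>

definition classical :: "complex set \<Rightarrow> complex fspace" where
  "classical D = \<lparr>zar = top_of_set D, reg = (\<lambda>U. {f. open U \<and> U \<subseteq> D \<and> continuous_on U f})\<rparr>"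

lemma points_classical [simp]: "points (classical D) = D"
  by (simp add: classical_def)

lemma swf_classical:
  assumes D: "open D"
  shows "space_with_functions (classical D)"
proof -
  have open_eq: "openin (zar (classical D)) U \<longleftrightarrow> open U \<and> U \<subseteq> D" for U
    using D by (simp add: classical_def openin_open_eq)
  have reg_eq: "f \<in> reg (classical D) U \<longleftrightarrow> open U \<and> U \<subseteq> D \<and> continuous_on U f" for f U
    by (simp add: classical_def)
  have glue: "open U \<and> U \<subseteq> D \<and> continuous_on U f"
    if "open U \<and> U \<subseteq> D" and *: "\<forall>x\<in>U. \<exists>V. x \<in> V \<and> V \<subseteq> U \<and> open V \<and> V \<subseteq> D \<and> continuous_on V f"
    for U and f :: "complex \<Rightarrow> complex"
  proof (intro conjI)
    show "continuous_on U f"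
    proof (rule continuous_at_imp_continuous_on, intro ballI)
      fix x
      assume "x \<in> U"
      then obtain V where "x \<in> V" "open V" "continuous_on V f"
        using * by blast
      then show "isCont f x"
        by (simp add: continuous_on_eq_continuous_at)
    qed
  qed (use that in auto)
  have inv: "open {x \<in> U. f x \<noteq> 0} \<and> {x \<in> U. f x \<noteq> 0} \<subseteq> D \<and> continuous_on {x \<in> U. f x \<noteq> 0} (\<lambda>x. inverse (f x))"
    if "open U \<and> U \<subseteq> D \<and> continuous_on U f" for U and f :: "complex \<Rightarrow> complex"
  proof (intro conjI)
    have "{x \<in> U. f x \<noteq> 0} = U \<inter> f -` (- {0})"
      by auto
    then show "open {x \<in> U. f x \<noteq> 0}"
      using that by (auto intro: continuous_open_preimage)
    show "continuous_on {x \<in> U. f x \<noteq> 0} (\<lambda>x. inverse (f x))"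
      by (rule continuous_on_inverse) (use that in \<open>auto intro: continuous_on_subset\<close>)
  qed (use that in auto)
  show ?thesis
    unfolding space_with_functions_def open_eq reg_eq
  proof (intro conjI allI impI; (elim conjE)?)
    show "continuous_on U g" if "\<forall>x\<in>U. g x = f x" "continuous_on U f" for U and f g :: "complex \<Rightarrow> complex"
      using that by (metis continuous_on_cong)
    show "continuous_on U f" if "open U" "U \<subseteq> D"
      "\<forall>x\<in>U. \<exists>V. x \<in> V \<and> V \<subseteq> U \<and> open V \<and> V \<subseteq> D \<and> continuous_on V f" for U and f :: "complex \<Rightarrow> complex"
      using glue that by blast
  qed (use inv in \<open>auto intro: continuous_intros continuous_on_subset\<close>)
qed

context
  fixes D :: "complex set"
  assumes D: "open D" "0 \<in> D"
begin

lemma curve_tendsto: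
  assumes c: "fs_morphism (classical D) X c" and g: "g \<in> reg X V" "c 0 \<in> V"
  shows "((\<lambda>t. g (c t)) \<longlongrightarrow> g (c 0)) (at 0)"
proof -
  have "(\<lambda>t. g (c t)) \<in> reg (classical D) {t \<in> points (classical D). c t \<in> V}"
    by (rule morphism_reg[OF c g(1)])
  then have *: "open {t \<in> D. c t \<in> V}" "continuous_on {t \<in> D. c t \<in> V} (\<lambda>t. g (c t))"
    by (simp_all add: classical_def)
  have "isCont (\<lambda>t. g (c t)) 0"
    by (rule continuous_on_interior[OF *(2)]) (simp add: interior_open[OF *(1)] D(2) g(2))
  then show ?thesis
    by (simp add: isCont_def)
qed

lemma curve_eventually:
  assumes c: "fs_morphism (classical D) X c" and V: "openin (zar X) V" "c 0 \<in> V"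
  shows "\<forall>\<^sub>F t in at 0. c t \<in> V"
proof -
  have "openin (top_of_set D) {t \<in> D. c t \<in> V}"
    using morphism_openin[OF c V(1)] by (simp add: classical_def)
  then have "open {t \<in> D. c t \<in> V}"
    using D(1) by (simp add: openin_open_eq)
  then have "\<forall>\<^sub>F t in nhds 0. t \<in> {t \<in> D. c t \<in> V}"
    by (rule eventually_nhds_in_open) (use D V in simp)
  then show ?thesis
    unfolding eventually_at_filter by (rule eventually_mono) simp
qed

text \<open>The preimage of a Zariski open set under the curve is open in the classical topology, so
  every neighbourhood of \<open>c 0\<close> contains \<open>c t\<close> for all small
  \<open>t\<close>, among them nonzero ones.\<close>

lemma curve_in_closure:
  assumes c: "fs_morphism (classical D) X c" and A: "\<And>t. t \<in> D \<Longrightarrow> t \<noteq> 0 \<Longrightarrow> c t \<in> A"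
  shows "c 0 \<in> zar X closure_of A"
  unfolding in_closure_of
proof (intro conjI allI impI)
  show "c 0 \<in> points X"
    using morphism_in_points[OF c] D by simp
  fix T
  assume T: "c 0 \<in> T \<and> openin (zar X) T"
  have "\<forall>\<^sub>F t in at 0. c t \<in> T"
    using curve_eventually[OF c] T by simp
  moreover have "\<forall>\<^sub>F t in at 0. t \<in> D \<and> t \<noteq> 0"
    using eventually_nhds_in_open[OF D] unfolding eventually_at_filter by (rule eventually_mono) simp
  ultimately have "\<forall>\<^sub>F t in at (0::complex). c t \<in> T \<and> c t \<in> A"
    by eventually_elim (use A in simp)
  from eventually_happens'[OF _ this] show "\<exists>y. y \<in> A \<and> y \<in> T"
    by auto
qed

text \<open>Only ratios of projective coordinates are functions, so the limit is taken in the chart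
  of a coordinate \<open>k\<close> that is nonzero at \<open>c 0\<close>. There
  \<open>hc (c t) i / hc (c t) k * L t k = L t i\<close> for small nonzero \<open>t\<close>, and the
  equation survives in the limit.\<close>

lemma curve_proj_limit:
  assumes c: "fs_morphism (classical D) (proj_space n) c"
    and L: "\<And>t. t \<in> D \<Longrightarrow> t \<noteq> 0 \<Longrightarrow> c t = proj_pt (L t)"
    and lim: "\<And>i. i \<le> n \<Longrightarrow> ((\<lambda>t. L t i) \<longlongrightarrow> L 0 i) (at 0)"
    and zero: "\<And>i. i > n \<Longrightarrow> L 0 i = 0" and nz: "L 0 j \<noteq> 0"
  shows "c 0 = proj_pt (L 0)"
proof -
  have c0: "c 0 \<in> proj_points n"
    using morphism_in_points[OF c] D by simp
  then obtain k where k: "k \<le> n" "hc (c 0) k \<noteq> 0"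
    using hc_proj_points(2) by blast
  have 1: "hc (c 0) i / hc (c 0) k * L 0 k = L 0 i" if i: "i \<le> n" for i
  proof (rule tendsto_unique)
    show "((\<lambda>t. L t i) \<longlongrightarrow> L 0 i) (at 0)"
      by (rule lim[OF i])
    have "((\<lambda>t. hc (c t) i / hc (c t) k * L t k) \<longlongrightarrow> hc (c 0) i / hc (c 0) k * L 0 k) (at 0)"
      by (intro tendsto_mult lim k curve_tendsto[OF c hc_ratio_reg[OF i k(1)]]) (use c0 k in auto)
    moreover have "\<forall>\<^sub>F t in at 0. hc (c t) i / hc (c t) k * L t k = L t i"
    proof -
      have "\<forall>\<^sub>F t in at 0. c t \<in> proj_points n \<inter> {p. hc p k \<noteq> 0}"
        by (rule curve_eventually[OF c reg_openin[OF _ hc_ratio_reg[OF k(1) k(1)]]]) (use c0 k in auto)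
      moreover have "\<forall>\<^sub>F t in at 0. t \<in> D \<and> t \<noteq> 0"
        using eventually_nhds_in_open[OF D] unfolding eventually_at_filter by (rule eventually_mono) simp
      ultimately show ?thesis
      proof eventually_elim
        case (elim t)
        obtain d where d: "d \<noteq> 0" "hc (proj_pt (L t)) = (\<lambda>i. d * L t i)"
          using hc_proj_pt by blast
        have "hc (c t) = (\<lambda>i. d * L t i)"
          using L elim d by simp
        then show ?case
          using elim d(1) by auto
      qed
    qed
    ultimately show "((\<lambda>t. L t i) \<longlongrightarrow> hc (c 0) i / hc (c 0) k * L 0 k) (at 0)"
      by (rule Lim_transform_eventually)
  qed simp
  \<comment> \<open>If \<open>L 0 k\<close> were 0, the limit equations would make all coordinates
    of \<open>L 0\<close> vanish.\<close>
  have "L 0 k \<noteq> 0"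
    using 1[of j] nz zero[of j] by fastforce
  have 2: "L 0 = (\<lambda>i. L 0 k / hc (c 0) k * hc (c 0) i)"
  proof
    fix i
    show "L 0 i = L 0 k / hc (c 0) k * hc (c 0) i"
      using 1[of i] zero[of i] hc_proj_points(1)[OF c0, of i] by (cases "i \<le> n") (auto simp: mult_ac)
  qed
  have "proj_pt (L 0) = proj_pt (hc (c 0))"
    by (subst 2, rule proj_pt_scale) (use k \<open>L 0 k \<noteq> 0\<close> in simp)
  then show ?thesis
    using proj_pt_hc[OF c0] by simp
qed

end

section \<open>The ideal of a diagonal in affine space\<close>

text \<open>The retraction onto the diagonal where the entries at \<A>, \<B>, \<C> agree;
  \<open>collapse x = x\<close> serves as the equation of that diagonal. The entries have an
  arbitrary type because both parameters and points of the conic occur.\<close>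

definition collapse :: "(letter \<Rightarrow> 'a) \<Rightarrow> letter \<Rightarrow> 'a" where
  "collapse x = x(\<B> := x \<A>, \<C> := x \<A>)"

lemma collapse_apply [simp]:
  "collapse x \<A> = x \<A>" "collapse x \<B> = x \<A>" "collapse x \<C> = x \<A>"
  "collapse x \<D> = x \<D>" "collapse x \<E> = x \<E>" "collapse x \<F> = x \<F>"
  by (simp_all add: collapse_def)

lemma collapse_idem [simp]: "collapse (collapse x) = collapse x"
  by (simp add: collapse_def)

lemma morphism_collapse: "fs_morphism affine_space affine_space collapse"
proof (rule morphism_into_affine)
  fix i :: letter
  have "\<exists>j. (\<lambda>w :: letter \<Rightarrow> complex. collapse w i) = (\<lambda>w. w j)"
    by (cases i) auto
  then show "(\<lambda>w :: letter \<Rightarrow> complex. collapse w i) \<in> reg affine_space (points affine_space)"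
    using reg_affine_component by (metis points_affine_space)
qed simp

text \<open>A division argument along the construction of \<open>f\<close>: the difference between
  \<open>f\<close> and its pullback under the retraction lies in the ideal of the two coordinate
  differences, with regular coefficients. The domain shrinks to the points whose retraction is still
  in \<open>U\<close>, where both terms make sense.\<close>

lemma partial_function_collapse:
  assumes "(U, f) \<in> partial_functions UNIV {(UNIV, \<lambda>x :: letter \<Rightarrow> complex. x i) | i. True}"
  shows "\<exists>\<alpha> \<beta>. \<alpha> \<in> reg affine_space {x \<in> U. collapse x \<in> U} \<and> \<beta> \<in> reg affine_space {x \<in> U. collapse x \<in> U} \<and>
    (\<forall>x\<in>{x \<in> U. collapse x \<in> U}.
      f x - f (collapse x) = \<alpha> x * (x \<A> - x \<B>) + \<beta> x * (x \<A> - x \<C>))"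
  using assms
proof (induction rule: partial_functions.induct)
  case (generator U f)
  then obtain i where i: "U = UNIV" "f = (\<lambda>x. x i)"
    by blast
  have c: "(\<lambda>_. c) \<in> reg affine_space (UNIV :: (letter \<Rightarrow> complex) set)" for c
    using reg_const[OF swf_affine openin_topspace] by simp
  have "\<exists>c d. \<forall>x :: letter \<Rightarrow> complex. x i - collapse x i = c * (x \<A> - x \<B>) + d * (x \<A> - x \<C>)"
  proof (cases i)
    case \<B>
    then show ?thesis
      by (intro exI[of _ "-1"] exI[of _ 0]) simp
  next
    case \<C>
    then show ?thesis
      by (intro exI[of _ 0] exI[of _ "-1"]) simp
  qed (auto intro!: exI[of _ 0])
  then obtain d d' where "\<forall>x :: letter \<Rightarrow> complex. x i - collapse x i = d * (x \<A> - x \<B>) + d' * (x \<A> - x \<C>)"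
    by blast
  then show ?case
    by (intro exI[of _ "\<lambda>_. d"] exI[of _ "\<lambda>_. d'"]) (simp add: i c)
next
  case (const c)
  show ?case
    using reg_const[OF swf_affine openin_topspace]
    by (intro exI[of _ "\<lambda>_. 0"]) simp
next
  case (add U f V g)
  let ?W = "{x \<in> U \<inter> V. collapse x \<in> U \<inter> V}"
  obtain \<alpha> \<beta> where f: "\<alpha> \<in> reg affine_space {x \<in> U. collapse x \<in> U}" "\<beta> \<in> reg affine_space {x \<in> U. collapse x \<in> U}"
    "\<forall>x\<in>{x \<in> U. collapse x \<in> U}. f x - f (collapse x) = \<alpha> x * (x \<A> - x \<B>) + \<beta> x * (x \<A> - x \<C>)"
    using add.IH(1) by (elim exE conjE) (rule that)
  obtain \<alpha>' \<beta>' where g: "\<alpha>' \<in> reg affine_space {x \<in> V. collapse x \<in> V}" "\<beta>' \<in> reg affine_space {x \<in> V. collapse x \<in> V}"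
    "\<forall>x\<in>{x \<in> V. collapse x \<in> V}. g x - g (collapse x) = \<alpha>' x * (x \<A> - x \<B>) + \<beta>' x * (x \<A> - x \<C>)"
    using add.IH(2) by (elim exE conjE) (rule that)
  have W: "openin (zar affine_space) ?W"
    using openin_Int[OF reg_openin[OF swf_affine f(1)] reg_openin[OF swf_affine g(1)]]
    by (rule back_subst) auto
  note r = reg_subset[OF swf_affine _ W]
  show ?case
  proof (rule exI[of _ "\<lambda>x. \<alpha> x + \<alpha>' x"], rule exI[of _ "\<lambda>x. \<beta> x + \<beta>' x"], intro conjI)
    show "(\<lambda>x. \<alpha> x + \<alpha>' x) \<in> reg affine_space ?W"
      by (rule reg_add[OF swf_affine r[OF f(1)] r[OF g(1)]]) auto
    show "(\<lambda>x. \<beta> x + \<beta>' x) \<in> reg affine_space ?W"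
      by (rule reg_add[OF swf_affine r[OF f(2)] r[OF g(2)]]) auto
    show "\<forall>x\<in>?W. f x + g x - (f (collapse x) + g (collapse x)) =
      (\<alpha> x + \<alpha>' x) * (x \<A> - x \<B>) + (\<beta> x + \<beta>' x) * (x \<A> - x \<C>)"
    proof
      fix x
      assume "x \<in> ?W"
      then have "f x - f (collapse x) = \<alpha> x * (x \<A> - x \<B>) + \<beta> x * (x \<A> - x \<C>)"
        "g x - g (collapse x) = \<alpha>' x * (x \<A> - x \<B>) + \<beta>' x * (x \<A> - x \<C>)"
        using f(3) g(3) by auto
      then show "f x + g x - (f (collapse x) + g (collapse x)) =
        (\<alpha> x + \<alpha>' x) * (x \<A> - x \<B>) + (\<beta> x + \<beta>' x) * (x \<A> - x \<C>)"
        by algebra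
    qed
  qed
next
  case (mult U f V g)
  let ?W = "{x \<in> U \<inter> V. collapse x \<in> U \<inter> V}"
  obtain \<alpha> \<beta> where f: "\<alpha> \<in> reg affine_space {x \<in> U. collapse x \<in> U}" "\<beta> \<in> reg affine_space {x \<in> U. collapse x \<in> U}"
    "\<forall>x\<in>{x \<in> U. collapse x \<in> U}. f x - f (collapse x) = \<alpha> x * (x \<A> - x \<B>) + \<beta> x * (x \<A> - x \<C>)"
    using mult.IH(1) by (elim exE conjE) (rule that)
  obtain \<alpha>' \<beta>' where g: "\<alpha>' \<in> reg affine_space {x \<in> V. collapse x \<in> V}" "\<beta>' \<in> reg affine_space {x \<in> V. collapse x \<in> V}"
    "\<forall>x\<in>{x \<in> V. collapse x \<in> V}. g x - g (collapse x) = \<alpha>' x * (x \<A> - x \<B>) + \<beta>' x * (x \<A> - x \<C>)"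
    using mult.IH(2) by (elim exE conjE) (rule that)
  have W: "openin (zar affine_space) ?W"
    using openin_Int[OF reg_openin[OF swf_affine f(1)] reg_openin[OF swf_affine g(1)]]
    by (rule back_subst) auto
  note r = reg_subset[OF swf_affine _ W]
  have f': "(\<lambda>x. f (collapse x)) \<in> reg affine_space ?W"
    by (rule r[OF morphism_reg[OF morphism_collapse
            partial_functions_reg[OF mult.hyps(1), folded affine_space_def]]]) auto
  have g': "g \<in> reg affine_space ?W"
    by (rule r[OF partial_functions_reg[OF mult.hyps(2), folded affine_space_def]]) auto
  \<comment> \<open>The product rule for differences: with \<open>f'\<close>, \<open>g'\<close> for
    the retracted values, \<open>f g - f' g' = (f - f') g + f' (g - g')\<close>.\<close>
  show ?case
  proof (rule exI[of _ "\<lambda>x. \<alpha> x * g x + f (collapse x) * \<alpha>' x"],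
      rule exI[of _ "\<lambda>x. \<beta> x * g x + f (collapse x) * \<beta>' x"], intro conjI)
    show "(\<lambda>x. \<alpha> x * g x + f (collapse x) * \<alpha>' x) \<in> reg affine_space ?W"
      by (rule reg_add[OF swf_affine
            reg_mult[OF swf_affine r[OF f(1)] g']
            reg_mult[OF swf_affine f' r[OF g(1)]]]) auto
    show "(\<lambda>x. \<beta> x * g x + f (collapse x) * \<beta>' x) \<in> reg affine_space ?W"
      by (rule reg_add[OF swf_affine
            reg_mult[OF swf_affine r[OF f(2)] g']
            reg_mult[OF swf_affine f' r[OF g(2)]]]) auto
    show "\<forall>x\<in>?W. f x * g x - f (collapse x) * g (collapse x) =
      (\<alpha> x * g x + f (collapse x) * \<alpha>' x) * (x \<A> - x \<B>) +
      (\<beta> x * g x + f (collapse x) * \<beta>' x) * (x \<A> - x \<C>)"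
    proof
      fix x
      assume "x \<in> ?W"
      then have "f x - f (collapse x) = \<alpha> x * (x \<A> - x \<B>) + \<beta> x * (x \<A> - x \<C>)"
        "g x - g (collapse x) = \<alpha>' x * (x \<A> - x \<B>) + \<beta>' x * (x \<A> - x \<C>)"
        using f(3) g(3) by auto
      then show "f x * g x - f (collapse x) * g (collapse x) =
        (\<alpha> x * g x + f (collapse x) * \<alpha>' x) * (x \<A> - x \<B>) +
        (\<beta> x * g x + f (collapse x) * \<beta>' x) * (x \<A> - x \<C>)"
        by algebra
    qed
  qed
next
  case (inv U f)
  let ?V = "{x \<in> U. f x \<noteq> 0}"
  let ?W = "{x \<in> ?V. collapse x \<in> ?V}"
  obtain \<alpha> \<beta> where f: "\<alpha> \<in> reg affine_space {x \<in> U. collapse x \<in> U}" "\<beta> \<in> reg affine_space {x \<in> U. collapse x \<in> U}"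
    "\<forall>x\<in>{x \<in> U. collapse x \<in> U}. f x - f (collapse x) = \<alpha> x * (x \<A> - x \<B>) + \<beta> x * (x \<A> - x \<C>)"
    using inv.IH by (elim exE conjE) (rule that)
  have freg: "f \<in> reg affine_space U"
    by (rule partial_functions_reg[OF inv.hyps, folded affine_space_def])
  have V: "openin (zar affine_space) ?V"
    by (rule reg_nonzero_openin[OF swf_affine freg])
  have W: "openin (zar affine_space) ?W"
    using openin_Int[OF V morphism_openin[OF morphism_collapse V]] by (rule back_subst) auto
  note r = reg_subset[OF swf_affine _ W]
  have ff: "(\<lambda>x. f x * f (collapse x)) \<in> reg affine_space ?W"
    by (rule reg_mult[OF swf_affine r[OF freg] r[OF morphism_reg[OF morphism_collapse freg]]]) auto
  have m1: "(\<lambda>_. -1) \<in> reg affine_space ?W"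
    by (rule reg_const[OF swf_affine W])
  \<comment> \<open>The coefficients come from \<open>1 / f - 1 / f' = - (f - f') / (f f')\<close>,
    with \<open>f'\<close> for the retracted value.\<close>
  show ?case
  proof (rule exI[of _ "\<lambda>x. -1 * \<alpha> x / (f x * f (collapse x))"],
      rule exI[of _ "\<lambda>x. -1 * \<beta> x / (f x * f (collapse x))"], intro conjI)
    show "(\<lambda>x. -1 * \<alpha> x / (f x * f (collapse x))) \<in> reg affine_space ?W"
      by (rule reg_divide[OF swf_affine
            reg_mult[OF swf_affine m1 r[OF f(1)]] ff]) auto
    show "(\<lambda>x. -1 * \<beta> x / (f x * f (collapse x))) \<in> reg affine_space ?W"
      by (rule reg_divide[OF swf_affine
            reg_mult[OF swf_affine m1 r[OF f(2)]] ff]) auto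
    show "\<forall>x\<in>?W. inverse (f x) - inverse (f (collapse x)) =
      -1 * \<alpha> x / (f x * f (collapse x)) * (x \<A> - x \<B>) + -1 * \<beta> x / (f x * f (collapse x)) * (x \<A> - x \<C>)"
    proof
      fix x
      assume x: "x \<in> ?W"
      then have eq: "f x - f (collapse x) = \<alpha> x * (x \<A> - x \<B>) + \<beta> x * (x \<A> - x \<C>)"
        using f(3) by auto
      have "inverse (f x) - inverse (f (collapse x)) = - (f x - f (collapse x)) / (f x * f (collapse x))"
        using x by (simp add: field_simps)
      then show "inverse (f x) - inverse (f (collapse x)) =
        -1 * \<alpha> x / (f x * f (collapse x)) * (x \<A> - x \<B>) + -1 * \<beta> x / (f x * f (collapse x)) * (x \<A> - x \<C>)"
        unfolding eq by (simp add: diff_divide_distrib add_divide_distrib)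
    qed
  qed
qed

text \<open>Where the retraction of \<open>y\<close> stays in the domain, the value subtracted in
  \<open>partial_function_collapse\<close> is zero. In other words, near its points the diagonal has
  its ideal generated by the two coordinate differences.\<close>

lemma reg_vanishing_on_diagonal:
  assumes f: "f \<in> reg affine_space U" and x: "x \<in> U" "collapse x = x"
    and zero: "\<And>y. y \<in> U \<Longrightarrow> collapse y = y \<Longrightarrow> f y = 0"
  shows "\<exists>W \<alpha> \<beta>. x \<in> W \<and> W \<subseteq> U \<and> \<alpha> \<in> reg affine_space W \<and> \<beta> \<in> reg affine_space W \<and>
    (\<forall>y\<in>W. f y = \<alpha> y * (y \<A> - y \<B>) + \<beta> y * (y \<A> - y \<C>))"
proof -
  from reg_generatedD[OF f[unfolded affine_space_def] x(1)]
  obtain V g where V: "(V, g) \<in> partial_functions UNIV {(UNIV, \<lambda>x :: letter \<Rightarrow> complex. x i) | i. True}"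
    "x \<in> V" "V \<subseteq> U" "\<forall>y\<in>V. f y = g y"
    by (elim exE conjE) (rule that)
  from partial_function_collapse[OF V(1)]
  obtain \<alpha> \<beta> where ab: "\<alpha> \<in> reg affine_space {x \<in> V. collapse x \<in> V}" "\<beta> \<in> reg affine_space {x \<in> V. collapse x \<in> V}"
    "\<forall>x\<in>{x \<in> V. collapse x \<in> V}. g x - g (collapse x) = \<alpha> x * (x \<A> - x \<B>) + \<beta> x * (x \<A> - x \<C>)"
    by (elim exE conjE) (rule that)
  have "f y = \<alpha> y * (y \<A> - y \<B>) + \<beta> y * (y \<A> - y \<C>)" if y: "y \<in> {x \<in> V. collapse x \<in> V}" for y
  proof -
    have "collapse y \<in> V"
      using y by simp
    then have "g (collapse y) = 0"
      using V(3,4) zero[of "collapse y"] by auto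
    then show ?thesis
      using y V(4) ab(3) by fastforce
  qed
  then show ?thesis
    using V x ab by (intro exI[of _ "{x \<in> V. collapse x \<in> V}"] exI[of _ \<alpha>] exI[of _ \<beta>]) auto
qed

section \<open>Coordinates adapted to the conic\<close>

lemma sum_le_2: "(\<Sum>i\<le>(2::nat). f i) = f 0 + f 1 + (f 2 :: complex)"
  by (simp add: numeral_2_eq_2)

lemma all_le_2: "(\<forall>i\<le>2. P i) \<longleftrightarrow> P 0 \<and> P (1::nat) \<and> P 2"
  by (auto simp: numeral_2_eq_2 le_Suc_eq)

lemma ex_le_2: "(\<exists>i\<le>2. P i) \<longleftrightarrow> P 0 \<or> P (1::nat) \<or> P 2"
  using all_le_2[of "\<lambda>i. \<not> P i"] by blast

section \<open>Vector algebra for points and lines of the plane\<close>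

definition dot :: "(nat \<Rightarrow> complex) \<Rightarrow> (nat \<Rightarrow> complex) \<Rightarrow> complex" where
  "dot u v = (\<Sum>i\<le>2. u i * v i)"

text \<open>Zero beyond index 2, to match the vectors of homogeneous coordinates.\<close>

definition triple :: "complex \<Rightarrow> complex \<Rightarrow> complex \<Rightarrow> nat \<Rightarrow> complex" where
  "triple a b c = (\<lambda>i. if i = 0 then a else if i = 1 then b else if i = 2 then c else 0)"

definition cross :: "(nat \<Rightarrow> complex) \<Rightarrow> (nat \<Rightarrow> complex) \<Rightarrow> nat \<Rightarrow> complex" where
  "cross u v = triple (u 1 * v 2 - u 2 * v 1) (u 2 * v 0 - u 0 * v 2) (u 0 * v 1 - u 1 * v 0)"

lemma triple_apply [simp]: "triple a b c 0 = a" "triple a b c (Suc 0) = b" "triple a b c 2 = c"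
  "i > 2 \<Longrightarrow> triple a b c i = 0"
  by (simp_all add: triple_def)

lemma dot_expand: "dot u v = u 0 * v 0 + u 1 * v 1 + u 2 * v 2"
  by (simp add: dot_def sum_le_2)

lemma dot_cross_left: "dot (cross u v) u = 0" and dot_cross_right: "dot (cross u v) v = 0"
  by (simp_all add: dot_expand cross_def algebra_simps)

text \<open>Both equations together make all 2x2 minors of \<open>c\<close> and
  \<open>cross u v\<close> vanish; the factor \<open>d\<close> is then the ratio of the entries at
  \<open>j\<close>.\<close>

lemma perpendicular_cross:
  assumes u: "dot c u = 0" and v: "dot c v = 0" and j: "j \<le> 2" "cross u v j \<noteq> 0"
  shows "\<exists>d. \<forall>i\<le>2. c i = d * cross u v i"
proof (intro exI allI impI)
  fix i :: nat
  assume i: "i \<le> 2"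
  have "\<forall>i\<le>2. \<forall>j\<le>2. c i * cross u v j = c j * cross u v i"
    using u v unfolding all_le_2 cross_def dot_expand triple_apply One_nat_def
    by (intro conjI; (algebra | simp))
  then have "c i * cross u v j = c j * cross u v i"
    using i j(1) by blast
  then show "c i = c j / cross u v j * cross u v i"
    using j(2) by (simp add: field_simps)
qed

text \<open>The coefficients of \<open>(t - a) * (t - b)\<close> at 1, t, t^2: the line that meets
  the conic of the points (1, t, t^2) in the parameters \<open>a\<close> and
  \<open>b\<close>.\<close>

definition chord :: "complex \<Rightarrow> complex \<Rightarrow> nat \<Rightarrow> complex" where
  "chord a b = triple (a * b) (- (a + b)) 1"

text \<open>The arguments are two columns \<open>(a, b)\<close> and \<open>(a', b')\<close> of the
  array; the value is the intersection of the two diagonal chords between them.\<close>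

definition pascal_pt :: "complex \<Rightarrow> complex \<Rightarrow> complex \<Rightarrow> complex \<Rightarrow> nat \<Rightarrow> complex" where
  "pascal_pt a b a' b' = cross (chord a b') (chord a' b)"

definition comb :: "(nat \<Rightarrow> nat \<Rightarrow> complex) \<Rightarrow> (nat \<Rightarrow> complex) \<Rightarrow> nat \<Rightarrow> complex" where
  "comb e a = (\<lambda>i. \<Sum>k\<le>2. a k * e k i)"

definition coords :: "(nat \<Rightarrow> nat \<Rightarrow> complex) \<Rightarrow> pt \<Rightarrow> nat \<Rightarrow> complex" where
  "coords l p = (\<lambda>k. \<Sum>i\<le>2. l k i * hc p i)"

text \<open>A basis \<open>e 0\<close>, \<open>e 1\<close>, \<open>e 2\<close> with its dual basis
  \<open>l\<close>: the point with coordinates \<open>a\<close> is \<open>comb e a\<close>, and the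
  line with equation \<open>c\<close> in these coordinates is \<open>comb l c\<close>. Stating that
  the matrices are inverse in both orders keeps the notion symmetric in \<open>e\<close> and
  \<open>l\<close>.\<close>

locale frame =
  fixes e l :: "nat \<Rightarrow> nat \<Rightarrow> complex"
  assumes dual: "k \<le> 2 \<Longrightarrow> m \<le> 2 \<Longrightarrow> (\<Sum>i\<le>2. l k i * e m i) = (if k = m then 1 else 0)"
    and complete: "i \<le> 2 \<Longrightarrow> j \<le> 2 \<Longrightarrow> (\<Sum>k\<le>2. e k i * l k j) = (if i = j then 1 else 0)"
    and support: "i > 2 \<Longrightarrow> e k i = 0" "i > 2 \<Longrightarrow> l k i = 0"
begin

text \<open>Projective duality: each fact about points in the frame becomes one about lines.\<close>

lemma swap: "frame l e"
proof
  show "(\<Sum>i\<le>2. e k i * l m i) = (if k = m then 1 else 0)" if "k \<le> 2" "m \<le> 2" for k m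
    using dual[OF that(2,1)] by (simp add: mult.commute eq_commute)
  show "(\<Sum>k\<le>2. l k i * e k j) = (if i = j then 1 else 0)" if "i \<le> 2" "j \<le> 2" for i j
    using complete[OF that(2,1)] by (simp add: mult.commute eq_commute)
qed (use support in auto)

lemma dual_comb:
  assumes "k \<le> 2"
  shows "(\<Sum>i\<le>2. l k i * comb e a i) = a k"
proof -
  have "(\<Sum>i\<le>2. l k i * comb e a i) = (\<Sum>m\<le>2. a m * (\<Sum>i\<le>2. l k i * e m i))"
    unfolding comb_def by (simp add: sum_le_2 algebra_simps)
  also have "\<dots> = (\<Sum>m\<le>2. a m * (if k = m then 1 else 0))"
    by (intro sum.cong refl arg_cong2[where f = "(*)"] dual assms) simp
  finally show ?thesis
    using assms by (simp add: if_distrib cong: if_cong)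
qed

lemma comb_nonzero:
  assumes "k \<le> 2" "a k \<noteq> 0"
  shows "\<exists>i\<le>2. comb e a i \<noteq> 0"
proof -
  have "(\<Sum>i\<le>2. l k i * comb e a i) \<noteq> 0"
    using dual_comb[OF assms(1)] assms(2) by simp
  then obtain i where "i \<le> 2" "l k i * comb e a i \<noteq> 0"
    by (meson atMost_iff sum.neutral)
  then show ?thesis
    by auto
qed

lemma comb_in_points:
  assumes "k \<le> 2" "a k \<noteq> 0"
  shows "proj_pt (comb e a) \<in> proj_points 2"
proof -
  obtain i where "i \<le> 2" "comb e a i \<noteq> 0"
    using comb_nonzero[where a = a, OF assms] by blast
  then show ?thesis
    by (intro proj_pt_in_points[of 2 _ i]) (auto simp: comb_def support)
qed

lemma comb_coords:
  assumes "p \<in> proj_points 2"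
  shows "comb e (coords l p) = hc p"
proof
  fix i
  show "comb e (coords l p) i = hc p i"
  proof (cases "i \<le> 2")
    case True
    have "comb e (coords l p) i = (\<Sum>j\<le>2. hc p j * (\<Sum>k\<le>2. e k i * l k j))"
      unfolding comb_def coords_def by (simp add: sum_le_2 algebra_simps)
    also have "\<dots> = (\<Sum>j\<le>2. hc p j * (if i = j then 1 else 0))"
      by (intro sum.cong refl arg_cong2[where f = "(*)"] complete True) simp
    finally show ?thesis
      using True by (simp add: if_distrib cong: if_cong)
  next
    case False
    then show ?thesis
      using hc_proj_points(1)[OF assms] by (simp add: comb_def support)
  qed
qed

lemma point_eq_comb:
  assumes "p \<in> proj_points 2"
  shows "p = proj_pt (comb e (coords l p))"
  using comb_coords[OF assms] proj_pt_hc[OF assms] by simp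

lemma coords_nonzero:
  assumes "p \<in> proj_points 2"
  shows "\<exists>k\<le>2. coords l p k \<noteq> 0"
proof (rule ccontr)
  assume "\<not> ?thesis"
  then have "comb e (coords l p) = (\<lambda>_. 0)"
    by (simp add: comb_def)
  then show False
    using comb_coords[OF assms] hc_proj_points(2)[OF assms] by simp
qed

lemma coords_comb: "\<exists>c. c \<noteq> 0 \<and> (\<forall>k\<le>2. coords l (proj_pt (comb e a)) k = c * a k)"
proof -
  obtain c where c: "c \<noteq> 0" "hc (proj_pt (comb e a)) = (\<lambda>i. c * comb e a i)"
    using hc_proj_pt by blast
  have "coords l (proj_pt (comb e a)) k = c * a k" if "k \<le> 2" for k
    using dual_comb[OF that, of a] unfolding coords_def c(2)
    by (simp add: sum_distrib_left mult_ac flip: sum_distrib_left)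
  then show ?thesis
    using c(1) by blast
qed

lemma proj_pt_comb_eq:
  assumes "c \<noteq> 0" "\<And>k. k \<le> 2 \<Longrightarrow> a k = c * b k"
  shows "proj_pt (comb e a) = proj_pt (comb e b)"
proof -
  have "comb e a = (\<lambda>i. c * comb e b i)"
    using assms(2) by (auto simp: comb_def sum_distrib_left mult_ac)
  then show ?thesis
    using proj_pt_scale[OF assms(1)] by simp
qed

lemma incident_coords:
  assumes "p \<in> proj_points 2" "m \<in> proj_points 2"
  shows "incident p m \<longleftrightarrow> dot (coords e m) (coords l p) = 0"
proof -
  interpret s: frame l e
    by (rule swap)
  have "(\<Sum>i\<le>2. hc m i * hc p i) = (\<Sum>i\<le>2. comb l (coords e m) i * hc p i)"
    by (simp add: s.comb_coords[OF assms(2)])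
  also have "\<dots> = dot (coords e m) (coords l p)"
    by (simp add: comb_def dot_expand sum_le_2 coords_def algebra_simps)
  finally show ?thesis
    by (simp add: incident_def)
qed

lemma incident_point:
  assumes "m \<in> proj_points 2" "j \<le> 2" "a j \<noteq> 0"
  shows "incident (proj_pt (comb e a)) m \<longleftrightarrow> dot (coords e m) a = 0"
proof -
  obtain d where d: "d \<noteq> 0" "\<forall>k\<le>2. coords l (proj_pt (comb e a)) k = d * a k"
    using coords_comb by blast
  have "dot (coords e m) (coords l (proj_pt (comb e a))) = d * dot (coords e m) a"
    using d(2) by (simp add: dot_expand algebra_simps)
  then show ?thesis
    using incident_coords[OF comb_in_points[where a = a, OF assms(2,3)] assms(1)] d(1) by simp
qed

lemma incident_comb_comb:
  assumes "i \<le> 2" "a i \<noteq> 0" "j \<le> 2" "c j \<noteq> 0"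
  shows "incident (proj_pt (comb e a)) (proj_pt (comb l c)) \<longleftrightarrow> dot c a = 0"
proof -
  interpret s: frame l e
    by (rule swap)
  obtain d where d: "d \<noteq> 0" "\<forall>k\<le>2. coords e (proj_pt (comb l c)) k = d * c k"
    using s.coords_comb by blast
  have "dot (coords e (proj_pt (comb l c))) a = d * dot c a"
    using d(2) by (simp add: dot_expand algebra_simps)
  then show ?thesis
    using incident_point[where a = a, OF s.comb_in_points[where a = c, OF assms(3,4)] assms(1,2)] d(1)
    by simp
qed

lemma line_unique:
  assumes m: "m \<in> proj_points 2" and u: "dot (coords e m) u = 0" and v: "dot (coords e m) v = 0"
    and j: "j \<le> 2" "cross u v j \<noteq> 0"
  shows "m = proj_pt (comb l (cross u v))"
proof -
  interpret s: frame l e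
    by (rule swap)
  obtain d where d: "\<forall>i\<le>2. coords e m i = d * cross u v i"
    using perpendicular_cross[OF u v j] by blast
  then have "d \<noteq> 0"
    using s.coords_nonzero[OF m] by auto
  then have "proj_pt (comb l (coords e m)) = proj_pt (comb l (cross u v))"
    using d by (intro s.proj_pt_comb_eq[of d]) auto
  then show ?thesis
    using s.point_eq_comb[OF m] by simp
qed

lemma cross_nonzeroD:
  assumes "cross u v j \<noteq> 0"
  shows "\<exists>i\<le>2. u i \<noteq> 0" "\<exists>i\<le>2. v i \<noteq> 0"
  using assms unfolding ex_le_2 cross_def triple_def by (auto split: if_splits)

lemma join_comb:
  assumes j: "j \<le> 2" "cross u v j \<noteq> 0"
  shows "join (proj_pt (comb e u)) (proj_pt (comb e v)) = proj_pt (comb l (cross u v))"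
  unfolding join_def
proof (rule the_equality)
  interpret s: frame l e
    by (rule swap)
  obtain i i' where i: "i \<le> 2" "u i \<noteq> 0" "i' \<le> 2" "v i' \<noteq> 0"
    using cross_nonzeroD[OF j(2)] by blast
  show "proj_pt (comb l (cross u v)) \<in> points dual_plane \<and>
    incident (proj_pt (comb e u)) (proj_pt (comb l (cross u v))) \<and>
    incident (proj_pt (comb e v)) (proj_pt (comb l (cross u v)))"
    using s.comb_in_points[where a = "cross u v", OF j]
    by (simp add: incident_comb_comb[where a = u and c = "cross u v", OF i(1,2) j]
        incident_comb_comb[where a = v and c = "cross u v", OF i(3,4) j]
        dot_cross_left dot_cross_right)
  fix m
  assume m: "m \<in> points dual_plane \<and> incident (proj_pt (comb e u)) m \<and> incident (proj_pt (comb e v)) m"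
  then have mp: "m \<in> proj_points 2"
    by simp
  show "m = proj_pt (comb l (cross u v))"
    using m by (intro line_unique[OF mp _ _ j])
      (simp_all add: incident_point[where a = u, OF mp i(1,2)] incident_point[where a = v, OF mp i(3,4)])
qed

text \<open>Points and lines have the same type and incidence is symmetric in their coordinates, so
  the two descriptions have the same defining property.\<close>

lemma meet_eq_join: "meet m n = join m n"
  unfolding meet_def join_def incident_def by (simp add: mult.commute)

lemma meet_comb:
  assumes "j \<le> 2" "cross u v j \<noteq> 0"
  shows "meet (proj_pt (comb l u)) (proj_pt (comb l v)) = proj_pt (comb e (cross u v))"
  unfolding meet_eq_join using frame.join_comb[OF swap assms] .

text \<open>Parametrises the conic \<open>x1^2 = x0 * x2\<close> of the frame, except for its point
  (0, 0, 1); the parameter 0 gives (1, 0, 0).\<close>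

definition \<gamma> :: "complex \<Rightarrow> pt" where
  "\<gamma> t = proj_pt (comb e (triple 1 t (t\<^sup>2)))"

lemma gamma_in_points: "\<gamma> t \<in> proj_points 2"
  unfolding \<gamma>_def by (rule comb_in_points[of 0]) simp_all

text \<open>The cross product of (1, a, a^2) and (1, b, b^2) is \<open>b - a\<close> times
  \<open>chord a b\<close>.\<close>

lemma join_gamma:
  assumes "a \<noteq> b"
  shows "join (\<gamma> a) (\<gamma> b) = proj_pt (comb l (chord a b))"
proof -
  interpret s: frame l e
    by (rule swap)
  have "cross (triple 1 a (a\<^sup>2)) (triple 1 b (b\<^sup>2)) 2 \<noteq> 0"
    using assms by (simp add: cross_def)
  then have "join (\<gamma> a) (\<gamma> b) = proj_pt (comb l (cross (triple 1 a (a\<^sup>2)) (triple 1 b (b\<^sup>2))))"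
    unfolding \<gamma>_def by (intro join_comb[of 2]) simp
  also have "\<dots> = proj_pt (comb l (chord a b))"
  proof (rule s.proj_pt_comb_eq[of "b - a"])
    have "\<forall>k\<le>2. cross (triple 1 a (a\<^sup>2)) (triple 1 b (b\<^sup>2)) k = (b - a) * chord a b k"
      unfolding all_le_2 by (simp add: cross_def chord_def algebra_simps power2_eq_square)
    then show "cross (triple 1 a (a\<^sup>2)) (triple 1 b (b\<^sup>2)) k = (b - a) * chord a b k" if "k \<le> 2" for k
      using that by blast
  qed (use assms in simp)
  finally show ?thesis .
qed

text \<open>If the first two coordinates vanish, the pairs \<open>a, b'\<close> and
  \<open>a', b\<close> have equal sums and products, so \<open>a\<close> is a root of
  \<open>(t - a') * (t - b)\<close>.\<close>

lemma pascal_pt_nonzero: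
  assumes "a \<noteq> a'" "a \<noteq> b"
  shows "\<exists>j\<le>2. pascal_pt a b a' b' j \<noteq> 0"
proof (rule ccontr)
  assume "\<not> ?thesis"
  then have "- (a + b') + (a' + b) = 0" "a' * b - a * b' = 0"
    unfolding ex_le_2 by (simp_all add: pascal_pt_def cross_def chord_def algebra_simps)
  then have "(a - a') * (a - b) = 0"
    by algebra
  then show False
    using assms by simp
qed

lemma incident_pascal_pt:
  assumes m: "m \<in> proj_points 2" and "a \<noteq> a'" "a \<noteq> b" "a \<noteq> b'" "a' \<noteq> b"
  shows "incident (meet (join (\<gamma> a) (\<gamma> b')) (join (\<gamma> a') (\<gamma> b))) m \<longleftrightarrow>
    dot (coords e m) (pascal_pt a b a' b') = 0"
proof -
  obtain j where j: "j \<le> 2" "pascal_pt a b a' b' j \<noteq> 0"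
    using pascal_pt_nonzero[OF assms(2,3)] by blast
  show ?thesis
    using meet_comb[OF j[unfolded pascal_pt_def]] incident_point[where a = "pascal_pt a b a' b'", OF m j] assms
    by (simp add: join_gamma pascal_pt_def)
qed

end

section \<open>The equation of the Pascal line\<close>

definition det3 :: "complex \<times> complex \<times> complex \<Rightarrow> complex \<times> complex \<times> complex \<Rightarrow>
    complex \<times> complex \<times> complex \<Rightarrow> complex" where
  "det3 = (\<lambda>(u1, u2, u3) (v1, v2, v3) (w1, w2, w3).
     u1 * (v2 * w3 - v3 * w2) + u2 * (v3 * w1 - v1 * w3) + u3 * (v1 * w2 - v2 * w1))"

text \<open>The Pascal line meets the conic in the fixed points of the homography taking \<open>a\<^sub>i\<close> to \<open>b\<^sub>i\<close>.
  If its graph is \<open>p x y + q x + r y + w = 0\<close>, these are the roots of \<open>p t\<^sup>2 + (q + r) t + w\<close>,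
  and \<open>p, q, r, w\<close> are minors of the matrix with rows \<open>(a\<^sub>i b\<^sub>i, a\<^sub>i, b\<^sub>i, 1)\<close>.\<close>

definition pascal_coeffs ::
    "complex \<Rightarrow> complex \<Rightarrow> complex \<Rightarrow> complex \<Rightarrow> complex \<Rightarrow> complex \<Rightarrow> nat \<Rightarrow> complex" where
  "pascal_coeffs a1 a2 a3 b1 b2 b3 = triple
     (- det3 (a1 * b1, a2 * b2, a3 * b3) (a1, a2, a3) (b1, b2, b3))
     (det3 (a1 * b1, a2 * b2, a3 * b3) (a1, a2, a3) (1, 1, 1) -
      det3 (a1 * b1, a2 * b2, a3 * b3) (b1, b2, b3) (1, 1, 1))
     (det3 (a1, a2, a3) (b1, b2, b3) (1, 1, 1))"

text \<open>At the parameter t the form is the 4x4 determinant with first row (t^2, t, t, 1) above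
  the rows \<open>(a\<^sub>i b\<^sub>i, a\<^sub>i, b\<^sub>i, 1)\<close>. For t = a1, subtracting
  the row of a1 splits off \<open>a1 - b1\<close>. The factorisation serves to show that the form is
  not zero.\<close>

lemma pascal_coeffs_on_conic:
  "dot (pascal_coeffs a1 a2 a3 b1 b2 b3) (triple 1 a1 (a1\<^sup>2)) =
     (a1 - b1) * (a1 - a2) * (a1 - a3) * (b2 - b3)"
  unfolding dot_expand pascal_coeffs_def det3_def triple_apply One_nat_def prod.case by algebra

lemma pascal_coeffs_nonzero:
  assumes "a1 \<noteq> b1" "a1 \<noteq> a2" "a1 \<noteq> a3" "b2 \<noteq> b3"
  shows "\<exists>j\<le>2. pascal_coeffs a1 a2 a3 b1 b2 b3 j \<noteq> 0"
proof (rule ccontr)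
  assume "\<not> ?thesis"
  then have "dot (pascal_coeffs a1 a2 a3 b1 b2 b3) (triple 1 a1 (a1\<^sup>2)) = 0"
    unfolding ex_le_2 dot_expand by simp
  then show False
    using assms by (simp add: pascal_coeffs_on_conic)
qed

lemma converse_insert: "(insert (a, b) r)\<inverse> = insert (b, a) (r\<inverse>)"
  by auto

context frame
begin

text \<open>Two Pascal points already span the line. Their cross product has the factor
  \<open>b1 - a1\<close>, nonzero for injective sextuples, and the cofactor is
  \<open>pascal_coeffs\<close>.\<close>

lemma cross_pascal_pts:
  "k \<le> 2 \<Longrightarrow> cross (pascal_pt a1 b1 a2 b2) (pascal_pt a1 b1 a3 b3) k =
     (b1 - a1) * pascal_coeffs a1 a2 a3 b1 b2 b3 k"
proof -
  have "\<forall>k\<le>2. cross (pascal_pt a1 b1 a2 b2) (pascal_pt a1 b1 a3 b3) k =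
     (b1 - a1) * pascal_coeffs a1 a2 a3 b1 b2 b3 k"
    unfolding all_le_2 pascal_pt_def cross_def chord_def pascal_coeffs_def det3_def triple_apply One_nat_def prod.case
    by (intro conjI) algebra+
  then show "k \<le> 2 \<Longrightarrow> ?thesis"
    by blast
qed

text \<open>Pascal's theorem, as three polynomial identities.\<close>

lemma dot_pascal_coeffs: "dot (pascal_coeffs a1 a2 a3 b1 b2 b3) (pascal_pt a1 b1 a2 b2) = 0"
    "dot (pascal_coeffs a1 a2 a3 b1 b2 b3) (pascal_pt a1 b1 a3 b3) = 0"
    "dot (pascal_coeffs a1 a2 a3 b1 b2 b3) (pascal_pt a2 b2 a3 b3) = 0"
  unfolding dot_expand pascal_pt_def cross_def chord_def pascal_coeffs_def det3_def triple_apply One_nat_def prod.case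
  by algebra+

text \<open>Exchanging the two columns, or the two rows, exchanges the two chords, so the cross
  product only changes its sign.\<close>

lemma dot_pascal_pt_swap:
  "dot c (pascal_pt a' b' a b) = 0 \<longleftrightarrow> dot c (pascal_pt a b a' b') = 0"
  "dot c (pascal_pt b a b' a') = 0 \<longleftrightarrow> dot c (pascal_pt a b a' b') = 0"
proof -
  have "dot c (pascal_pt a' b' a b) = - dot c (pascal_pt a b a' b')"
    "dot c (pascal_pt b a b' a') = - dot c (pascal_pt a b a' b')"
    by (simp_all add: dot_expand pascal_pt_def cross_def chord_def algebra_simps)
  then show "dot c (pascal_pt a' b' a b) = 0 \<longleftrightarrow> dot c (pascal_pt a b a' b') = 0"
    "dot c (pascal_pt b a b' a') = 0 \<longleftrightarrow> dot c (pascal_pt a b a' b') = 0"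
    by simp_all
qed

lemma pascal_line_gamma:
  assumes inj: "inj x" and dist: "distinct [x1, x2, x3, y1, y2, y3]"
  shows "pascal_line (symbol x1 x2 x3 y1 y2 y3) (\<lambda>i. \<gamma> (x i)) =
    proj_pt (comb l (pascal_coeffs (x x1) (x x2) (x x3) (x y1) (x y2) (x y3)))"
proof -
  interpret s: frame l e
    by (rule swap)
  let ?c = "pascal_coeffs (x x1) (x x2) (x x3) (x y1) (x y2) (x y3)"
  let ?P = "\<lambda>m. \<forall>C\<in>symbol x1 x2 x3 y1 y2 y3. \<forall>(x', y)\<in>C. \<forall>(x'', y')\<in>C. (x', y) \<noteq> (x'', y') \<longrightarrow>
        incident (meet (join (\<gamma> (x x')) (\<gamma> (x y'))) (join (\<gamma> (x x'')) (\<gamma> (x y)))) m"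
  let ?p12 = "pascal_pt (x x1) (x y1) (x x2) (x y2)"
  let ?p13 = "pascal_pt (x x1) (x y1) (x x3) (x y3)"
  let ?p23 = "pascal_pt (x x2) (x y2) (x x3) (x y3)"
  have eq: "x i = x j \<longleftrightarrow> i = j" for i j
    using inj by (simp add: inj_eq)
  \<comment> \<open>\<open>?P\<close> runs over both orders of the rows and all ordered pairs of
    distinct columns; the sign symmetries reduce these twelve conditions to three.\<close>
  have P: "?P m \<longleftrightarrow> dot (coords e m) ?p12 = 0 \<and> dot (coords e m) ?p13 = 0 \<and> dot (coords e m) ?p23 = 0"
    if m: "m \<in> proj_points 2" for m
  proof -
    have inc: "incident (meet (join (\<gamma> (x i)) (\<gamma> (x j'))) (join (\<gamma> (x i')) (\<gamma> (x j)))) m \<longleftrightarrow>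
      dot (coords e m) (pascal_pt (x i) (x j) (x i') (x j')) = 0"
      if "i \<noteq> i'" "i \<noteq> j" "i \<noteq> j'" "i' \<noteq> j" for i i' j j'
      using that by (intro incident_pascal_pt[OF m]) (simp_all add: eq)
    note swap = dot_pascal_pt_swap(1)[where c = "coords e m" and a = "x x1" and b = "x y1" and a' = "x x2" and b' = "x y2"]
      dot_pascal_pt_swap(1)[where c = "coords e m" and a = "x x1" and b = "x y1" and a' = "x x3" and b' = "x y3"]
      dot_pascal_pt_swap(1)[where c = "coords e m" and a = "x x2" and b = "x y2" and a' = "x x3" and b' = "x y3"]
      dot_pascal_pt_swap(2)[where c = "coords e m" and a = "x x1" and b = "x y1" and a' = "x x2" and b' = "x y2"]
      dot_pascal_pt_swap(2)[where c = "coords e m" and a = "x x1" and b = "x y1" and a' = "x x3" and b' = "x y3"]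
      dot_pascal_pt_swap(2)[where c = "coords e m" and a = "x x2" and b = "x y2" and a' = "x x1" and b' = "x y1"]
      dot_pascal_pt_swap(2)[where c = "coords e m" and a = "x x2" and b = "x y2" and a' = "x x3" and b' = "x y3"]
      dot_pascal_pt_swap(2)[where c = "coords e m" and a = "x x3" and b = "x y3" and a' = "x x1" and b' = "x y1"]
      dot_pascal_pt_swap(2)[where c = "coords e m" and a = "x x3" and b = "x y3" and a' = "x x2" and b' = "x y2"]
    \<comment> \<open>The reversed list supplies each inequality in the other orientation for the
      simplifier.\<close>
    have "distinct [y3, y2, y1, x3, x2, x1]"
      using dist by auto
    have "?P m \<longleftrightarrow> (\<forall>C\<in>{{(x1, y1), (x2, y2), (x3, y3)}, {(y1, x1), (y2, x2), (y3, x3)}}.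
        \<forall>(x', y)\<in>C. \<forall>(x'', y')\<in>C. (x', y) \<noteq> (x'', y') \<longrightarrow>
        incident (meet (join (\<gamma> (x x')) (\<gamma> (x y'))) (join (\<gamma> (x x'')) (\<gamma> (x y)))) m)"
      unfolding symbol_def Let_def converse_insert converse_empty ..
    also have "\<dots> \<longleftrightarrow> dot (coords e m) ?p12 = 0 \<and> dot (coords e m) ?p13 = 0 \<and> dot (coords e m) ?p23 = 0"
      using dist \<open>distinct [y3, y2, y1, x3, x2, x1]\<close> by (simp add: inc swap) blast
    finally show ?thesis .
  qed
  obtain j where j: "j \<le> 2" "?c j \<noteq> 0"
    using pascal_coeffs_nonzero[of "x x1" "x y1" "x x2" "x x3" "x y2" "x y3"] dist by (auto simp: eq)
  have nz: "x y1 - x x1 \<noteq> 0"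
    using dist by (auto simp: eq)
  have j': "cross ?p12 ?p13 j \<noteq> 0"
    using j nz by (simp add: cross_pascal_pts)
  have L: "proj_pt (comb l (cross ?p12 ?p13)) = proj_pt (comb l ?c)"
    by (rule s.proj_pt_comb_eq[OF nz]) (rule cross_pascal_pts)
  show ?thesis
    unfolding pascal_line_def
  proof (rule the_equality)
    have c: "proj_pt (comb l ?c) \<in> proj_points 2"
      by (rule s.comb_in_points[where a = ?c, OF j])
    obtain d where d: "\<forall>k\<le>2. coords e (proj_pt (comb l ?c)) k = d * ?c k"
      using s.coords_comb by blast
    have "dot (coords e (proj_pt (comb l ?c))) v = d * dot ?c v" for v
      using d by (simp add: dot_expand algebra_simps)
    then have "?P (proj_pt (comb l ?c))"
      unfolding P[OF c] by (simp add: dot_pascal_coeffs)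
    then show "proj_pt (comb l ?c) \<in> points dual_plane \<and> ?P (proj_pt (comb l ?c))"
      using c by simp
    fix m
    assume m: "m \<in> points dual_plane \<and> ?P m"
    then have mp: "m \<in> proj_points 2"
      by simp
    from m have "dot (coords e m) ?p12 = 0" "dot (coords e m) ?p13 = 0"
      using P[OF mp] by blast+
    then show "m = proj_pt (comb l ?c)"
      using line_unique[OF mp _ _ j(1) j'] L by simp
  qed
qed

end

section \<open>Normal form of a nonsingular conic\<close>

lemma cramer:
  assumes "i \<le> 2"
  shows "dot (cross v w) y * u i + dot (cross w u) y * v i + dot (cross u v) y * w i = dot (cross u v) w * y i"
proof -
  have "\<forall>i\<le>2. dot (cross v w) y * u i + dot (cross w u) y * v i + dot (cross u v) y * w i =
    dot (cross u v) w * y i"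
    unfolding all_le_2 cross_def dot_expand triple_apply One_nat_def by (intro conjI; algebra)
  then show ?thesis
    using assms by blast
qed

lemma dot_cross_rotate: "dot (cross v w) u = dot (cross u v) w"
  unfolding cross_def dot_expand triple_apply One_nat_def by algebra

text \<open>The dual basis consists of the cross products of two basis vectors, divided by the
  determinant. Orthogonality of cross products gives one matrix identity, \<open>cramer\<close> for
  the unit vectors gives the other.\<close>

lemma frame_of_basis:
  assumes e: "\<And>i k. i > 2 \<Longrightarrow> e k i = 0" and D: "dot (cross (e 0) (e 1)) (e 2) \<noteq> 0"
  shows "\<exists>l. frame e l"
proof
  define D' where "D' = dot (cross (e 0) (e 1)) (e 2)"
  define m where "m = (\<lambda>k :: nat. if k = 0 then cross (e 1) (e 2) else if k = 1 then cross (e 2) (e 0)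
    else cross (e 0) (e 1))"
  have D': "D' \<noteq> 0"
    using D by (simp add: D'_def)
  have m: "m 0 = cross (e 1) (e 2)" "m 1 = cross (e 2) (e 0)" "m 2 = cross (e 0) (e 1)"
    by (simp_all add: m_def)
  have "dot (cross (e 1) (e 2)) (e 0) = D'" "dot (cross (e 2) (e 0)) (e 1) = D'"
    unfolding D'_def by (metis dot_cross_rotate)+
  then have 1: "\<forall>k\<le>2. \<forall>j\<le>2. dot (m k) (e j) = (if k = j then D' else 0)"
    unfolding all_le_2 m by (simp add: D'_def dot_cross_left dot_cross_right)
  have 2: "(\<Sum>k\<le>2. e k i * m k j) = (if i = j then D' else 0)" if i: "i \<le> 2" and j: "j \<le> 2" for i j
  proof -
    let ?y = "\<lambda>i. if i = j then 1 else (0 :: complex)"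
    have "dot w ?y = w j" for w
      using j by (simp add: dot_def if_distrib cong: if_cong)
    then have "e 0 i * m 0 j + e 1 i * m 1 j + e 2 i * m 2 j = D' * ?y i"
      using cramer[OF i, of "e 1" "e 2" ?y "e 0"] unfolding m D'_def by (simp add: mult.commute)
    then show ?thesis
      by (simp add: sum_le_2)
  qed
  show "frame e (\<lambda>k i. m k i / D')"
  proof
    show "(\<Sum>i\<le>2. m k i / D' * e j i) = (if k = j then 1 else 0)" if "k \<le> 2" "j \<le> 2" for k j
    proof -
      have "(\<Sum>i\<le>2. m k i / D' * e j i) = dot (m k) (e j) / D'"
        by (simp add: dot_def sum_divide_distrib)
      also have "\<dots> = (if k = j then D' else 0) / D'"
        using 1 that by metis
      finally show ?thesis
        using D' by simp
    qed
    show "(\<Sum>k\<le>2. e k i * (m k j / D')) = (if i = j then 1 else 0)" if "i \<le> 2" "j \<le> 2" for i j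
    proof -
      have "(\<Sum>k\<le>2. e k i * (m k j / D')) = (\<Sum>k\<le>2. e k i * m k j) / D'"
        by (simp add: sum_divide_distrib)
      also have "\<dots> = (if i = j then D' else 0) / D'"
        unfolding 2[OF that] ..
      finally show ?thesis
        using D' by simp
    qed
  qed (simp_all add: e m_def cross_def)
qed

lemma cross_hc_nonzero:
  assumes p: "p \<in> proj_points 2" and q: "q \<in> proj_points 2" and "p \<noteq> q"
  shows "\<exists>j\<le>2. cross (hc p) (hc q) j \<noteq> 0"
proof (rule ccontr)
  assume "\<not> ?thesis"
  then have 0: "\<forall>i\<le>2. \<forall>k\<le>2. hc p i * hc q k = hc p k * hc q i"
    unfolding ex_le_2 all_le_2 by (simp add: cross_def algebra_simps)
  obtain k where k: "k \<le> 2" "hc p k \<noteq> 0"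
    using hc_proj_points(2)[OF p] by blast
  have eq: "hc q = (\<lambda>i. hc q k / hc p k * hc p i)"
  proof
    fix i
    show "hc q i = hc q k / hc p k * hc p i"
    proof (cases "i \<le> 2")
      case True
      then have "hc p i * hc q k = hc p k * hc q i"
        using 0 k(1) by blast
      then show ?thesis
        using k(2) by (simp add: field_simps)
    qed (simp add: hc_proj_points(1)[OF p] hc_proj_points(1)[OF q])
  qed
  then have "hc q k / hc p k \<noteq> 0"
    using hc_proj_points(2)[OF q] by auto
  then have "proj_pt (hc q) = proj_pt (hc p)"
    by (subst eq) (rule proj_pt_scale)
  then show False
    using assms proj_pt_hc by metis
qed

text \<open>The basis is made of vectors of M and N and of the pole of the line MN. The pole is
  conjugate to M and N, so only \<open>x1^2\<close> and \<open>x0 * x2\<close> survive in the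
  equation, and scaling the vector of N balances their coefficients.\<close>

lemma nonsingular_conic_frame:
  assumes K: "nonsingular_conic K" and MN: "M \<in> K" "N \<in> K" "M \<noteq> N"
  obtains e l where "frame e l" "M = proj_pt (comb e (triple 1 0 0))" "N = proj_pt (comb e (triple 0 0 1))"
    "\<And>p. p \<in> K \<longleftrightarrow> p \<in> proj_points 2 \<and> (coords l p 1)\<^sup>2 = coords l p 0 * coords l p 2"
proof -
  obtain a where a: "K = conic a" "\<forall>p\<in>K. \<exists>i\<le>2. (\<Sum>j\<le>2. (a i j + a j i) * hc p j) \<noteq> 0"
    using K unfolding nonsingular_conic_def by blast
  \<comment> \<open>\<open>a\<close> may be asymmetric. \<open>g v\<close> is the gradient at
    \<open>v\<close>, that is, the polar line of \<open>v\<close>, and the symmetric form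
    \<open>B\<close> has as \<open>B v v\<close> twice the value of the quadratic form.\<close>
  define g where "g = (\<lambda>v i. \<Sum>j\<le>2. (a i j + a j i) * v j)"
  define B where "B = (\<lambda>u v. dot u (g v))"
  have B_sym: "B u v = B v u" for u v
    by (simp add: B_def g_def dot_expand sum_le_2 algebra_simps)
  have B_comb: "B (comb e x) v = x 0 * B (e 0) v + x 1 * B (e 1) v + x 2 * B (e 2) v" for e x v
    by (simp add: B_def comb_def dot_expand sum_le_2 algebra_simps)
  have B_scale: "B (\<lambda>i. c * u i) v = c * B u v" for c u v
    by (simp add: B_def dot_expand algebra_simps)
  have g_scale: "g (\<lambda>i. c * v i) i = c * g v i" for c v i
    by (simp add: g_def sum_distrib_left mult_ac)
  have KB: "p \<in> K \<longleftrightarrow> p \<in> proj_points 2 \<and> B (hc p) (hc p) = 0" for p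
  proof -
    have "B v v = 2 * (\<Sum>i\<le>2. \<Sum>j\<le>2. a i j * v i * v j)" for v
      by (simp add: B_def g_def dot_expand sum_le_2 algebra_simps)
    then show ?thesis
      by (simp add: a(1) conic_def)
  qed
  \<comment> \<open>A vector with zero gradient also satisfies \<open>B v v = 0\<close>, so it lies
    on the conic and contradicts the Jacobian criterion.\<close>
  have nonsing: False if "\<And>i. i > 2 \<Longrightarrow> v i = 0" "j \<le> 2" "v j \<noteq> 0" "\<forall>i\<le>2. g v i = 0" for v j
  proof -
    obtain c where c: "c \<noteq> 0" "hc (proj_pt v) = (\<lambda>i. c * v i)"
      using hc_proj_pt by blast
    have 0: "g (hc (proj_pt v)) i = 0" if "i \<le> 2" for i
      unfolding c(2) g_scale using \<open>\<forall>i\<le>2. g v i = 0\<close> that by simp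
    have "B (hc (proj_pt v)) (hc (proj_pt v)) = 0"
      unfolding B_def dot_def using 0 by simp
    then have "proj_pt v \<in> K"
      using KB proj_pt_in_points[where v = v, OF that(1-3)] by simp
    then show False
      using a(2) 0 unfolding g_def by blast
  qed
  define u v where "u = hc M" and "v = hc N"
  have M: "M \<in> proj_points 2" "B u u = 0" and N: "N \<in> proj_points 2" "B v v = 0"
    using MN KB by (auto simp: u_def v_def)
  have u0: "u i = 0" and v0: "v i = 0" if "i > 2" for i
    using that hc_proj_points(1)[OF M(1)] hc_proj_points(1)[OF N(1)] by (auto simp: u_def v_def)
  obtain j where j: "j \<le> 2" "cross u v j \<noteq> 0"
    using cross_hc_nonzero[OF M(1) N(1) MN(3)] unfolding u_def v_def by blast
  have gu: "\<exists>i\<le>2. g u i \<noteq> 0" and gv: "\<exists>i\<le>2. g v i \<noteq> 0"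
    using a(2) MN unfolding g_def u_def v_def by blast+
  have dots: "dot (g x) y = B y x" for x y
    by (simp add: B_def dot_expand algebra_simps)
  define b where "b = B u v"
  \<comment> \<open>If \<open>b = 0\<close>, the polar lines of \<open>u\<close> and
    \<open>v\<close> each contain both points, so both gradients are multiples of
    \<open>cross u v\<close>. The combination of \<open>u\<close> and \<open>v\<close> in which
    these multiples cancel is a singular point.\<close>
  have b: "b \<noteq> 0"
  proof
    assume "b = 0"
    then have z: "B u v = 0" "B v u = 0"
      using B_sym[of u v] by (simp_all add: b_def)
    obtain s where s: "\<forall>i\<le>2. g u i = s * cross u v i"
      using perpendicular_cross[of "g u", OF _ _ j] z M by (auto simp: dots)
    obtain t where t: "\<forall>i\<le>2. g v i = t * cross u v i"
      using perpendicular_cross[of "g v", OF _ _ j] z N by (auto simp: dots)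
    have st: "s \<noteq> 0" "t \<noteq> 0"
      using s gu t gv by auto
    define w where "w = (\<lambda>i. t * u i - s * v i)"
    have gw: "g w i = t * g u i - s * g v i" for i
      by (simp add: g_def w_def sum_le_2 algebra_simps)
    have "\<exists>i\<le>2. w i \<noteq> 0"
    proof (rule ccontr)
      assume "\<not> ?thesis"
      then have w: "t * u 0 = s * v 0" "t * u (Suc 0) = s * v (Suc 0)" "t * u 2 = s * v 2"
        unfolding w_def ex_le_2 by simp_all
      have "\<forall>i\<le>2. s * cross u v i = 0"
        using w unfolding all_le_2 cross_def triple_apply One_nat_def by (intro conjI; algebra)
      then show False
        using j st by auto
    qed
    then obtain i where "i \<le> 2" "w i \<noteq> 0"
      by blast
    then show False
      using nonsing[of w i] gw s t u0 v0 by (auto simp: w_def)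
  qed
  \<comment> \<open>The pole of the line MN: the intersection of the tangents at M and N.\<close>
  define w where "w = cross (g u) (g v)"
  have w0: "w i = 0" if "i > 2" for i
    using that by (simp add: w_def cross_def)
  have wu: "B w u = 0" and wv: "B w v = 0"
    by (simp_all add: B_def w_def dot_expand cross_def algebra_simps)
  \<comment> \<open>The Binet-Cauchy identity for the scalar product of \<open>cross u v\<close> and
    \<open>cross (g u) (g v)\<close>.\<close>
  have D: "dot (cross u v) w = - b\<^sup>2"
  proof -
    have "dot (cross u v) w = B u u * B v v - B u v * B v u"
      by (simp add: B_def w_def dot_expand cross_def algebra_simps)
    then show ?thesis
      using M N B_sym[of v u] by (simp add: b_def power2_eq_square)
  qed
  have wnz: "\<exists>i\<le>2. w i \<noteq> 0"
  proof (rule ccontr)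
    assume "\<not> ?thesis"
    then have "dot (cross u v) w = 0"
      by (simp add: dot_def)
    then show False
      using D b by simp
  qed
  define q where "q = B w w"
  \<comment> \<open>By conjugacy the gradient at \<open>w\<close> is \<open>d\<close> times the line
    \<open>cross u v\<close>, which misses \<open>w\<close>. So \<open>q = 0\<close> forces
    \<open>d = 0\<close> and makes \<open>w\<close> singular.\<close>
  have q: "q \<noteq> 0"
  proof
    assume "q = 0"
    then have ww: "dot (g w) w = 0"
      by (simp add: q_def dots)
    obtain d where d: "\<forall>i\<le>2. g w i = d * cross u v i"
      using perpendicular_cross[of "g w", OF _ _ j] wu wv B_sym[of w u] B_sym[of w v] by (auto simp: dots)
    then have "dot (g w) w = d * dot (cross u v) w"
      by (simp add: dot_expand algebra_simps)
    then have "d = 0"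
      using ww D b by simp
    then show False
      using d wnz nonsing[of w] w0 by auto
  qed
  \<comment> \<open>In the basis \<open>u\<close>, \<open>w\<close>, \<open>c v\<close> the form is
    \<open>q * x1^2 + 2 * b * c * x0 * x2\<close>; this \<open>c\<close> makes it \<open>q\<close>
    times \<open>x1^2 - x0 * x2\<close>.\<close>
  define c where "c = - q / (2 * b)"
  have c: "c \<noteq> 0" "2 * b * c = - q"
    using q b by (simp_all add: c_def)
  define e where "e = (\<lambda>k :: nat. if k = 0 then u else if k = 1 then w else (\<lambda>i. c * v i))"
  have e: "e 0 = u" "e (Suc 0) = w" "e 2 = (\<lambda>i. c * v i)"
    by (simp_all add: e_def)
  have "dot (cross (e 0) (e 1)) (e 2) = - c * dot (cross u v) w"
    by (simp add: e dot_expand cross_def algebra_simps)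
  then have "dot (cross (e 0) (e 1)) (e 2) \<noteq> 0"
    using c(1) D b by simp
  moreover have "e k i = 0" if "i > 2" for k i
    using that u0 v0 w0 by (simp add: e_def)
  ultimately have "\<exists>l. frame e l"
    by (intro frame_of_basis)
  then obtain l where l: "frame e l"
    by blast
  interpret frame e l
    by (rule l)
  show thesis
  proof (rule that[OF l])
    have "comb e (triple 1 0 0) = u"
      by (simp add: comb_def sum_le_2 e)
    then show "M = proj_pt (comb e (triple 1 0 0))"
      using proj_pt_hc[OF M(1)] by (simp add: u_def)
    have "comb e (triple 0 0 1) = (\<lambda>i. c * v i)"
      by (simp add: comb_def sum_le_2 e)
    then show "N = proj_pt (comb e (triple 0 0 1))"
      using proj_pt_hc[OF N(1)] proj_pt_scale[OF c(1)] by (simp add: v_def)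
    fix p
    show "p \<in> K \<longleftrightarrow> p \<in> proj_points 2 \<and> (coords l p 1)\<^sup>2 = coords l p 0 * coords l p 2"
    proof (cases "p \<in> proj_points 2")
      case True
      define x where "x = coords l p"
      have ev: "B (e 2) y = c * B v y" for y
        by (simp add: e B_scale)
      have "B (hc p) (hc p) = B (comb e x) (comb e x)"
        by (simp add: x_def comb_coords[OF True])
      also have "\<dots> = x 0 * B u (comb e x) + x 1 * B w (comb e x) + x 2 * (c * B v (comb e x))"
        by (subst B_comb) (simp add: e(1,2) ev)
      also have "B u (comb e x) = x 2 * c * b"
        unfolding B_sym[of _ "comb e x"] B_comb ev e(1) One_nat_def e(2)
        using M wu B_sym[of v u] by (simp add: b_def)
      also have "B v (comb e x) = x 0 * b"
        unfolding B_sym[of _ "comb e x"] B_comb ev e(1) One_nat_def e(2)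
        using N wv by (simp add: b_def)
      also have "B w (comb e x) = x 1 * q"
        unfolding B_sym[of _ "comb e x"] B_comb ev e(1) One_nat_def e(2)
        using wu wv B_sym[of w u] B_sym[of w v] by (simp add: q_def)
      also have "x 0 * (x 2 * c * b) + x 1 * (x 1 * q) + x 2 * (c * (x 0 * b)) =
          x 0 * x 2 * (2 * b * c) + q * (x 1)\<^sup>2"
        by (simp add: power2_eq_square algebra_simps)
      also have "\<dots> = q * ((x 1)\<^sup>2 - x 0 * x 2)"
        unfolding c(2) by (simp add: algebra_simps)
      finally show ?thesis
        using KB True q by (simp add: x_def)
    qed (simp add: KB)
  qed
qed

section \<open>Local structure of blow-ups\<close>

lemma morphism_const:
  assumes W: "space_with_functions W" and x: "x \<in> points X"
  shows "fs_morphism W X (\<lambda>_. x)"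
proof (rule morphismI)
  show "continuous_map (zar W) (zar X) (\<lambda>_. x)"
    using x by simp
  fix U g
  assume "g \<in> reg X U"
  have "openin (zar W) {w \<in> points W. x \<in> U}"
    by (cases "x \<in> U") simp_all
  then show "(\<lambda>_. g x) \<in> reg W {w \<in> points W. x \<in> U}"
    by (rule reg_const[OF W])
qed

lemma morphism_id:
  assumes X: "space_with_functions X"
  shows "fs_morphism X X (\<lambda>x. x)"
proof (rule morphism_regI[OF X X])
  fix U g
  assume g: "g \<in> reg X U"
  have "{x \<in> points X. x \<in> U} = U"
    using openin_subset[OF reg_openin[OF X g]] by blast
  with g show "g \<in> reg X {x \<in> points X. x \<in> U}"
    by (simp only:)
qed

text \<open>A linear map of homogeneous coordinates is undefined only at the common zeros of its
  rows, and \<open>nz\<close> keeps the image of \<open>g\<close> away from them; ratios of linear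
  forms are regular by \<open>linear_ratio_reg\<close>.\<close>

lemma morphism_linear_proj:
  assumes W: "space_with_functions W" and g: "fs_morphism W (proj_space n) g"
    and nz: "\<And>w. w \<in> points W \<Longrightarrow> \<exists>i\<le>m. (\<Sum>j\<le>n. a i j * hc (g w) j) \<noteq> 0"
  shows "fs_morphism W (proj_space m) (\<lambda>w. proj_pt (\<lambda>i. if i \<le> m then \<Sum>j\<le>n. a i j * hc (g w) j else 0))"
  unfolding proj_space_def[of m]
proof (rule morphism_generatedI[OF W])
  let ?v = "\<lambda>w i. if i \<le> m then \<Sum>j\<le>n. a i j * hc (g w) j else 0"
  show "proj_pt (?v w) \<in> proj_points m" if w: "w \<in> points W" for w
  proof -
    obtain i where "i \<le> m" "(\<Sum>j\<le>n. a i j * hc (g w) j) \<noteq> 0"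
      using nz[OF w] by blast
    then show ?thesis
      by (intro proj_pt_in_points[of m _ i]) auto
  qed
  fix U k
  assume "(U, k) \<in> {({p. hc p j \<noteq> 0}, \<lambda>p. hc p i / hc p j) | i j. i \<le> m \<and> j \<le> m}"
  then obtain i j where ij: "U = {p. hc p j \<noteq> 0}" "k = (\<lambda>p. hc p i / hc p j)" "i \<le> m" "j \<le> m"
    by blast
  have hc: "(hc (proj_pt (?v w)) j \<noteq> 0 \<longleftrightarrow> (\<Sum>s\<le>n. a j s * hc (g w) s) \<noteq> 0) \<and>
      hc (proj_pt (?v w)) i / hc (proj_pt (?v w)) j =
      (\<Sum>s\<le>n. a i s * hc (g w) s) / (\<Sum>s\<le>n. a j s * hc (g w) s)" for w
  proof -
    obtain c where "c \<noteq> 0" "hc (proj_pt (?v w)) = (\<lambda>i. c * ?v w i)"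
      using hc_proj_pt by blast
    then show ?thesis
      using ij by simp
  qed
  have const: "(\<lambda>_. c) \<in> reg W (points W)" for c
    by (rule reg_const[OF W openin_topspace])
  have "(\<lambda>w. (\<Sum>s\<le>n. a i s * hc (g w) s) / (\<Sum>s\<le>n. a j s * hc (g w) s)) \<in>
    reg W {w \<in> points W. (\<Sum>s\<le>n. a j s * hc (g w) s) \<noteq> 0}"
    by (rule linear_ratio_reg[OF W g openin_topspace const const])
  then show "(\<lambda>w. k (proj_pt (?v w))) \<in> reg W {w \<in> points W. proj_pt (?v w) \<in> U}"
    unfolding ij(1,2) using hc by simp
qed

section \<open>The graph model of a blow-up\<close>

definition blowup_graph :: "'a set \<Rightarrow> nat \<Rightarrow> (nat \<Rightarrow> 'a \<Rightarrow> complex) \<Rightarrow> ('a \<times> pt) set" where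
  "blowup_graph U r f =
     {(x, proj_pt (\<lambda>i. if i \<le> r then f i x else 0)) | x. x \<in> U \<and> (\<exists>i\<le>r. f i x \<noteq> 0)}"

lemma blowup_graph_subset: "blowup_graph U r f \<subseteq> U \<times> proj_points r"
proof
  fix p
  assume "p \<in> blowup_graph U r f"
  then obtain x i where p: "p = (x, proj_pt (\<lambda>i. if i \<le> r then f i x else 0))" "x \<in> U" "i \<le> r" "f i x \<noteq> 0"
    unfolding blowup_graph_def by blast
  then show "p \<in> U \<times> proj_points r"
    by (auto intro!: proj_pt_in_points[of r _ i])
qed

lemma points_blowup_model:
  "points (blowup_model X U r f) =
     zar (fs_prod (fs_sub X U) (proj_space r)) closure_of blowup_graph U r f"
  by (simp add: blowup_model_def Let_def blowup_graph_def)

lemma points_blowup_model_subset: "points (blowup_model X U r f) \<subseteq> U \<times> proj_points r"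
  unfolding points_blowup_model using closure_of_subset_topspace[of "zar (fs_prod (fs_sub X U) (proj_space r))"]
  by simp

lemma blowup_graph_in_model: "blowup_graph U r f \<subseteq> points (blowup_model X U r f)"
  unfolding points_blowup_model by (rule closure_of_subset) (simp add: blowup_graph_subset)

lemma swf_blowup_model [simp]: "space_with_functions (blowup_model X U r f)"
  by (simp add: blowup_model_def Let_def)

lemma morphism_into_blowup_model:
  assumes W: "space_with_functions W" and x: "fs_morphism W (fs_sub X U) x"
    and y: "fs_morphism W (proj_space r) y"
    and xy: "\<And>w. w \<in> points W \<Longrightarrow> (x w, y w) \<in> points (blowup_model X U r f)"
  shows "fs_morphism W (blowup_model X U r f) (\<lambda>w. (x w, y w))"
proof -
  have "fs_morphism W (fs_sub (fs_prod (fs_sub X U) (proj_space r)) (points (blowup_model X U r f)))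
      (\<lambda>w. (x w, y w))"
    by (rule morphism_into_sub[OF W morphism_Pair[OF W x y] xy])
  then show ?thesis
    unfolding points_blowup_model by (simp add: blowup_model_def Let_def blowup_graph_def)
qed

text \<open>The form in which the local isomorphism is used: \<psi> is kept as a morphism from the
  model to \<open>X'\<close>, while \<phi> only has to locate a given point of \<open>X'\<close> in
  the model.\<close>

lemma blowup_local_model:
  assumes b: "is_blowup X Z X' \<beta>" and x: "x \<in> points X"
  obtains U r f \<phi> \<psi> where "openin (zar X) U" "x \<in> U" "generates_ideal X Z U r f"
    "fs_morphism (blowup_model X U r f) X' \<psi>"
    "\<And>p. p \<in> points (blowup_model X U r f) \<Longrightarrow> \<beta> (\<psi> p) = fst p"
    "\<And>\<xi>. \<xi> \<in> points X' \<Longrightarrow> \<beta> \<xi> \<in> U \<Longrightarrow>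
       \<phi> \<xi> \<in> points (blowup_model X U r f) \<and> fst (\<phi> \<xi>) = \<beta> \<xi> \<and> \<psi> (\<phi> \<xi>) = \<xi>"
proof -
  have X': "space_with_functions X'"
    using b unfolding is_blowup_def by (elim conjE)
  have "\<forall>x\<in>points X. \<exists>U r f \<phi>.
        openin (zar X) U \<and> x \<in> U \<and> generates_ideal X Z U r f \<and>
        fs_isomorphism (fs_sub X' {\<xi> \<in> points X'. \<beta> \<xi> \<in> U}) (blowup_model X U r f) \<phi> \<and>
        (\<forall>\<xi>\<in>points X'. \<beta> \<xi> \<in> U \<longrightarrow> fst (\<phi> \<xi>) = \<beta> \<xi>)"
    using b unfolding is_blowup_def by (elim conjE)
  from bspec[OF this x] obtain U r f \<phi> where U: "openin (zar X) U" "x \<in> U" "generates_ideal X Z U r f"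
    "fs_isomorphism (fs_sub X' {\<xi> \<in> points X'. \<beta> \<xi> \<in> U}) (blowup_model X U r f) \<phi>"
    "\<forall>\<xi>\<in>points X'. \<beta> \<xi> \<in> U \<longrightarrow> fst (\<phi> \<xi>) = \<beta> \<xi>"
    by (elim exE conjE) (rule that)
  let ?S = "{\<xi> \<in> points X'. \<beta> \<xi> \<in> U}" and ?B = "blowup_model X U r f"
  from U(4)[unfolded fs_isomorphism_def] obtain \<psi> where \<phi>: "fs_morphism (fs_sub X' ?S) ?B \<phi>"
    and \<psi>: "fs_morphism ?B (fs_sub X' ?S) \<psi>"
    and inv: "\<forall>\<xi>\<in>points (fs_sub X' ?S). \<psi> (\<phi> \<xi>) = \<xi>" "\<forall>p\<in>points ?B. \<phi> (\<psi> p) = p"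
    by (elim exE conjE) (rule that)
  show thesis
  proof (rule that[OF U(1-3)])
    show "fs_morphism ?B X' \<psi>"
      by (rule morphism_comp[OF \<psi> fs_sub_inclusion[OF X']]) auto
    show "\<beta> (\<psi> p) = fst p" if p: "p \<in> points ?B" for p
    proof -
      have "\<psi> p \<in> ?S"
        using morphism_in_points[OF \<psi> p] by simp
      then have "fst (\<phi> (\<psi> p)) = \<beta> (\<psi> p)"
        using U(5) by simp
      then show ?thesis
        using inv(2) p by simp
    qed
    show "\<phi> \<xi> \<in> points ?B \<and> fst (\<phi> \<xi>) = \<beta> \<xi> \<and> \<psi> (\<phi> \<xi>) = \<xi>" if "\<xi> \<in> points X'" "\<beta> \<xi> \<in> U" for \<xi>
      using that U(5) inv(1) morphism_in_points[OF \<phi>, of \<xi>] by simp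
  qed
qed

text \<open>Off the centre the generators have no common zero, so the blow-up is locally the graph of
  \<open>[f 0 : \<dots> : f r]\<close>, which is closed.\<close>

lemma blowup_section:
  assumes X: "space_with_functions X" and b: "is_blowup X Z X' \<beta>" and x: "x \<in> points X" "x \<notin> Z"
  obtains U \<sigma> where "openin (zar X) U" "x \<in> U" "U \<inter> Z = {}" "fs_morphism (fs_sub X U) X' \<sigma>"
    "\<And>y. y \<in> U \<Longrightarrow> \<beta> (\<sigma> y) = y" "\<And>\<xi>. \<xi> \<in> points X' \<Longrightarrow> \<beta> \<xi> \<in> U \<Longrightarrow> \<sigma> (\<beta> \<xi>) = \<xi>"
proof -
  obtain U r f \<phi> \<psi> where U: "openin (zar X) U" "x \<in> U" "generates_ideal X Z U r f"
    and \<psi>: "fs_morphism (blowup_model X U r f) X' \<psi>"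
    and \<psi>': "\<And>p. p \<in> points (blowup_model X U r f) \<Longrightarrow> \<beta> (\<psi> p) = fst p"
    and \<phi>: "\<And>\<xi>. \<xi> \<in> points X' \<Longrightarrow> \<beta> \<xi> \<in> U \<Longrightarrow>
       \<phi> \<xi> \<in> points (blowup_model X U r f) \<and> fst (\<phi> \<xi>) = \<beta> \<xi> \<and> \<psi> (\<phi> \<xi>) = \<xi>"
    by (rule blowup_local_model[OF b x(1)]) (rule that)
  have Z: "closedin (zar X) Z"
    using b unfolding is_blowup_def by (elim conjE)
  define U0 where "U0 = U - Z"
  have U0: "openin (zar X) U0"
    unfolding U0_def by (rule openin_diff[OF U(1) Z])
  have UX: "U \<subseteq> points X" and U0X: "U0 \<subseteq> points X"
    using openin_subset[OF U(1)] by (auto simp: U0_def)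
  have f: "f i \<in> reg X U" if "i \<le> r" for i
    using U(3) that unfolding generates_ideal_def by blast
  have f0: "f i \<in> reg X U0" if "i \<le> r" for i
    by (rule reg_subset[OF X f[OF that] U0]) (auto simp: U0_def)
  \<comment> \<open>The constant 1 vanishes on the empty set \<open>U0 \<inter> Z\<close>, so near
    \<open>y\<close> it is a combination of the generators.\<close>
  have nz: "\<exists>i\<le>r. f i y \<noteq> 0" if y: "y \<in> U0" for y
  proof (rule ccontr)
    assume neg: "\<not> ?thesis"
    have gen: "\<forall>V g. V \<subseteq> U \<and> g \<in> reg X V \<and> (\<forall>x\<in>V \<inter> Z. g x = 0) \<longrightarrow>
        (\<forall>x\<in>V. \<exists>W a. x \<in> W \<and> W \<subseteq> V \<and> (\<forall>i\<le>r. a i \<in> reg X W) \<and> (\<forall>y\<in>W. g y = (\<Sum>i\<le>r. a i y * f i y)))"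
      using U(3) unfolding generates_ideal_def by (elim conjE)
    have "(\<lambda>_. 1) \<in> reg X U0"
      by (rule reg_const[OF X U0])
    then have "\<exists>W a. y \<in> W \<and> W \<subseteq> U0 \<and> (\<forall>i\<le>r. a i \<in> reg X W) \<and> (\<forall>y\<in>W. 1 = (\<Sum>i\<le>r. a i y * f i y))"
      by (intro gen[rule_format, of U0 "\<lambda>_. 1"]) (use y in \<open>auto simp: U0_def\<close>)
    then obtain a where "1 = (\<Sum>i\<le>r. a i y * f i y)"
      by blast
    then show False
      using neg by simp
  qed
  define \<sigma> where "\<sigma> = (\<lambda>y. (y, proj_pt (\<lambda>i. if i \<le> r then f i y else 0)))"
  have \<sigma>_graph: "\<sigma> y \<in> blowup_graph U r f" if "y \<in> U0" for y
    unfolding \<sigma>_def blowup_graph_def using that nz[OF that] U0_def by blast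
  have \<sigma>_model: "\<sigma> y \<in> points (blowup_model X U r f)" if "y \<in> U0" for y
    by (rule subsetD[OF blowup_graph_in_model \<sigma>_graph[OF that]])
  have 1: "fs_morphism (fs_sub X U0) (fs_sub X U) (\<lambda>y. y)"
    by (rule morphism_into_sub[OF swf_sub fs_sub_inclusion[OF X U0X]]) (auto simp: U0_def)
  have 2: "fs_morphism (fs_sub X U0) (proj_space r) (\<lambda>y. proj_pt (\<lambda>i. if i \<le> r then f i y else 0))"
  proof (rule morphism_into_proj)
    show "(\<lambda>w. if i \<le> r then f i w else 0) \<in> reg (fs_sub X U0) (points (fs_sub X U0))" if "i \<le> r" for i
      using reg_fs_sub_subset[OF f0[OF that] order_refl] that by simp
  qed (use nz in auto)
  have \<sigma>: "fs_morphism (fs_sub X U0) X' (\<lambda>y. \<psi> (\<sigma> y))"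
    using morphism_comp[OF morphism_into_blowup_model[OF swf_sub 1 2] \<psi>] \<sigma>_model
    unfolding \<sigma>_def by simp
  show thesis
  proof (rule that[OF U0 _ _ \<sigma>])
    show "x \<in> U0" "U0 \<inter> Z = {}"
      using U(2) x(2) by (auto simp: U0_def)
    show "\<beta> (\<psi> (\<sigma> y)) = y" if "y \<in> U0" for y
      using \<psi>'[OF \<sigma>_model[OF that]] by (simp add: \<sigma>_def)
    fix \<xi>
    assume \<xi>: "\<xi> \<in> points X'" "\<beta> \<xi> \<in> U0"
    then have "\<beta> \<xi> \<in> U"
      by (simp add: U0_def)
    note p = \<phi>[OF \<xi>(1) this]
    define y w where "y = fst (\<phi> \<xi>)" and "w = snd (\<phi> \<xi>)"
    have y: "y \<in> U0" "y = \<beta> \<xi>"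
      using p \<xi> by (auto simp: y_def)
    have "(y, w) = \<phi> \<xi>"
      by (simp add: y_def w_def)
    then have yw: "(y, w) \<in> points (blowup_model X U r f)"
      using p by (simp only:)
    then have w: "w \<in> proj_points r"
      using points_blowup_model_subset by blast
    \<comment> \<open>On the graph the vectors \<open>f\<close> and \<open>hc w\<close> are
      proportional. The minors are linear in \<open>hc w\<close>, so they vanish on the closure too,
      and where \<open>f\<close> is nonzero they force \<open>w\<close> to be the class of
      \<open>f\<close>.\<close>
    have minors: "f i y * hc w k = f k y * hc w i" if ik: "i \<le> r" "k \<le> r" for i k
    proof -
      define m where "m = (\<lambda>j y. (if j = k then f i y else 0) - (if j = i then f k y else 0))"
      have sum: "(\<Sum>j\<le>r. m j y * hc w j) = f i y * hc w k - f k y * hc w i" for y w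
        using ik by (simp add: m_def left_diff_distrib sum_subtractf if_distrib[of "\<lambda>t. t * _"] cong: if_cong)
      have zero: "(\<lambda>_. 0) \<in> reg X U0"
        by (rule reg_const[OF X U0])
      have m: "m j \<in> reg X U0" if "j \<le> r" for j
      proof -
        have "(\<lambda>y. if j = k then f i y else 0) \<in> reg X U0"
          using f0[OF ik(1)] zero by (cases "j = k") simp_all
        moreover have "(\<lambda>y. if j = i then f k y else 0) \<in> reg X U0"
          using f0[OF ik(2)] zero by (cases "j = i") simp_all
        ultimately show ?thesis
          unfolding m_def by (rule reg_diff[OF X])
      qed
      have "(\<Sum>j\<le>r. m j y * hc w j) = 0"
      proof (rule closure_linear_condition[OF X U0 _ m UX])
        show "U0 \<subseteq> U"
          by (auto simp: U0_def)
        show "(y, w) \<in> zar (fs_prod (fs_sub X U) (proj_space r)) closure_of blowup_graph U r f" "y \<in> U0"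
          using yw y by (simp_all add: points_blowup_model)
        fix y' w'
        assume "(y', w') \<in> blowup_graph U r f"
        then have w': "w' = proj_pt (\<lambda>i. if i \<le> r then f i y' else 0)"
          unfolding blowup_graph_def by blast
        obtain c where "hc w' = (\<lambda>j. c * (if j \<le> r then f j y' else 0))"
          unfolding w' using hc_proj_pt by blast
        then show "(\<Sum>j\<le>r. m j y' * hc w' j) = 0"
          unfolding sum using ik by simp
      qed
      then show ?thesis
        unfolding sum by simp
    qed
    obtain i where i: "i \<le> r" "f i y \<noteq> 0"
      using nz[OF y(1)] by blast
    have eq: "hc w = (\<lambda>k. hc w i / f i y * (if k \<le> r then f k y else 0))"
    proof
      fix k
      show "hc w k = hc w i / f i y * (if k \<le> r then f k y else 0)"
        using minors[OF i(1), of k] i(2) hc_proj_points(1)[OF w, of k]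
        by (cases "k \<le> r") (simp_all add: field_simps)
    qed
    have "hc w i / f i y \<noteq> 0"
      using hc_proj_points(2)[OF w] eq by auto
    then have "proj_pt (hc w) = proj_pt (\<lambda>k. if k \<le> r then f k y else 0)"
      by (subst eq) (rule proj_pt_scale)
    then have "\<sigma> y = \<phi> \<xi>"
      unfolding \<sigma>_def using proj_pt_hc[OF w] by (simp add: y_def w_def)
    then show "\<psi> (\<sigma> (\<beta> \<xi>)) = \<xi>"
      using p y by simp
  qed
qed

text \<open>A curve through \<open>x\<close> leaving the diagonal in the direction \<open>(u, v)\<close>; the quadratic terms keep
  the three entries apart for small \<open>t \<noteq> 0\<close>.\<close>

definition arc :: "(letter \<Rightarrow> complex) \<Rightarrow> complex \<Rightarrow> complex \<Rightarrow> complex \<Rightarrow> letter \<Rightarrow> complex" where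
  "arc x u v t = x(\<B> := x \<A> - t * (u - t), \<C> := x \<A> - t * (v - 2 * t))"

lemma arc_apply [simp]:
  "arc x u v t \<A> = x \<A>" "arc x u v t \<B> = x \<A> - t * (u - t)" "arc x u v t \<C> = x \<A> - t * (v - 2 * t)"
  "arc x u v t \<D> = x \<D>" "arc x u v t \<E> = x \<E>" "arc x u v t \<F> = x \<F>"
  by (simp_all add: arc_def)

lemma arc_0: "arc x u v 0 = collapse x"
  by (simp add: arc_def collapse_def)

lemma reg_classical: "f \<in> reg (classical D) U \<longleftrightarrow> open U \<and> U \<subseteq> D \<and> continuous_on U f"
  by (simp add: classical_def)

lemma openin_classical: "open D \<Longrightarrow> openin (zar (classical D)) U \<longleftrightarrow> open U \<and> U \<subseteq> D"
  by (simp add: classical_def openin_open_eq)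

lemma morphism_arc:
  assumes "open D"
  shows "fs_morphism (classical D) affine_space (arc x u v)"
proof (rule morphism_into_affine[OF swf_classical[OF assms]])
  fix i
  show "(\<lambda>t. arc x u v t i) \<in> reg (classical D) (points (classical D))"
    unfolding reg_classical using assms by (cases i) (auto intro!: continuous_intros)
qed

text \<open>The blow-up of \<open>X\<close> along \<open>Z\<close> over \<open>\<sigma> x\<close>, near which the pair \<open>(X, Z)\<close> is isomorphic, via \<open>\<theta>\<close>
  and \<open>\<sigma>\<close>, to an open part of affine space with the diagonal \<open>x \<A> = x \<B> = x \<C>\<close>.\<close>

lemma blowup_diagonal_fibre:
  fixes X :: "'b fspace" and x :: "letter \<Rightarrow> complex"
  assumes X: "space_with_functions X" and b: "is_blowup X Z X' \<beta>"
    and A: "openin (zar affine_space) A" and V: "openin (zar X) V"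
    and \<sigma>: "fs_morphism (fs_sub affine_space A) X \<sigma>" and \<theta>: "fs_morphism (fs_sub X V) affine_space \<theta>"
    and \<sigma>V: "\<And>y. y \<in> A \<Longrightarrow> \<sigma> y \<in> V" and \<theta>A: "\<And>\<xi>. \<xi> \<in> V \<Longrightarrow> \<theta> \<xi> \<in> A"
    and \<sigma>\<theta>: "\<And>\<xi>. \<xi> \<in> V \<Longrightarrow> \<sigma> (\<theta> \<xi>) = \<xi>" and \<theta>\<sigma>: "\<And>y. y \<in> A \<Longrightarrow> \<theta> (\<sigma> y) = y"
    and Z1: "\<And>y. y \<in> A \<Longrightarrow> collapse y = y \<Longrightarrow> \<sigma> y \<in> Z"
    and Z2: "\<And>\<xi>. \<xi> \<in> V \<Longrightarrow> \<xi> \<in> Z \<Longrightarrow> collapse (\<theta> \<xi>) = \<theta> \<xi>"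
    and x: "x \<in> A" "collapse x = x"
  obtains F where "fs_morphism (proj_space 1) X' F"
    "\<And>p. p \<in> proj_points 1 \<Longrightarrow> \<beta> (F p) = \<sigma> x"
    "\<And>\<xi>. \<xi> \<in> points X' \<Longrightarrow> \<beta> \<xi> = \<sigma> x \<Longrightarrow> \<exists>p\<in>proj_points 1. \<xi> = F p"
    "\<And>p. p \<in> proj_points 1 \<Longrightarrow> \<exists>D c. open D \<and> 0 \<in> D \<and> fs_morphism (classical D) X' c \<and> c 0 = F p \<and>
      (\<forall>t\<in>D. arc x (hc p 0) (hc p 1) t \<in> A \<and> \<beta> (c t) = \<sigma> (arc x (hc p 0) (hc p 1) t))"
proof -
  note aff = swf_affine
  have VX: "V \<subseteq> points X"
    by (rule openin_subset[OF V])
  have x': "\<sigma> x \<in> V" "\<sigma> x \<in> points X"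
    using \<sigma>V[OF x(1)] VX by auto
  obtain U r f \<phi> \<psi> where U: "openin (zar X) U" "\<sigma> x \<in> U" "generates_ideal X Z U r f"
    and \<psi>: "fs_morphism (blowup_model X U r f) X' \<psi>"
    and \<psi>': "\<And>p. p \<in> points (blowup_model X U r f) \<Longrightarrow> \<beta> (\<psi> p) = fst p"
    and \<phi>: "\<And>\<xi>. \<xi> \<in> points X' \<Longrightarrow> \<beta> \<xi> \<in> U \<Longrightarrow>
       \<phi> \<xi> \<in> points (blowup_model X U r f) \<and> fst (\<phi> \<xi>) = \<beta> \<xi> \<and> \<psi> (\<phi> \<xi>) = \<xi>"
    by (rule blowup_local_model[OF b x'(2)]) (rule that)
  have UX: "U \<subseteq> points X"
    by (rule openin_subset[OF U(1)])
  have f: "f i \<in> reg X U" "\<forall>y\<in>U \<inter> Z. f i y = 0" if "i \<le> r" for i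
    using U(3) that unfolding generates_ideal_def by blast+
  have gen: "\<forall>V g. V \<subseteq> U \<and> g \<in> reg X V \<and> (\<forall>x\<in>V \<inter> Z. g x = 0) \<longrightarrow>
        (\<forall>x\<in>V. \<exists>W a. x \<in> W \<and> W \<subseteq> V \<and> (\<forall>i\<le>r. a i \<in> reg X W) \<and> (\<forall>y\<in>W. g y = (\<Sum>i\<le>r. a i y * f i y)))"
    using U(3) unfolding generates_ideal_def by (elim conjE)

  text \<open>Each \<open>f i\<close> is a combination of \<open>x \<A> - x \<B>\<close> and \<open>x \<A> - x \<C>\<close> in the chart, and conversely.\<close>

  define A1 where "A1 = {y \<in> A. \<sigma> y \<in> U}"
  have "\<forall>i\<in>{..r}. \<exists>W \<alpha> \<beta>. x \<in> W \<and> W \<subseteq> A1 \<and> \<alpha> \<in> reg affine_space W \<and> \<beta> \<in> reg affine_space W \<and>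
    (\<forall>y\<in>W. f i (\<sigma> y) = \<alpha> y * (y \<A> - y \<B>) + \<beta> y * (y \<A> - y \<C>))"
  proof
    fix i
    assume i: "i \<in> {..r}"
    have "(\<lambda>y. f i (\<sigma> y)) \<in> reg affine_space A1"
      unfolding A1_def by (rule morphism_sub_reg[OF aff A \<sigma>]) (use f i in simp)
    then show "\<exists>W \<alpha> \<beta>. x \<in> W \<and> W \<subseteq> A1 \<and> \<alpha> \<in> reg affine_space W \<and> \<beta> \<in> reg affine_space W \<and>
      (\<forall>y\<in>W. f i (\<sigma> y) = \<alpha> y * (y \<A> - y \<B>) + \<beta> y * (y \<A> - y \<C>))"
      by (rule reg_vanishing_on_diagonal) (use x U(2) Z1 f(2) i in \<open>auto simp: A1_def\<close>)
  qed
  from bchoice[OF this] obtain W where "\<forall>i\<in>{..r}. \<exists>\<alpha> \<beta>. x \<in> W i \<and> W i \<subseteq> A1 \<and> \<alpha> \<in> reg affine_space (W i) \<and>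
    \<beta> \<in> reg affine_space (W i) \<and> (\<forall>y\<in>W i. f i (\<sigma> y) = \<alpha> y * (y \<A> - y \<B>) + \<beta> y * (y \<A> - y \<C>))"
    by (elim exE) (rule that)
  from bchoice[OF this] obtain \<alpha> where "\<forall>i\<in>{..r}. \<exists>\<beta>. x \<in> W i \<and> W i \<subseteq> A1 \<and> \<alpha> i \<in> reg affine_space (W i) \<and>
    \<beta> \<in> reg affine_space (W i) \<and> (\<forall>y\<in>W i. f i (\<sigma> y) = \<alpha> i y * (y \<A> - y \<B>) + \<beta> y * (y \<A> - y \<C>))"
    by (elim exE) (rule that)
  from bchoice[OF this] obtain \<beta>' where W: "\<forall>i\<in>{..r}. x \<in> W i \<and> W i \<subseteq> A1 \<and> \<alpha> i \<in> reg affine_space (W i) \<and>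
    \<beta>' i \<in> reg affine_space (W i) \<and> (\<forall>y\<in>W i. f i (\<sigma> y) = \<alpha> i y * (y \<A> - y \<B>) + \<beta>' i y * (y \<A> - y \<C>))"
    by (elim exE) (rule that)
  have coord: "(\<lambda>\<xi>. \<theta> \<xi> i) \<in> reg X V" for i
    using morphism_sub_reg[OF X V \<theta> reg_affine_component] by simp
  have ideal: "\<exists>S a. \<sigma> x \<in> S \<and> S \<subseteq> U \<inter> V \<and> (\<forall>i\<le>r. a i \<in> reg X S) \<and>
      (\<forall>y\<in>S. \<theta> y \<A> - \<theta> y j = (\<Sum>i\<le>r. a i y * f i y))" if "j = \<B> \<or> j = \<C>" for j
  proof (rule gen[rule_format])
    have UV: "openin (zar X) (U \<inter> V)"
      by (rule openin_Int[OF U(1) V])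
    have zero: "\<theta> \<xi> \<A> - \<theta> \<xi> j = 0" if "\<xi> \<in> U \<inter> V \<inter> Z" for \<xi>
      using Z2[of \<xi>] that \<open>j = \<B> \<or> j = \<C>\<close> collapse_apply(2,3)[of "\<theta> \<xi>"] by auto
    show "U \<inter> V \<subseteq> U \<and> (\<lambda>y. \<theta> y \<A> - \<theta> y j) \<in> reg X (U \<inter> V) \<and>
        (\<forall>x\<in>U \<inter> V \<inter> Z. \<theta> x \<A> - \<theta> x j = 0)"
      using zero reg_subset[OF X reg_diff[OF X coord coord] UV] by simp
    show "\<sigma> x \<in> U \<inter> V"
      using U(2) x'(1) by simp
  qed
  obtain S1 a where S1: "\<sigma> x \<in> S1" "S1 \<subseteq> U \<inter> V" "\<forall>i\<le>r. a i \<in> reg X S1"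
    "\<forall>y\<in>S1. \<theta> y \<A> - \<theta> y \<B> = (\<Sum>i\<le>r. a i y * f i y)"
    using ideal[OF disjI1[OF refl]] by (elim exE conjE) (rule that)
  obtain S2 b' where S2: "\<sigma> x \<in> S2" "S2 \<subseteq> U \<inter> V" "\<forall>i\<le>r. b' i \<in> reg X S2"
    "\<forall>y\<in>S2. \<theta> y \<A> - \<theta> y \<C> = (\<Sum>i\<le>r. b' i y * f i y)"
    using ideal[OF disjI2[OF refl]] by (elim exE conjE) (rule that)
  \<comment> \<open>One neighbourhood of \<open>x\<close> on which the combinations in both
    directions are available.\<close>
  define A2 where "A2 = {y \<in> A. \<sigma> y \<in> S1 \<inter> S2} \<inter> (\<Inter>i\<in>{..r}. W i)"
  have S12: "openin (zar X) (S1 \<inter> S2)"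
    using S1(3) S2(3) by (intro openin_Int) (auto intro: reg_openin[OF X])
  have A2: "openin (zar affine_space) A2"
  proof -
    have "openin (zar affine_space) (\<Inter>i\<in>{..r}. W i)"
      using W by (intro openin_Inter) (auto intro: reg_openin[OF aff])
    then show ?thesis
      unfolding A2_def by (rule openin_Int[OF morphism_sub_openin[OF aff A \<sigma> S12]])
  qed
  have x2: "x \<in> A2"
    using x S1(1) S2(1) W by (auto simp: A2_def)
  have A2A: "A2 \<subseteq> A" "A2 \<subseteq> A1"
    using W by (auto simp: A2_def)
  have \<alpha>: "\<alpha> i \<in> reg affine_space A2" "\<beta>' i \<in> reg affine_space A2" if "i \<le> r" for i
  proof -
    have i: "\<alpha> i \<in> reg affine_space (W i)" "\<beta>' i \<in> reg affine_space (W i)" "A2 \<subseteq> W i"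
      using W that by (auto simp: A2_def)
    show "\<alpha> i \<in> reg affine_space A2" "\<beta>' i \<in> reg affine_space A2"
      by (rule reg_subset[OF aff i(1) A2 i(3)], rule reg_subset[OF aff i(2) A2 i(3)])
  qed
  have fab: "f i (\<sigma> y) = \<alpha> i y * (y \<A> - y \<B>) + \<beta>' i y * (y \<A> - y \<C>)" if "i \<le> r" "y \<in> A2" for i y
    using W that by (auto simp: A2_def)
  have a: "(\<lambda>y. a i (\<sigma> y)) \<in> reg affine_space A2" "(\<lambda>y. b' i (\<sigma> y)) \<in> reg affine_space A2" if "i \<le> r" for i
  proof -
    have i: "a i \<in> reg X S1" "b' i \<in> reg X S2"
      using S1(3) S2(3) that by simp_all
    show "(\<lambda>y. a i (\<sigma> y)) \<in> reg affine_space A2"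
      by (rule reg_subset[OF aff morphism_sub_reg[OF aff A \<sigma> i(1)] A2]) (auto simp: A2_def)
    show "(\<lambda>y. b' i (\<sigma> y)) \<in> reg affine_space A2"
      by (rule reg_subset[OF aff morphism_sub_reg[OF aff A \<sigma> i(2)] A2]) (auto simp: A2_def)
  qed
  have ab: "y \<A> - y \<B> = (\<Sum>i\<le>r. a i (\<sigma> y) * f i (\<sigma> y))" "y \<A> - y \<C> = (\<Sum>i\<le>r. b' i (\<sigma> y) * f i (\<sigma> y))"
    if "y \<in> A2" for y
  proof -
    have "\<sigma> y \<in> S1" "\<sigma> y \<in> S2" "\<theta> (\<sigma> y) = y"
      using that \<theta>\<sigma> by (auto simp: A2_def)
    then show "y \<A> - y \<B> = (\<Sum>i\<le>r. a i (\<sigma> y) * f i (\<sigma> y))" "y \<A> - y \<C> = (\<Sum>i\<le>r. b' i (\<sigma> y) * f i (\<sigma> y))"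
      using S1(4) S2(4) by metis+
  qed

  \<comment> \<open>The leading part of the generators: along an arc they are \<open>t\<close> times
    this expression, taken at \<open>(u - t, v - 2 * t)\<close>. At \<open>x\<close> it gives the
    point of the fibre in the direction \<open>(u, v)\<close>.\<close>
  define n where "n = (\<lambda>u v y i. if i \<le> r then \<alpha> i y * u + \<beta>' i y * v else 0)"
  have arc0: "arc x u v 0 = x" for u v
    by (simp add: arc_0 x(2))
  have n_arc: "f i (\<sigma> (arc x u v t)) = t * n (u - t) (v - 2 * t) (arc x u v t) i"
    if "arc x u v t \<in> A2" "i \<le> r" for u v t i
    using fab[OF that(2,1)] that(2) by (simp add: n_def algebra_simps)

  have arcs: "open {t. arc x u v t \<in> A2}" "0 \<in> {t. arc x u v t \<in> A2}"
    "fs_morphism (classical {t. arc x u v t \<in> A2}) (fs_sub affine_space A2) (arc x u v)" for u v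
  proof -
    have "openin (zar (classical UNIV)) {t \<in> points (classical UNIV). arc x u v t \<in> A2}"
      by (rule morphism_openin[OF morphism_arc[OF open_UNIV] A2])
    then show o: "open {t. arc x u v t \<in> A2}"
      by (simp add: openin_classical)
    show "0 \<in> {t. arc x u v t \<in> A2}"
      using x2 by (simp add: arc0)
    show "fs_morphism (classical {t. arc x u v t \<in> A2}) (fs_sub affine_space A2) (arc x u v)"
      by (rule morphism_into_sub[OF swf_classical[OF o] morphism_arc[OF o]]) simp
  qed

  text \<open>Dividing the relations by \<open>t\<close> along arcs shows that \<open>n\<close> has a left inverse at \<open>x\<close>.\<close>

  have inverse_n: "u = (\<Sum>i\<le>r. a i (\<sigma> x) * n u v x i)" "v = (\<Sum>i\<le>r. b' i (\<sigma> x) * n u v x i)" for u v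
  proof -
    let ?D = "{t. arc x u v t \<in> A2}"
    have arc: "fs_morphism (classical ?D) affine_space (arc x u v)"
      by (rule morphism_arc[OF arcs(1)])
    have lim: "((\<lambda>t. g (arc x u v t)) \<longlongrightarrow> g x) (at 0)" if "g \<in> reg affine_space A2" for g
      using curve_tendsto[OF arcs(1,2) arc that] x2 by (simp add: arc0)
    have id: "((\<lambda>t. t) \<longlongrightarrow> (0 :: complex)) (at 0)"
      by (rule tendsto_ident_at)
    have n_lim: "((\<lambda>t. n (u - t) (v - 2 * t) (arc x u v t) i) \<longlongrightarrow> n u v x i) (at 0)" if "i \<le> r" for i
    proof -
      have "((\<lambda>t. \<alpha> i (arc x u v t) * (u - t) + \<beta>' i (arc x u v t) * (v - 2 * t)) \<longlongrightarrow>
          \<alpha> i x * (u - 0) + \<beta>' i x * (v - 2 * 0)) (at 0)"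
        by (intro tendsto_intros lim \<alpha> id that)
      then show ?thesis
        using that by (simp add: n_def)
    qed
    have near: "\<forall>\<^sub>F t in at 0. arc x u v t \<in> A2 \<and> t \<noteq> 0"
      using eventually_nhds_in_open[OF arcs(1,2)[of u v]] unfolding eventually_at_filter
      by (rule eventually_mono) simp
    \<comment> \<open>\<open>w\<close> stands for the factor \<open>u - t\<close> or
      \<open>v - 2 * t\<close> of a coordinate difference; two limits of the same function at 0 are
      equated.\<close>
    have key: "w 0 = (\<Sum>i\<le>r. c i (\<sigma> x) * n u v x i)"
      if c: "\<And>i. i \<le> r \<Longrightarrow> (\<lambda>y. c i (\<sigma> y)) \<in> reg affine_space A2" and w: "(w \<longlongrightarrow> w 0) (at 0)"
        and rel: "\<And>t. arc x u v t \<in> A2 \<Longrightarrow> t * w t = (\<Sum>i\<le>r. c i (\<sigma> (arc x u v t)) * f i (\<sigma> (arc x u v t)))"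
      for c w
    proof -
      have "\<forall>\<^sub>F t in at 0. w t = (\<Sum>i\<le>r. c i (\<sigma> (arc x u v t)) * n (u - t) (v - 2 * t) (arc x u v t) i)"
        using near
      proof eventually_elim
        case (elim t)
        have "t * w t = t * (\<Sum>i\<le>r. c i (\<sigma> (arc x u v t)) * n (u - t) (v - 2 * t) (arc x u v t) i)"
          using rel[of t] elim by (simp add: n_arc sum_distrib_left mult.left_commute cong: sum.cong_simp)
        then show ?case
          using elim by simp
      qed
      from Lim_transform_eventually[OF w this]
      have 1: "((\<lambda>t. \<Sum>i\<le>r. c i (\<sigma> (arc x u v t)) * n (u - t) (v - 2 * t) (arc x u v t) i) \<longlongrightarrow> w 0) (at 0)" .
      have "((\<lambda>t. \<Sum>i\<le>r. c i (\<sigma> (arc x u v t)) * n (u - t) (v - 2 * t) (arc x u v t) i) \<longlongrightarrow>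
          (\<Sum>i\<le>r. c i (\<sigma> x) * n u v x i)) (at 0)"
        by (intro tendsto_sum tendsto_mult n_lim lim[of "\<lambda>y. c _ (\<sigma> y)"] c) simp_all
      from tendsto_unique[OF _ 1 this] show ?thesis
        by simp
    qed
    have "u - 0 = (\<Sum>i\<le>r. a i (\<sigma> x) * n u v x i)"
      by (rule key[of a "\<lambda>t. u - t", OF a(1) tendsto_diff[OF tendsto_const id]]) (simp_all add: ab(1)[symmetric])
    then show "u = (\<Sum>i\<le>r. a i (\<sigma> x) * n u v x i)"
      by simp
    have "v - 2 * 0 = (\<Sum>i\<le>r. b' i (\<sigma> x) * n u v x i)"
      by (rule key[of b' "\<lambda>t. v - 2 * t", OF a(2) tendsto_diff[OF tendsto_const tendsto_mult_left[OF id]]])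
        (simp_all add: ab(2)[symmetric])
    then show "v = (\<Sum>i\<le>r. b' i (\<sigma> x) * n u v x i)"
      by simp
  qed
  have n_nz: "\<exists>i\<le>r. n u v x i \<noteq> 0" if "u \<noteq> 0 \<or> v \<noteq> 0" for u v
  proof (rule ccontr)
    assume "\<not> ?thesis"
    then have "(\<Sum>i\<le>r. a i (\<sigma> x) * n u v x i) = 0" "(\<Sum>i\<le>r. b' i (\<sigma> x) * n u v x i) = 0"
      by (auto intro!: sum.neutral)
    then have "u = 0" "v = 0"
      unfolding inverse_n[symmetric] .
    then show False
      using that by simp
  qed
  have n_scale: "n (c * u) (c * v) y = (\<lambda>i. c * n u v y i)" for c u v y
    by (simp add: n_def fun_eq_iff algebra_simps)

  let ?B = "blowup_model X U r f"
  \<comment> \<open>The arc lifts to the model. For nonzero \<open>t\<close> the factor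
    \<open>t\<close> cancels in projective space, so the lift runs in the graph; \<open>n\<close>
    remains nonzero at \<open>t = 0\<close>, where the lift ends in the closure.\<close>
  have curve: "\<exists>D c. open D \<and> 0 \<in> D \<and> fs_morphism (classical D) ?B c \<and> c 0 = (\<sigma> x, proj_pt (n u v x)) \<and>
      (\<forall>t\<in>D. arc x u v t \<in> A \<and> fst (c t) = \<sigma> (arc x u v t))" if uv: "u \<noteq> 0 \<or> v \<noteq> 0" for u v
  proof -
    let ?D0 = "{t. arc x u v t \<in> A2}"
    let ?n = "\<lambda>t. n (u - t) (v - 2 * t) (arc x u v t)"
    obtain k where k: "k \<le> r" "n u v x k \<noteq> 0"
      using n_nz[OF uv] by blast
    have n_reg: "(\<lambda>t. ?n t i) \<in> reg (classical ?D0) ?D0" if "i \<le> r" for i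
    proof -
      have "(\<lambda>t. g (arc x u v t)) \<in> reg (classical ?D0) ?D0" if g: "g \<in> reg affine_space A2" for g
        using morphism_reg[OF morphism_arc[where x = x and u = u and v = v, OF arcs(1)[of u v]] g] by simp
      then have "continuous_on ?D0 (\<lambda>t. g (arc x u v t))" if g: "g \<in> reg affine_space A2" for g
        using g by (simp add: reg_classical)
      then have "continuous_on ?D0 (\<lambda>t. \<alpha> i (arc x u v t) * (u - t) + \<beta>' i (arc x u v t) * (v - 2 * t))"
        using \<alpha>[OF \<open>i \<le> r\<close>] by (intro continuous_intros) simp_all
      then show ?thesis
        using arcs(1) that by (simp add: reg_classical n_def)
    qed
    define D where "D = {t \<in> ?D0. ?n t k \<noteq> 0}"
    have D: "open D"
      using reg_nonzero_openin[OF swf_classical[OF arcs(1)] n_reg[OF k(1)]] arcs(1)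
      by (simp add: openin_classical D_def)
    have DA: "arc x u v t \<in> A2" if "t \<in> D" for t
      using that by (simp add: D_def)
    have D0: "0 \<in> D"
      using x2 k(2) by (simp add: D_def arc0)
    note cl = swf_classical[OF D]
    define c where "c = (\<lambda>t. (\<sigma> (arc x u v t), proj_pt (?n t)))"
    have arcD: "fs_morphism (classical D) (fs_sub affine_space A) (arc x u v)"
      by (rule morphism_into_sub[OF cl morphism_arc[OF D]]) (use DA A2A in auto)
    have \<sigma>arc: "\<sigma> (arc x u v t) \<in> U" if "t \<in> D" for t
      using DA[OF that] A2A(2) by (auto simp: A1_def)
    have m1: "fs_morphism (classical D) (fs_sub X U) (\<lambda>t. \<sigma> (arc x u v t))"
      by (rule morphism_into_sub[OF cl morphism_comp[OF arcD \<sigma>]]) (use \<sigma>arc in simp)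
    have m2: "fs_morphism (classical D) (proj_space r) (\<lambda>t. proj_pt (?n t))"
    proof (rule morphism_into_proj[OF cl])
      show "(\<lambda>t. ?n t i) \<in> reg (classical D) (points (classical D))" if "i \<le> r" for i
        using n_reg[OF that] D continuous_on_subset[of ?D0 "\<lambda>t. ?n t i" D]
        by (auto simp: reg_classical D_def)
      show "\<exists>i\<le>r. ?n t i \<noteq> 0" if "t \<in> points (classical D)" for t
        using that k(1) by (auto simp: D_def)
    qed (simp add: n_def)
    have cP: "fs_morphism (classical D) (fs_prod (fs_sub X U) (proj_space r)) c"
      unfolding c_def by (rule morphism_Pair[OF cl m1 m2])
    have graph: "c t \<in> blowup_graph U r f" if t: "t \<in> D" "t \<noteq> 0" for t
    proof -
      have fn: "(\<lambda>i. if i \<le> r then f i (\<sigma> (arc x u v t)) else 0) = (\<lambda>i. t * ?n t i)"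
        using n_arc[OF DA[OF t(1)]] by (auto simp: n_def)
      have "f k (\<sigma> (arc x u v t)) \<noteq> 0"
        using n_arc[OF DA[OF t(1)] k(1)] t by (simp add: D_def)
      moreover have "c t = (\<sigma> (arc x u v t), proj_pt (\<lambda>i. if i \<le> r then f i (\<sigma> (arc x u v t)) else 0))"
        unfolding c_def fn by (simp only: proj_pt_scale[OF t(2)])
      ultimately show ?thesis
        unfolding blowup_graph_def using \<sigma>arc[OF t(1)] k(1) by blast
    qed
    have "c t \<in> points ?B" if t: "t \<in> D" for t
    proof (cases "t = 0")
      case True
      have "c 0 \<in> zar (fs_prod (fs_sub X U) (proj_space r)) closure_of blowup_graph U r f"
        by (rule curve_in_closure[OF D D0 cP graph])
      then show ?thesis
        unfolding True points_blowup_model .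
    next
      case False
      show ?thesis
        by (rule subsetD[OF blowup_graph_in_model graph[OF t False]])
    qed
    then have "fs_morphism (classical D) ?B c"
      unfolding c_def by (intro morphism_into_blowup_model[OF cl m1 m2]) simp
    moreover have "c 0 = (\<sigma> x, proj_pt (n u v x))"
      by (simp add: c_def arc0)
    ultimately show ?thesis
      using D D0 DA A2A(1) by (intro exI[of _ D] exI[of _ c]) (auto simp: c_def)
  qed

  \<comment> \<open>The map from directions to the fibre; since \<open>n\<close> is linear in the
    direction, the representative \<open>hc p\<close> does not affect the projective point.\<close>
  define E where "E = (\<lambda>p. (\<sigma> x, proj_pt (n (hc p 0) (hc p 1) x)))"
  have E_in: "E p \<in> points ?B" if p: "p \<in> proj_points 1" for p
  proof -
    obtain D c where "0 \<in> D" "fs_morphism (classical D) ?B c" "c 0 = E p"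
      using curve[OF hc_P1_nonzero[OF p]] unfolding E_def by blast
    then show ?thesis
      using morphism_in_points[of "classical D" ?B c 0] by simp
  qed
  have E: "fs_morphism (proj_space 1) ?B E"
  proof -
    define m where "m = (\<lambda>i j :: nat. if j = 0 then \<alpha> i x else \<beta>' i x)"
    have m: "(\<Sum>j\<le>1. m i j * hc p j) = \<alpha> i x * hc p 0 + \<beta>' i x * hc p 1" for i p
      by (simp add: m_def)
    have id: "fs_morphism (proj_space 1) (proj_space 1) (\<lambda>p. p)"
      by (rule morphism_id) simp
    have "fs_morphism (proj_space 1) (proj_space r)
        (\<lambda>p. proj_pt (\<lambda>i. if i \<le> r then \<Sum>j\<le>1. m i j * hc p j else 0))"
    proof (rule morphism_linear_proj[OF swf_proj id])
      fix p
      assume "p \<in> points (proj_space 1)"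
      then show "\<exists>i\<le>r. (\<Sum>j\<le>1. m i j * hc p j) \<noteq> 0"
        using n_nz[OF hc_P1_nonzero, of p] unfolding m by (auto simp: n_def)
    qed
    then have "fs_morphism (proj_space 1) (proj_space r) (\<lambda>p. proj_pt (n (hc p 0) (hc p 1) x))"
      unfolding m n_def .
    then show ?thesis
      unfolding E_def
      by (intro morphism_into_blowup_model morphism_const) (use U(2) E_in in \<open>auto simp: E_def\<close>)
  qed
  show thesis
  proof (rule that)
    show "fs_morphism (proj_space 1) X' (\<lambda>p. \<psi> (E p))"
      by (rule morphism_comp[OF E \<psi>])
    show "\<beta> (\<psi> (E p)) = \<sigma> x" if "p \<in> proj_points 1" for p
      using \<psi>'[OF E_in[OF that]] by (simp add: E_def)
    show "\<exists>D c. open D \<and> 0 \<in> D \<and> fs_morphism (classical D) X' c \<and> c 0 = \<psi> (E p) \<and>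
      (\<forall>t\<in>D. arc x (hc p 0) (hc p 1) t \<in> A \<and> \<beta> (c t) = \<sigma> (arc x (hc p 0) (hc p 1) t))" if p: "p \<in> proj_points 1" for p
    proof -
      obtain D c where c: "open D" "0 \<in> D" "fs_morphism (classical D) ?B c" "c 0 = E p"
        "\<forall>t\<in>D. arc x (hc p 0) (hc p 1) t \<in> A \<and> fst (c t) = \<sigma> (arc x (hc p 0) (hc p 1) t)"
        using curve[OF hc_P1_nonzero[OF p]] unfolding E_def by blast
      have "\<beta> (\<psi> (c t)) = \<sigma> (arc x (hc p 0) (hc p 1) t)" if "t \<in> D" for t
        using \<psi>'[OF morphism_in_points[OF c(3)]] c(5) that by simp
      then show ?thesis
        using c(1,2,4,5) morphism_comp[OF c(3) \<psi>] by (intro exI[of _ D] exI[of _ "\<lambda>t. \<psi> (c t)"]) simp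
    qed
    fix \<xi>
    assume \<xi>: "\<xi> \<in> points X'" "\<beta> \<xi> = \<sigma> x"
    then have "\<beta> \<xi> \<in> U"
      using U(2) by simp
    note p = \<phi>[OF \<xi>(1) this]
    define w where "w = snd (\<phi> \<xi>)"
    have \<phi>\<xi>: "\<phi> \<xi> = (\<sigma> x, w)"
      using p \<xi>(2) unfolding w_def by (metis prod.collapse)
    then have xw: "(\<sigma> x, w) \<in> points ?B"
      using conjunct1[OF p] by (simp only:)
    then have w: "w \<in> proj_points r"
      using points_blowup_model_subset by blast
    define V3 where "V3 = {\<xi> \<in> V. \<theta> \<xi> \<in> A2}"
    have V3: "openin (zar X) V3"
      unfolding V3_def by (rule morphism_sub_openin[OF X V \<theta> A2])
    have V3S: "y \<in> S1" "y \<in> S2" "y \<in> V" "y \<in> U" "\<theta> y \<in> A2" "\<sigma> (\<theta> y) = y" if "y \<in> V3" for y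
    proof -
      have y: "y \<in> V" "\<theta> y \<in> A2"
        using that by (auto simp: V3_def)
      then show "y \<in> V" "\<theta> y \<in> A2" "\<sigma> (\<theta> y) = y"
        using \<sigma>\<theta> by auto
      then show "y \<in> S1" "y \<in> S2"
        unfolding A2_def by auto
      then show "y \<in> U"
        using S1(2) by auto
    qed
    have V3': "V3 \<subseteq> U" "V3 \<subseteq> S1" "V3 \<subseteq> S2"
      using V3S by auto
    \<comment> \<open>The left inverse of \<open>n\<close> applied to \<open>w\<close> proposes a
      direction. Expanding the generators in the differences and back reproduces \<open>hc w\<close>
      on the graph; this is linear in \<open>hc w\<close>, so it persists on the closure, and at
      \<open>\<sigma> x\<close> it says that the proposal is right.\<close>
    define u v where "u = (\<Sum>j\<le>r. a j (\<sigma> x) * hc w j)" and "v = (\<Sum>j\<le>r. b' j (\<sigma> x) * hc w j)"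
    have w_eq: "hc w i = n u v x i" if i: "i \<le> r" for i
    proof -
      define m where "m = (\<lambda>j y. \<alpha> i (\<theta> y) * a j y + \<beta>' i (\<theta> y) * b' j y - (if j = i then 1 else 0))"
      have sum: "(\<Sum>j\<le>r. m j y * hc w j) =
          \<alpha> i (\<theta> y) * (\<Sum>j\<le>r. a j y * hc w j) + \<beta>' i (\<theta> y) * (\<Sum>j\<le>r. b' j y * hc w j) - hc w i" for y w
      proof -
        have "(\<Sum>j\<le>r. m j y * hc w j) = (\<Sum>j\<le>r. \<alpha> i (\<theta> y) * (a j y * hc w j) + \<beta>' i (\<theta> y) * (b' j y * hc w j) -
            (if j = i then hc w j else 0))"
          by (intro sum.cong refl) (simp add: m_def algebra_simps)
        then show ?thesis
          using i by (simp add: sum.distrib sum_subtractf sum_distrib_left)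
      qed
      have \<alpha>\<theta>: "(\<lambda>y. \<alpha> i (\<theta> y)) \<in> reg X V3" "(\<lambda>y. \<beta>' i (\<theta> y)) \<in> reg X V3"
        unfolding V3_def by (rule morphism_sub_reg[OF X V \<theta> \<alpha>(1)[OF i]], rule morphism_sub_reg[OF X V \<theta> \<alpha>(2)[OF i]])
      have m: "m j \<in> reg X V3" if "j \<le> r" for j
      proof -
        have "a j \<in> reg X V3" "b' j \<in> reg X V3"
          using S1(3) S2(3) that V3' by (auto intro: reg_subset[OF X _ V3])
        moreover have "(\<lambda>_. if j = i then 1 else 0) \<in> reg X V3"
          by (rule reg_const[OF X V3])
        ultimately show ?thesis
          unfolding m_def by (intro reg_diff[OF X] reg_add[OF X] reg_mult[OF X] \<alpha>\<theta>)
      qed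
      have "(\<Sum>j\<le>r. m j (\<sigma> x) * hc w j) = 0"
      proof (rule closure_linear_condition[OF X V3 V3'(1) m UX])
        show "(\<sigma> x, w) \<in> zar (fs_prod (fs_sub X U) (proj_space r)) closure_of blowup_graph U r f"
          using xw by (simp add: points_blowup_model)
        show "\<sigma> x \<in> V3"
          using x'(1) x2 \<theta>\<sigma>[OF x(1)] by (simp add: V3_def)
        fix y w'
        assume "(y, w') \<in> blowup_graph U r f" and y: "y \<in> V3"
        then have w': "w' = proj_pt (\<lambda>i. if i \<le> r then f i y else 0)"
          unfolding blowup_graph_def by blast
        obtain c where c: "hc w' = (\<lambda>j. c * (if j \<le> r then f j y else 0))"
          unfolding w' using hc_proj_pt by blast
        have "(\<Sum>j\<le>r. a j y * hc w' j) = c * (\<Sum>j\<le>r. a j y * f j y)"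
          "(\<Sum>j\<le>r. b' j y * hc w' j) = c * (\<Sum>j\<le>r. b' j y * f j y)"
          unfolding c sum_distrib_left by (auto intro!: sum.cong)
        moreover have "(\<Sum>j\<le>r. a j y * f j y) = \<theta> y \<A> - \<theta> y \<B>" "(\<Sum>j\<le>r. b' j y * f j y) = \<theta> y \<A> - \<theta> y \<C>"
          using S1(4) S2(4) V3S(1,2)[OF y] by auto
        ultimately have sums: "(\<Sum>j\<le>r. a j y * hc w' j) = c * (\<theta> y \<A> - \<theta> y \<B>)"
          "(\<Sum>j\<le>r. b' j y * hc w' j) = c * (\<theta> y \<A> - \<theta> y \<C>)"
          by (simp_all only:)
        have "f i y = \<alpha> i (\<theta> y) * (\<theta> y \<A> - \<theta> y \<B>) + \<beta>' i (\<theta> y) * (\<theta> y \<A> - \<theta> y \<C>)"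
          using fab[OF i V3S(5)[OF y]] V3S(6)[OF y] by simp
        then have hci: "hc w' i = c * (\<alpha> i (\<theta> y) * (\<theta> y \<A> - \<theta> y \<B>) + \<beta>' i (\<theta> y) * (\<theta> y \<A> - \<theta> y \<C>))"
          using i c by simp
        show "(\<Sum>j\<le>r. m j y * hc w' j) = 0"
          unfolding sum sums hci by (simp add: algebra_simps)
      qed
      then show ?thesis
        unfolding sum \<theta>\<sigma>[OF x(1)] using i by (simp add: n_def u_def v_def)
    qed
    have hcw: "hc w = n u v x"
    proof
      show "hc w i = n u v x i" for i
        using w_eq[of i] hc_proj_points(1)[OF w, of i] by (cases "i \<le> r") (auto simp: n_def)
    qed
    have uv: "u \<noteq> 0 \<or> v \<noteq> 0"
      using hc_proj_points(2)[OF w] unfolding hcw by (auto simp: n_def)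
    let ?y = "\<lambda>i :: nat. if i = 0 then u else if i = 1 then v else 0"
    have "\<exists>i\<le>1. ?y i \<noteq> 0"
      using uv by (auto intro: exI[of _ 0] exI[of _ 1])
    then have y: "proj_pt ?y \<in> proj_points 1"
      unfolding proj_points_def by auto
    obtain d where d: "d \<noteq> 0" "hc (proj_pt ?y) = (\<lambda>i. d * ?y i)"
      using hc_proj_pt by blast
    have "E (proj_pt ?y) = (\<sigma> x, proj_pt (n (d * u) (d * v) x))"
      unfolding E_def d(2) by simp
    also have "\<dots> = (\<sigma> x, proj_pt (hc w))"
      unfolding n_scale hcw proj_pt_scale[OF d(1)] ..
    also have "\<dots> = \<phi> \<xi>"
      unfolding \<phi>\<xi> proj_pt_hc[OF w] ..
    finally have "\<xi> = \<psi> (E (proj_pt ?y))"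
      using p by simp
    then show "\<exists>p\<in>proj_points 1. \<xi> = \<psi> (E p)"
      using y by blast
  qed
qed

section \<open>Letters and polydiagonals\<close>

lemma finite_letters: "finite (S :: letter set)"
proof (rule finite_subset)
  show "S \<subseteq> {\<A>, \<B>, \<C>, \<D>, \<E>, \<F>}"
    using letter.exhaust by blast
qed simp

text \<open>The coincidences that may occur near the triple point: at most among the letters \<A>,
  \<B>, \<C>.\<close>

definition separated :: "(letter \<Rightarrow> 'a) \<Rightarrow> bool" where
  "separated h \<longleftrightarrow> (\<forall>i j. h i = h j \<longrightarrow> i = j \<or> {i, j} \<subseteq> {\<A>, \<B>, \<C>})"

lemma separatedD: "separated h \<Longrightarrow> h i = h j \<Longrightarrow> i \<noteq> j \<Longrightarrow> i \<in> {\<A>, \<B>, \<C>}"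
  unfolding separated_def by blast

lemma separated_inj_comp:
  assumes "inj f"
  shows "separated (\<lambda>i. f (h i)) \<longleftrightarrow> separated h"
  using assms unfolding separated_def by (simp add: inj_eq)

text \<open>The letters \<D>, \<E>, \<F> coincide with no other letter, so each is a block of its
  own. Among the types in play this leaves only (3,1,1,1), which keeps \<open>h\<close> off the
  removed set and off the first centre.\<close>

lemma separated_polydiagonal_count:
  assumes h: "separated h" "h \<in> polydiagonal K \<pi>" and t: "has_type \<pi> t"
  shows "3 \<le> count t 1"
proof -
  have part: "partition_on UNIV \<pi>" and t': "image_mset card (mset_set \<pi>) = t"
    using t unfolding has_type_def by auto
  have same: "h i = h j" if "B \<in> \<pi>" "i \<in> B" "j \<in> B" for B i j
    using h(2) that unfolding polydiagonal_def by blast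
  have single: "{d} \<in> \<pi>" if "d \<notin> {\<A>, \<B>, \<C>}" for d
  proof -
    obtain B where B: "B \<in> \<pi>" "d \<in> B"
      using part unfolding partition_on_def by blast
    have "i = d" if "i \<in> B" for i
      using separatedD[OF h(1) same[OF B(1,2) that]] \<open>d \<notin> {\<A>, \<B>, \<C>}\<close> by blast
    then have "B = {d}"
      using B(2) by blast
    then show ?thesis
      using B(1) by simp
  qed
  have fin: "finite \<pi>"
    by (rule finite_subset[OF _ finite_Pow_iff[THEN iffD2, OF finite_letters[of UNIV]]]) simp
  have "{{\<D>}, {\<E>}, {\<F>}} \<subseteq> \<pi>"
    using single by simp
  then have "mset_set {{\<D>}, {\<E>}, {\<F>}} \<subseteq># mset_set \<pi>"
    by (rule subset_imp_msubset_mset_set[OF _ fin])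
  from image_mset_subseteq_mono[OF this, of card]
  have "{#1, 1, 1#} \<subseteq># t"
    by (simp add: t')
  from mset_subset_eq_count[OF this, of 1] show ?thesis
    by simp
qed

lemma points_conic_power [simp]: "points (conic_power K) = {h. \<forall>i. h i \<in> K}"
  by (simp add: conic_power_def)

lemma swf_conic_power [simp]: "space_with_functions (conic_power K)"
  by (simp add: conic_power_def)

lemma points_H_open [simp]: "points (H_open K) = H_open_set K"
  by (simp add: H_open_def)

lemma swf_H_open [simp]: "space_with_functions (H_open K)"
  by (simp add: H_open_def)

lemma H_open_set_subset: "H_open_set K \<subseteq> {h. \<forall>i. h i \<in> K}"
  unfolding H_open_set_def by auto

lemma separated_in_H_open_set:
  assumes "\<And>i. h i \<in> K" "separated h"
  shows "h \<in> H_open_set K"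
proof -
  have "h \<notin> polydiagonal K \<mu>" if "has_type \<mu> {#3, 2, 1#} \<or> has_type \<mu> {#4, 1, 1#}" for \<mu>
    using separated_polydiagonal_count[OF assms(2), of K \<mu>] that by force
  then show ?thesis
    unfolding H_open_set_def using assms(1) by simp
qed

lemma separated_notin_Z_locus:
  assumes "separated h"
  shows "h \<notin> Z_locus K"
proof -
  have "h \<notin> polydiagonal K \<mu>" if "has_type \<mu> {#2, 2, 2#}" for \<mu>
    using separated_polydiagonal_count[OF assms, of K \<mu>] that by force
  then show ?thesis
    unfolding Z_locus_def by blast
qed

lemma collapse_eq_iff: "collapse h = h \<longleftrightarrow> h \<A> = h \<B> \<and> h \<A> = h \<C>"
proof
  assume "collapse h = h"
  then have "collapse h \<B> = h \<B>" "collapse h \<C> = h \<C>"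
    by simp_all
  then show "h \<A> = h \<B> \<and> h \<A> = h \<C>"
    by simp
qed (auto simp: collapse_def)

text \<open>Counting singletons excludes the type (2,2,1,1). Each letter of a block of size 3
  coincides with another one, so that block can only be the one of \<A>, \<B>, \<C>.\<close>

lemma separated_Y_locus:
  assumes h: "separated h" "h \<in> Y_locus K"
  shows "collapse h = h"
proof -
  obtain \<pi> where \<pi>: "has_type \<pi> {#2, 2, 1, 1#} \<or> has_type \<pi> {#3, 1, 1, 1#}" "h \<in> polydiagonal K \<pi>"
    using h(2) unfolding Y_locus_def by blast
  have "\<not> has_type \<pi> {#2, 2, 1, 1#}"
    using separated_polydiagonal_count[OF h(1) \<pi>(2)] by force
  then have "image_mset card (mset_set \<pi>) = {#3, 1, 1, 1#}"
    using \<pi>(1) unfolding has_type_def by blast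
  then have "3 \<in># image_mset card (mset_set \<pi>)"
    by simp
  then obtain B where B: "B \<in># mset_set \<pi>" "card B = 3"
    by auto
  then have "B \<in> \<pi>"
    by (cases "finite \<pi>") auto
  then have same: "h i = h j" if "i \<in> B" "j \<in> B" for i j
    using \<pi>(2) that unfolding polydiagonal_def by blast
  have "B \<subseteq> {\<A>, \<B>, \<C>}"
  proof
    fix i
    assume i: "i \<in> B"
    have "B \<noteq> {i}"
      using B(2) by auto
    then obtain j where "j \<in> B" "j \<noteq> i"
      using i by blast
    then show "i \<in> {\<A>, \<B>, \<C>}"
      using separatedD[OF h(1) same[OF i]] by blast
  qed
  then have "B = {\<A>, \<B>, \<C>}"
    using B(2) by (intro card_subset_eq) auto
  then show ?thesis
    unfolding collapse_eq_iff using same by simp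
qed

lemma collapsed_in_Y_locus:
  assumes "h \<in> H_open_set K" "collapse h = h"
  shows "h \<in> Y_locus K"
proof -
  let ?\<pi> = "{{\<A>, \<B>, \<C>}, {\<D>}, {\<E>}, {\<F>}}"
  have eq: "h \<A> = h \<B>" "h \<A> = h \<C>"
    using assms(2) unfolding collapse_eq_iff by blast+
  have "i \<in> {\<A>, \<B>, \<C>} \<union> {\<D>} \<union> {\<E>} \<union> {\<F>}" for i
    by (cases i) simp_all
  then have "partition_on UNIV ?\<pi>"
    by (intro partition_onI) (auto simp: disjnt_def)
  moreover have "mset_set ?\<pi> = {#{\<A>, \<B>, \<C>}, {\<D>}, {\<E>}, {\<F>}#}"
    by simp
  then have "image_mset card (mset_set ?\<pi>) = {#3, 1, 1, 1#}"
    by simp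
  ultimately have "has_type ?\<pi> {#3, 1, 1, 1#}"
    unfolding has_type_def by blast
  moreover have "h \<in> polydiagonal K ?\<pi>"
    unfolding polydiagonal_def using assms(1) H_open_set_subset eq by auto
  ultimately show ?thesis
    unfolding Y_locus_def using assms(1) by blast
qed

lemma openin_separated: "openin (zar affine_space) {x. separated x}"
proof -
  define I where "I = {(i, j). i \<noteq> j \<and> \<not> {i, j} \<subseteq> {\<A>, \<B>, \<C>}}"
  have "finite I"
    by (rule finite_subset[OF _ finite_cartesian_product[OF finite_letters[of UNIV] finite_letters[of UNIV]]]) simp
  \<comment> \<open>A witness that the intersection below is over a nonempty family, as
    \<open>openin_Inter\<close> demands.\<close>
  have "(\<A>, \<D>) \<in> I"
    by (simp add: I_def)
  have "openin (zar affine_space) {x. x i - x j \<noteq> (0 :: complex)}" for i j :: letter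
    using reg_nonzero_openin[OF swf_affine
        reg_diff[OF swf_affine reg_affine_component[of i] reg_affine_component[of j]]]
    by simp
  then have "openin (zar affine_space) (\<Inter>(i, j)\<in>I. {x. x i - x j \<noteq> 0})"
    using \<open>finite I\<close> \<open>(\<A>, \<D>) \<in> I\<close> by (intro openin_Inter) auto
  moreover have "(\<Inter>(i, j)\<in>I. {x. x i - x j \<noteq> 0}) = {x :: letter \<Rightarrow> complex. separated x}"
  proof (intro set_eqI iffI)
    fix x :: "letter \<Rightarrow> complex"
    assume "x \<in> (\<Inter>(i, j)\<in>I. {x. x i - x j \<noteq> 0})"
    then have "x i - x j \<noteq> 0" if "(i, j) \<in> I" for i j
      using that by blast
    then show "x \<in> {x. separated x}"
      unfolding separated_def I_def mem_Collect_eq prod.case right_minus_eq by blast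
  next
    fix x :: "letter \<Rightarrow> complex"
    assume "x \<in> {x. separated x}"
    then have "x i - x j \<noteq> 0" if "(i, j) \<in> I" for i j
      using that unfolding separated_def I_def mem_Collect_eq prod.case right_minus_eq by blast
    then show "x \<in> (\<Inter>(i, j)\<in>I. {x. x i - x j \<noteq> 0})"
      by blast
  qed
  ultimately show ?thesis
    by (simp only:)
qed

section \<open>The chart of the space of sextuples\<close>

lemma morphism_H_open_component:
  assumes m: "fs_morphism W (H_open K) m" and K: "K \<subseteq> proj_points 2"
  shows "fs_morphism W plane (\<lambda>w. m w i)"
proof -
  have "fs_morphism (H_open K) (conic_power K) (\<lambda>h. h)"
    unfolding H_open_def by (rule fs_sub_inclusion) (use H_open_set_subset in auto)
  from morphism_comp[OF m this]
  have "fs_morphism W (fs_power (fs_sub plane K)) m"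
    unfolding conic_power_def .
  from morphism_comp[OF this morphism_power_component[OF swf_sub, of plane K i]]
  have "fs_morphism W (fs_sub plane K) (\<lambda>w. m w i)" .
  from morphism_comp[OF this fs_sub_inclusion[of plane K]] show ?thesis
    using K by simp
qed

locale conic_frame = frame e l for e l +
  fixes K :: "pt set"
  assumes K_iff: "p \<in> K \<longleftrightarrow> p \<in> proj_points 2 \<and> (coords l p 1)\<^sup>2 = coords l p 0 * coords l p 2"
begin

lemma K_subset: "K \<subseteq> proj_points 2"
  by (rule subsetI) (simp add: K_iff)

text \<open>A ratio, so independent of the representative \<open>hc p\<close>. At the point at
  infinity division by zero gives the default value 0, the parameter of another point.\<close>

definition param :: "pt \<Rightarrow> complex" where
  "param p = coords l p 1 / coords l p 0"

lemma coords_gamma: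
  obtains c where "c \<noteq> 0" "coords l (\<gamma> t) 0 = c" "coords l (\<gamma> t) 1 = c * t" "coords l (\<gamma> t) 2 = c * t\<^sup>2"
proof -
  obtain c where c: "c \<noteq> 0" "\<forall>k\<le>2. coords l (\<gamma> t) k = c * triple 1 t (t\<^sup>2) k"
    using coords_comb unfolding \<gamma>_def by blast
  show thesis
    by (rule that[OF c(1)]) (use c(2) in \<open>simp_all add: all_le_2\<close>)
qed

lemma gamma_in_K: "\<gamma> t \<in> K"
  by (rule coords_gamma[of t]) (simp add: K_iff gamma_in_points power2_eq_square)

lemma coords_gamma_nonzero: "coords l (\<gamma> t) 0 \<noteq> 0"
  by (rule coords_gamma[of t]) simp

lemma param_gamma: "param (\<gamma> t) = t"
  by (rule coords_gamma[of t]) (simp add: param_def)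

lemma inj_gamma: "inj \<gamma>"
  by (metis injI param_gamma)

lemma gamma_param:
  assumes "p \<in> K" "coords l p 0 \<noteq> 0"
  shows "\<gamma> (param p) = p"
proof -
  have p: "p \<in> proj_points 2" "(coords l p 1)\<^sup>2 = coords l p 0 * coords l p 2"
    using assms(1) K_iff by auto
  have "\<forall>k\<le>2. coords l p k = coords l p 0 * triple 1 (param p) ((param p)\<^sup>2) k"
    using p(2) assms(2) unfolding all_le_2 by (simp add: param_def power2_eq_square)
  then have "proj_pt (comb e (coords l p)) = \<gamma> (param p)"
    unfolding \<gamma>_def by (intro proj_pt_comb_eq[OF assms(2)]) blast
  then show ?thesis
    using point_eq_comb[OF p(1)] by simp
qed

text \<open>On \<open>x1^2 = x0 * x2\<close> the equation \<open>x0 = 0\<close> forces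
  \<open>x1 = 0\<close>.\<close>

lemma point_at_infinity:
  assumes "p \<in> K" "coords l p 0 = 0"
  shows "p = proj_pt (comb e (triple 0 0 1))"
proof -
  have p: "p \<in> proj_points 2" "coords l p 1 = 0"
    using assms K_iff[of p] by auto
  have "coords l p 2 \<noteq> 0"
    using coords_nonzero[OF p(1)] assms(2) p(2) unfolding ex_le_2 by simp
  moreover have "\<forall>k\<le>2. coords l p k = coords l p 2 * triple 0 0 1 k"
    using assms(2) p(2) unfolding all_le_2 by simp
  ultimately have "proj_pt (comb e (coords l p)) = proj_pt (comb e (triple 0 0 1))"
    by (intro proj_pt_comb_eq) blast+
  then show ?thesis
    using point_eq_comb[OF p(1)] by simp
qed

lemma morphism_gamma:
  assumes W: "space_with_functions W" and t: "t \<in> reg W (points W)"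
  shows "fs_morphism W plane (\<lambda>w. \<gamma> (t w))"
  unfolding \<gamma>_def
proof (rule morphism_into_proj[OF W])
  have c: "(\<lambda>_. c) \<in> reg W (points W)" for c
    by (rule reg_const[OF W openin_topspace])
  show "(\<lambda>w. comb e (triple 1 (t w) ((t w)\<^sup>2)) i) \<in> reg W (points W)" for i
  proof -
    have "(\<lambda>w. e 0 i + t w * e 1 i + (t w * t w) * e 2 i) \<in> reg W (points W)"
      by (intro reg_add[OF W] reg_mult[OF W] t c)
    then show ?thesis
      by (simp add: comb_def sum_le_2 power2_eq_square)
  qed
  show "\<exists>i\<le>2. comb e (triple 1 (t w) ((t w)\<^sup>2)) i \<noteq> 0" for w
    by (rule comb_nonzero[of 0]) simp_all
  show "comb e (triple 1 (t w) ((t w)\<^sup>2)) i = 0" if "i > 2" for w i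
    using that by (simp add: comb_def support)
qed

text \<open>Regularity is checked entry by entry; \<open>separated\<close>, carried over by the
  injective \<open>\<gamma>\<close>, keeps the values off the removed polydiagonals.\<close>

lemma morphism_chart:
  fixes x :: "'w \<Rightarrow> letter \<Rightarrow> complex"
  assumes W: "space_with_functions W" and x: "\<And>i. (\<lambda>w. x w i) \<in> reg W (points W)"
    and sep: "\<And>w. w \<in> points W \<Longrightarrow> separated (x w)"
  shows "fs_morphism W (H_open K) (\<lambda>w i. \<gamma> (x w i))"
proof -
  have "fs_morphism W (conic_power K) (\<lambda>w i. \<gamma> (x w i))"
    unfolding conic_power_def
  proof (rule morphism_into_power[OF W])
    fix i
    have "fs_morphism W plane (\<lambda>w. \<gamma> (x w i))"
      by (rule morphism_gamma[OF W x])
    then show "fs_morphism W (fs_sub plane K) (\<lambda>w. \<gamma> (x w i))"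
      by (rule morphism_into_sub[OF W]) (rule gamma_in_K)
  qed
  then show ?thesis
    unfolding H_open_def
  proof (rule morphism_into_sub[OF W])
    show "(\<lambda>i. \<gamma> (x w i)) \<in> H_open_set K" if "w \<in> points W" for w
      using sep[OF that] by (intro separated_in_H_open_set gamma_in_K) (simp add: separated_inj_comp[OF inj_gamma])
  qed
qed

text \<open>The frame coordinates of each entry are linear forms in \<open>hc\<close>, so their
  ratio is regular where the denominator is nonzero; six such open conditions are
  intersected.\<close>

lemma chart_inverse:
  assumes W: "space_with_functions W" and m: "fs_morphism W (H_open K) m"
  shows "openin (zar W) {w \<in> points W. \<forall>i. coords l (m w i) 0 \<noteq> 0}"
    "(\<lambda>w. param (m w i)) \<in> reg W {w \<in> points W. \<forall>i. coords l (m w i) 0 \<noteq> 0}"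
proof -
  have c: "(\<lambda>_. c) \<in> reg W (points W)" for c
    by (rule reg_const[OF W openin_topspace])
  have r: "(\<lambda>w. param (m w i)) \<in> reg W {w \<in> points W. coords l (m w i) 0 \<noteq> 0}" for i
    unfolding param_def coords_def
    by (rule linear_ratio_reg[OF W morphism_H_open_component[OF m K_subset] openin_topspace c c])
  let ?I = "\<Inter>i. {w \<in> points W. coords l (m w i) 0 \<noteq> 0}"
  have I: "?I = {w \<in> points W. \<forall>i. coords l (m w i) 0 \<noteq> 0}"
    by auto
  have "openin (zar W) {w \<in> points W. coords l (m w i) 0 \<noteq> 0}" for i
    by (rule reg_openin[OF W r])
  then have "openin (zar W) ?I"
    using finite_letters by (intro openin_Inter) auto
  then show o: "openin (zar W) {w \<in> points W. \<forall>i. coords l (m w i) 0 \<noteq> 0}"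
    unfolding I .
  show "(\<lambda>w. param (m w i)) \<in> reg W {w \<in> points W. \<forall>i. coords l (m w i) 0 \<noteq> 0}"
    by (rule reg_subset[OF W r o]) auto
qed

end

section \<open>The fibre over a triple point\<close>

lemma morphism_classical_subset:
  assumes D0: "open D" and D: "open D'" "D' \<subseteq> D" and c: "fs_morphism (classical D) X c"
  shows "fs_morphism (classical D') X c"
proof -
  have "fs_morphism (classical D') (classical D) (\<lambda>t. t)"
  proof (rule morphism_regI[OF swf_classical[OF D(1)] swf_classical[OF D0]])
    show "t \<in> points (classical D)" if "t \<in> points (classical D')" for t
      using that D(2) by auto
    fix U g
    assume "g \<in> reg (classical D) U"
    then have g: "open U" "U \<subseteq> D" "continuous_on U g"
      by (auto simp: reg_classical)
    have "{t \<in> points (classical D'). t \<in> U} = D' \<inter> U"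
      by auto
    moreover have "continuous_on (D' \<inter> U) g"
      by (rule continuous_on_subset[OF g(3)]) simp
    ultimately show "g \<in> reg (classical D') {t \<in> points (classical D'). t \<in> U}"
      using D(1) g(1) by (simp add: reg_classical open_Int)
  qed
  from morphism_comp[OF this c] show ?thesis .
qed

text \<open>The limits of \<open>pascal_coeffs a1 a2 a3 b1 b2 b3\<close>, rescaled, as \<open>a1 = 0\<close> and \<open>a2, a3\<close> tend to \<open>0\<close> in the
  direction \<open>(- u, - v)\<close>.\<close>

definition limit_coeffs :: "complex \<Rightarrow> complex \<Rightarrow> complex \<Rightarrow> complex \<Rightarrow> complex \<Rightarrow> nat \<Rightarrow> complex" where
  "limit_coeffs b1 b2 b3 u v = triple 0 (u * (b2 * (b3 - b1)) + v * (b3 * (b1 - b2)))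
     (u * (b1 - b3) + v * (b2 - b1))"

text \<open>\<open>pascal_coeffs\<close> at the upper entries 0, -t u, -t v with one factor
  \<open>t\<close> removed. The columns of the \<open>a\<^sub>i b\<^sub>i\<close> and of the
  \<open>a\<^sub>i\<close> are both divisible by \<open>t\<close>, so the minors that contain both
  keep a second factor.\<close>

definition arc_coeffs ::
    "complex \<Rightarrow> complex \<Rightarrow> complex \<Rightarrow> complex \<Rightarrow> complex \<Rightarrow> complex \<Rightarrow> nat \<Rightarrow> complex" where
  "arc_coeffs b1 b2 b3 u v t = triple
     (- (t * det3 (0, - u * b2, - v * b3) (0, - u, - v) (b1, b2, b3)))
     (t * det3 (0, - u * b2, - v * b3) (0, - u, - v) (1, 1, 1) -
      det3 (0, - u * b2, - v * b3) (b1, b2, b3) (1, 1, 1))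
     (det3 (0, - u, - v) (b1, b2, b3) (1, 1, 1))"

lemma pascal_coeffs_arc:
  "k \<le> 2 \<Longrightarrow> pascal_coeffs 0 (0 - t * u) (0 - t * v) b1 b2 b3 k = t * arc_coeffs b1 b2 b3 u v t k"
proof -
  have "\<forall>k\<le>2. pascal_coeffs 0 (0 - t * u) (0 - t * v) b1 b2 b3 k = t * arc_coeffs b1 b2 b3 u v t k"
    unfolding all_le_2 pascal_coeffs_def arc_coeffs_def det3_def triple_apply One_nat_def prod.case
    by (intro conjI; algebra)
  then show "k \<le> 2 \<Longrightarrow> ?thesis"
    by blast
qed

lemma arc_coeffs_0: "k \<le> 2 \<Longrightarrow> arc_coeffs b1 b2 b3 u v 0 k = limit_coeffs b1 b2 b3 u v k"
proof -
  have "\<forall>k\<le>2. arc_coeffs b1 b2 b3 u v 0 k = limit_coeffs b1 b2 b3 u v k"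
    unfolding all_le_2 limit_coeffs_def arc_coeffs_def det3_def triple_apply One_nat_def prod.case
    by (intro conjI; algebra)
  then show "k \<le> 2 \<Longrightarrow> ?thesis"
    by blast
qed

lemma continuous_arc_coeffs: "continuous_on UNIV (\<lambda>t. arc_coeffs b1 b2 b3 (u - t) (v - 2 * t) t k)"
  unfolding arc_coeffs_def det3_def triple_def prod.case
  by (cases "k = 0"; cases "k = 1"; cases "k = 2") (auto intro!: continuous_intros)

section \<open>The line of directions and the pencil of lines\<close>

context frame
begin

definition line_of :: "complex \<Rightarrow> complex \<Rightarrow> complex \<Rightarrow> pt \<Rightarrow> pt" where
  "line_of b1 b2 b3 p = proj_pt (comb l (limit_coeffs b1 b2 b3 (hc p 0) (hc p 1)))"

text \<open>The inverse of \<open>limit_coeffs\<close>, written in the coordinates \<open>hc\<close>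
  of the line. For a line with coefficients (0, L1, L2), the combination \<open>L1 + b3 * L2\<close>
  eliminates v and \<open>L1 + b2 * L2\<close> eliminates u; up to the factor b3 or b2 these are the
  values of the form at the points with parameters b3 and b2.\<close>

definition direction_matrix :: "complex \<Rightarrow> complex \<Rightarrow> complex \<Rightarrow> nat \<Rightarrow> nat \<Rightarrow> complex" where
  "direction_matrix b1 b2 b3 i j =
     (if i = 0 then (e 1 j + b3 * e 2 j) / ((b3 - b1) * (b2 - b3))
      else (e 1 j + b2 * e 2 j) / ((b1 - b2) * (b3 - b2)))"

definition direction_of :: "complex \<Rightarrow> complex \<Rightarrow> complex \<Rightarrow> pt \<Rightarrow> pt" where
  "direction_of b1 b2 b3 m =
     proj_pt (\<lambda>i. if i \<le> 1 then \<Sum>j\<le>2. direction_matrix b1 b2 b3 i j * hc m j else 0)"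

lemma direction_matrix_apply:
  "(\<Sum>j\<le>2. direction_matrix b1 b2 b3 0 j * hc m j) =
     (coords e m 1 + b3 * coords e m 2) / ((b3 - b1) * (b2 - b3))"
  "(\<Sum>j\<le>2. direction_matrix b1 b2 b3 (Suc 0) j * hc m j) =
     (coords e m 1 + b2 * coords e m 2) / ((b1 - b2) * (b3 - b2))"
  by (simp_all add: direction_matrix_def coords_def sum_le_2 add_divide_distrib algebra_simps)

lemma pencil_iff:
  assumes "M = proj_pt (comb e (triple 1 0 0))"
  shows "m \<in> pencil M \<longleftrightarrow> m \<in> proj_points 2 \<and> coords e m 0 = 0"
proof (cases "m \<in> proj_points 2")
  case True
  have "incident M m \<longleftrightarrow> dot (coords e m) (triple 1 0 0) = 0"
    unfolding assms by (rule incident_point[OF True, of 0]) simp_all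
  then show ?thesis
    using True by (simp add: pencil_def dot_expand)
qed (simp add: pencil_def)

context
  fixes b1 b2 b3 :: complex
  assumes b: "b1 \<noteq> b2" "b1 \<noteq> b3" "b2 \<noteq> b3"
begin

lemma limit_coeffs_solve:
  "limit_coeffs b1 b2 b3 u v 1 + b3 * limit_coeffs b1 b2 b3 u v 2 = u * ((b3 - b1) * (b2 - b3))"
  "limit_coeffs b1 b2 b3 u v 1 + b2 * limit_coeffs b1 b2 b3 u v 2 = v * ((b1 - b2) * (b3 - b2))"
  unfolding limit_coeffs_def triple_apply One_nat_def by algebra+

lemma limit_coeffs_nonzero:
  assumes "u \<noteq> 0 \<or> v \<noteq> 0"
  shows "\<exists>k\<le>2. limit_coeffs b1 b2 b3 u v k \<noteq> 0"
proof (rule ccontr)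
  assume "\<not> ?thesis"
  then have "u * ((b3 - b1) * (b2 - b3)) = 0" "v * ((b1 - b2) * (b3 - b2)) = 0"
    using limit_coeffs_solve[of u v] unfolding ex_le_2 by simp_all
  then show False
    using assms b by auto
qed

lemma line_of_coords:
  obtains c where "c \<noteq> 0" "\<And>k. k \<le> 2 \<Longrightarrow> coords e (line_of b1 b2 b3 p) k = c * limit_coeffs b1 b2 b3 (hc p 0) (hc p 1) k"
proof -
  obtain c where "c \<noteq> 0" "\<forall>k\<le>2. coords e (line_of b1 b2 b3 p) k = c * limit_coeffs b1 b2 b3 (hc p 0) (hc p 1) k"
    using frame.coords_comb[OF swap] unfolding line_of_def by blast
  then show thesis
    by (intro that[of c]) simp_all
qed

lemma line_of_in_points:
  assumes p: "p \<in> proj_points 1"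
  shows "line_of b1 b2 b3 p \<in> proj_points 2"
proof -
  obtain k where "k \<le> 2" "limit_coeffs b1 b2 b3 (hc p 0) (hc p 1) k \<noteq> 0"
    using limit_coeffs_nonzero[OF hc_P1_nonzero[OF p]] by blast
  then show ?thesis
    unfolding line_of_def by (rule frame.comb_in_points[OF swap])
qed

lemma line_of_in_pencil:
  assumes M: "M = proj_pt (comb e (triple 1 0 0))" and p: "p \<in> proj_points 1"
  shows "line_of b1 b2 b3 p \<in> pencil M"
  by (rule line_of_coords[of p]) (simp add: pencil_iff[OF M] line_of_in_points[OF p] limit_coeffs_def)

lemma direction_of_line_of:
  assumes p: "p \<in> proj_points 1"
  shows "direction_of b1 b2 b3 (line_of b1 b2 b3 p) = p"
proof -
  let ?m = "line_of b1 b2 b3 p"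
  obtain c where c: "c \<noteq> 0" "\<And>k. k \<le> 2 \<Longrightarrow> coords e ?m k = c * limit_coeffs b1 b2 b3 (hc p 0) (hc p 1) k"
    by (rule line_of_coords[of p]) (rule that)
  have "coords e ?m 1 + b3 * coords e ?m 2 =
      c * (limit_coeffs b1 b2 b3 (hc p 0) (hc p 1) 1 + b3 * limit_coeffs b1 b2 b3 (hc p 0) (hc p 1) 2)"
    "coords e ?m 1 + b2 * coords e ?m 2 =
      c * (limit_coeffs b1 b2 b3 (hc p 0) (hc p 1) 1 + b2 * limit_coeffs b1 b2 b3 (hc p 0) (hc p 1) 2)"
    using c(2)[of 1] c(2)[of 2] by (simp_all add: algebra_simps)
  then have 1: "(\<Sum>j\<le>2. direction_matrix b1 b2 b3 0 j * hc ?m j) = c * hc p 0"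
    "(\<Sum>j\<le>2. direction_matrix b1 b2 b3 (Suc 0) j * hc ?m j) = c * hc p 1"
    unfolding direction_matrix_apply limit_coeffs_solve using b by simp_all
  have "(\<lambda>i. if i \<le> 1 then \<Sum>j\<le>2. direction_matrix b1 b2 b3 i j * hc ?m j else 0) = (\<lambda>i. c * hc p i)"
  proof
    fix i :: nat
    consider "i = 0" | "i = Suc 0" | "i > 1"
      by linarith
    then show "(if i \<le> 1 then \<Sum>j\<le>2. direction_matrix b1 b2 b3 i j * hc ?m j else 0) = c * hc p i"
      by cases (use 1 hc_proj_points(1)[OF p, of i] in simp_all)
  qed
  then show ?thesis
    unfolding direction_of_def using proj_pt_scale[OF c(1)] proj_pt_hc[OF p] by simp
qed

lemma pencil_direction_nonzero:
  assumes M: "M = proj_pt (comb e (triple 1 0 0))" and m: "m \<in> pencil M"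
  shows "\<exists>i\<le>1. (\<Sum>j\<le>2. direction_matrix b1 b2 b3 i j * hc m j) \<noteq> 0"
proof (rule ccontr)
  assume neg: "\<not> ?thesis"
  have "coords e m 1 + b3 * coords e m 2 = 0" "coords e m 1 + b2 * coords e m 2 = 0"
    using neg[simplified, rule_format, of 0] neg[simplified, rule_format, of 1] b
    by (simp_all add: direction_matrix_apply)
  then have "(b3 - b2) * coords e m 2 = 0"
    by algebra
  then have "coords e m 2 = 0"
    using b by simp
  moreover have "coords e m 1 = 0"
    using \<open>coords e m 1 + b3 * coords e m 2 = 0\<close> \<open>coords e m 2 = 0\<close> by simp
  moreover have "m \<in> proj_points 2" "coords e m 0 = 0"
    using m pencil_iff[OF M] by auto
  ultimately show False
    using frame.coords_nonzero[OF swap] unfolding ex_le_2 by blast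
qed

lemma line_of_direction_of:
  assumes M: "M = proj_pt (comb e (triple 1 0 0))" and m: "m \<in> pencil M"
  shows "line_of b1 b2 b3 (direction_of b1 b2 b3 m) = m"
proof -
  have m': "m \<in> proj_points 2" "coords e m 0 = 0"
    using m pencil_iff[OF M] by auto
  let ?u = "(coords e m 1 + b3 * coords e m 2) / ((b3 - b1) * (b2 - b3))"
  let ?v = "(coords e m 1 + b2 * coords e m 2) / ((b1 - b2) * (b3 - b2))"
  obtain c where c: "c \<noteq> 0" "hc (direction_of b1 b2 b3 m) =
      (\<lambda>i. c * (if i \<le> 1 then \<Sum>j\<le>2. direction_matrix b1 b2 b3 i j * hc m j else 0))"
    using hc_proj_pt unfolding direction_of_def by blast
  have hc: "hc (direction_of b1 b2 b3 m) 0 = c * ?u" "hc (direction_of b1 b2 b3 m) 1 = c * ?v"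
    unfolding c(2) by (simp_all add: direction_matrix_apply)
  have D: "(b3 - b1) * (b2 - b3) \<noteq> 0" "(b1 - b2) * (b3 - b2) \<noteq> 0"
    using b by simp_all
  let ?L = "limit_coeffs b1 b2 b3 (c * ?u) (c * ?v)"
  have e3: "?L 1 + b3 * ?L 2 = c * (coords e m 1 + b3 * coords e m 2)"
    unfolding limit_coeffs_solve using D(1) by simp
  have e2: "?L 1 + b2 * ?L 2 = c * (coords e m 1 + b2 * coords e m 2)"
    unfolding limit_coeffs_solve using D(2) by simp
  have "(b3 - b2) * (?L 2 - c * coords e m 2) = 0"
    using e2 e3 by algebra
  then have L2: "?L 2 = c * coords e m 2"
    using b by simp
  then have L1: "?L 1 = c * coords e m 1"
    using e2 by algebra
  have L0: "?L 0 = c * coords e m 0"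
    using m'(2) by (simp add: limit_coeffs_def)
  have "\<forall>k\<le>2. ?L k = c * coords e m k"
    using L0 L1 L2 unfolding all_le_2 by blast
  then have "proj_pt (comb l ?L) = proj_pt (comb l (coords e m))"
    by (intro frame.proj_pt_comb_eq[OF swap c(1)]) blast
  then show ?thesis
    unfolding line_of_def hc using frame.point_eq_comb[OF swap m'(1)] by simp
qed

lemma morphism_direction_of:
  assumes M: "M = proj_pt (comb e (triple 1 0 0))"
  shows "fs_morphism (fs_sub dual_plane (pencil M)) (proj_space 1) (direction_of b1 b2 b3)"
proof -
  have "fs_morphism (fs_sub dual_plane (pencil M)) (proj_space 1)
    (\<lambda>m. proj_pt (\<lambda>i. if i \<le> 1 then \<Sum>j\<le>2. direction_matrix b1 b2 b3 i j * hc m j else 0))"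
  proof (rule morphism_linear_proj[OF swf_sub])
    show "fs_morphism (fs_sub dual_plane (pencil M)) dual_plane (\<lambda>m. m)"
      by (rule fs_sub_inclusion) (auto simp: pencil_def)
    show "\<exists>i\<le>1. (\<Sum>j\<le>2. direction_matrix b1 b2 b3 i j * hc m j) \<noteq> 0"
      if "m \<in> points (fs_sub dual_plane (pencil M))" for m
      by (rule pencil_direction_nonzero[OF M]) (use that in simp)
  qed
  then show ?thesis
    unfolding direction_of_def .
qed

end

end

text \<open>An auxiliary frame through \<open>M\<close> and \<open>P\<close> parametrises part of
  \<open>K\<close> injectively, so \<open>K\<close> is infinite and has a point \<open>N\<close>
  outside the finite set \<open>S\<close>. The frame through \<open>M\<close> and \<open>N\<close>
  has \<open>N\<close> as its only point at infinity.\<close>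

lemma nonsingular_conic_frame_avoiding:
  assumes K: "nonsingular_conic K" and S: "finite S" "S \<subseteq> K" and M: "M \<in> S" and P: "P \<in> S" "P \<noteq> M"
  obtains e l where "conic_frame e l K" "M = proj_pt (comb e (triple 1 0 0))"
    "\<And>p. p \<in> S \<Longrightarrow> coords l p 0 \<noteq> 0"
proof -
  have MK: "M \<in> K" "P \<in> K"
    using M P S by auto
  have "\<exists>N\<in>K. N \<notin> S"
  proof (rule nonsingular_conic_frame[OF K MK P(2)[symmetric]])
    fix e l
    assume "frame e l" and "\<And>p. p \<in> K \<longleftrightarrow> p \<in> proj_points 2 \<and> (coords l p 1)\<^sup>2 = coords l p 0 * coords l p 2"
    then interpret conic_frame e l K
      by (simp add: conic_frame_def conic_frame_axioms_def)
    have "finite (\<gamma> -` S)"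
      by (rule finite_vimageI[OF S(1) inj_gamma])
    then obtain t where "t \<notin> \<gamma> -` S"
      using ex_new_if_finite[OF infinite_UNIV_char_0] by blast
    then show ?thesis
      using gamma_in_K[of t] by auto
  qed
  then obtain N where N: "N \<in> K" "N \<notin> S"
    by blast
  then have MN: "M \<noteq> N"
    using M by blast
  show thesis
  proof (rule nonsingular_conic_frame[OF K MK(1) N(1) MN])
    fix e l
    assume "frame e l" "\<And>p. p \<in> K \<longleftrightarrow> p \<in> proj_points 2 \<and> (coords l p 1)\<^sup>2 = coords l p 0 * coords l p 2"
      and MN: "M = proj_pt (comb e (triple 1 0 0))" "N = proj_pt (comb e (triple 0 0 1))"
    then have cf: "conic_frame e l K"
      by (simp add: conic_frame_def conic_frame_axioms_def)
    show thesis
    proof (rule that[OF cf MN(1)])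
      fix p
      assume "p \<in> S"
      then show "coords l p 0 \<noteq> 0"
        using conic_frame.point_at_infinity[OF cf, of p] N(2) S(2) MN(2) by blast
    qed
  qed
qed

lemma separated_injI:
  assumes "separated h" "h \<A> \<noteq> h \<B>" "h \<A> \<noteq> h \<C>" "h \<B> \<noteq> h \<C>"
  shows "inj h"
proof (rule injI)
  fix i j
  assume eq: "h i = h j"
  show "i = j"
  proof (rule ccontr)
    assume "i \<noteq> j"
    then have "i \<in> {\<A>, \<B>, \<C>}" "j \<in> {\<A>, \<B>, \<C>}"
      using eq assms(1) unfolding separated_def by blast+
    then show False
      using eq \<open>i \<noteq> j\<close> assms(2-4) by auto
  qed
qed

theorem proposition4p1:
  fixes K :: "pt set" and M P Q R :: pt and h :: "letter \<Rightarrow> pt" and x y z :: letter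
    and X' :: "'b fspace" and \<beta>\<^sub>1 :: "'b \<Rightarrow> letter \<Rightarrow> pt"
    and X :: "'c fspace" and \<beta>\<^sub>2 :: "'c \<Rightarrow> 'b" and \<beta> :: "'c \<Rightarrow> letter \<Rightarrow> pt"
    and q :: "'c \<Rightarrow> pt"
  assumes "nonsingular_conic K"
    and "is_blowup (H_open K) (Z_locus K) X' \<beta>\<^sub>1"
    and "is_blowup X' (proper_transform X' \<beta>\<^sub>1 (Z_locus K) (Y_locus K)) X \<beta>\<^sub>2"
    and "\<beta> = \<beta>\<^sub>1 \<circ> \<beta>\<^sub>2"
    and "{M, P, Q, R} \<subseteq> K" and "distinct [M, P, Q, R]"
    and "h \<A> = M" and "h \<B> = M" and "h \<C> = M" and "h \<D> = P" and "h \<E> = Q" and "h \<F> = R"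
    and "{x, y, z} = {\<D>, \<E>, \<F>}"
    and "extends_pascal (symbol \<A> \<B> \<C> x y z) X \<beta> q"
  shows "fs_isomorphism (fs_sub X {\<xi> \<in> topspace (zar X). \<beta> \<xi> = h})
           (fs_sub dual_plane (pencil M)) q"
proof -
  note hv = assms(7-12)
  have PM: "P \<in> {M, P, Q, R}" "P \<noteq> M" "M \<in> {M, P, Q, R}" "finite {M, P, Q, R}"
    using assms(6) by auto
  obtain e l where cf: "conic_frame e l K" and M: "M = proj_pt (comb e (triple 1 0 0))"
    and fin: "\<And>p. p \<in> {M, P, Q, R} \<Longrightarrow> coords l p 0 \<noteq> 0"
    by (rule nonsingular_conic_frame_avoiding[OF assms(1) PM(4) assms(5) PM(3) PM(1) PM(2)]) (rule that)
  interpret conic_frame e l K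
    by (rule cf)
  have h_in: "h i \<in> {M, P, Q, R}" for i
    using hv by (cases i) simp_all
  have hK: "h i \<in> K" for i
    using h_in assms(5) by blast
  define \<Gamma> where "\<Gamma> = (\<lambda>(x :: letter \<Rightarrow> complex) i. \<gamma> (x i))"
  define x0 where "x0 = (\<lambda>i. param (h i))"
  have \<Gamma>x0: "\<Gamma> x0 = h"
    unfolding \<Gamma>_def x0_def using gamma_param[OF hK fin[OF h_in]] by simp
  have sep_h: "separated h"
    unfolding separated_def
  proof (intro allI impI)
    fix i j
    assume "h i = h j"
    then show "i = j \<or> {i, j} \<subseteq> {\<A>, \<B>, \<C>}"
      using hv assms(6) by (cases i; cases j) auto
  qed
  have \<Gamma>_sep: "separated (\<Gamma> x) \<longleftrightarrow> separated x" for x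
    unfolding \<Gamma>_def by (rule separated_inj_comp[OF inj_gamma])
  have sep_x0: "separated x0"
    using sep_h \<Gamma>_sep[of x0] \<Gamma>x0 by simp
  have "M = \<gamma> 0"
    unfolding M \<gamma>_def by simp
  then have x0M: "x0 \<A> = 0" "x0 \<B> = 0" "x0 \<C> = 0"
    using hv param_gamma[of 0] by (simp_all add: x0_def)
  then have collapse_x0: "collapse x0 = x0"
    by (simp add: collapse_eq_iff)

  text \<open>Near \<open>h\<close> the centre of the first blow-up is empty, so \<open>X'\<close> is a copy of the space of sextuples.\<close>

  have X': "space_with_functions X'"
    using assms(2) unfolding is_blowup_def by (elim conjE)
  have X: "space_with_functions X"
    using assms(3) unfolding is_blowup_def by (elim conjE)
  have \<beta>1: "fs_morphism X' (H_open K) \<beta>\<^sub>1"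
    using assms(2) unfolding is_blowup_def by (elim conjE)
  have \<beta>2: "fs_morphism X X' \<beta>\<^sub>2"
    using assms(3) unfolding is_blowup_def by (elim conjE)
  have "h \<in> points (H_open K)"
    using separated_in_H_open_set[OF hK sep_h] by simp
  then obtain U0 \<sigma>1 where U0: "openin (zar (H_open K)) U0" "h \<in> U0" "U0 \<inter> Z_locus K = {}"
    and \<sigma>1: "fs_morphism (fs_sub (H_open K) U0) X' \<sigma>1"
    and \<beta>\<sigma>: "\<And>g. g \<in> U0 \<Longrightarrow> \<beta>\<^sub>1 (\<sigma>1 g) = g"
    and \<sigma>\<beta>: "\<And>\<xi>. \<xi> \<in> points X' \<Longrightarrow> \<beta>\<^sub>1 \<xi> \<in> U0 \<Longrightarrow> \<sigma>1 (\<beta>\<^sub>1 \<xi>) = \<xi>"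
    by (rule blowup_section[OF swf_H_open assms(2) _ separated_notin_Z_locus[OF sep_h]])
      (rule that)
  \<comment> \<open>The parameters of sextuples near \<open>h\<close> over which
    \<open>\<sigma>1\<close> is a section of the first blow-up.\<close>
  define A where "A = {x. separated x \<and> \<Gamma> x \<in> U0}"
  have \<Gamma>: "fs_morphism (fs_sub affine_space B) (H_open K) \<Gamma>" if "B \<subseteq> {x. separated x}" for B
    unfolding \<Gamma>_def
  proof (rule morphism_chart[OF swf_sub])
    show "(\<lambda>w. w i) \<in> reg (fs_sub affine_space B) (points (fs_sub affine_space B))" for i
      using reg_fs_subI[OF reg_affine_component[of i], of B] by simp
  qed (use that in auto)
  have A: "openin (zar affine_space) A"
    using morphism_sub_openin[OF swf_affine openin_separated \<Gamma>[OF order_refl] U0(1)]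
    unfolding A_def by simp
  define \<sigma> where "\<sigma> = (\<lambda>x. \<sigma>1 (\<Gamma> x))"
  have "fs_morphism (fs_sub affine_space A) (fs_sub (H_open K) U0) \<Gamma>"
    by (rule morphism_into_sub[OF swf_sub \<Gamma>]) (auto simp: A_def)
  then have \<sigma>: "fs_morphism (fs_sub affine_space A) X' \<sigma>"
    unfolding \<sigma>_def by (rule morphism_comp[OF _ \<sigma>1])
  have \<beta>\<sigma>\<Gamma>: "\<beta>\<^sub>1 (\<sigma> x) = \<Gamma> x" if "x \<in> A" for x
    unfolding \<sigma>_def by (rule \<beta>\<sigma>) (use that in \<open>simp add: A_def\<close>)
  have \<sigma>_points: "\<sigma> x \<in> points X'" if "x \<in> A" for x
    using morphism_in_points[OF \<sigma>] that by simp
  define \<theta> where "\<theta> = (\<lambda>\<xi> i. param (\<beta>\<^sub>1 \<xi> i))"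
  \<comment> \<open>All six points are finite here, so \<open>param\<close> is a genuine inverse of
    \<open>\<gamma>\<close>.\<close>
  define W where "W = {\<xi> \<in> points X'. \<forall>i. coords l (\<beta>\<^sub>1 \<xi> i) 0 \<noteq> 0}"
  have W: "openin (zar X') W" and \<theta>_reg: "(\<lambda>\<xi>. \<theta> \<xi> i) \<in> reg X' W" for i
    unfolding W_def \<theta>_def by (rule chart_inverse[OF X' \<beta>1])+
  have \<theta>_sub: "fs_morphism (fs_sub X' B) affine_space \<theta>" if "B \<subseteq> W" for B
  proof (rule morphism_into_affine[OF swf_sub])
    show "(\<lambda>\<xi>. \<theta> \<xi> i) \<in> reg (fs_sub X' B) (points (fs_sub X' B))" for i
      using reg_fs_subI[OF \<theta>_reg[of i], of B] that by (simp add: Int_absorb2)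
  qed
  have \<Gamma>\<theta>: "\<Gamma> (\<theta> \<xi>) = \<beta>\<^sub>1 \<xi>" if "\<xi> \<in> W" for \<xi>
  proof -
    have "\<beta>\<^sub>1 \<xi> \<in> H_open_set K"
      using morphism_in_points[OF \<beta>1, of \<xi>] that by (simp add: W_def)
    then have "\<beta>\<^sub>1 \<xi> i \<in> K" for i
      using H_open_set_subset by blast
    then show ?thesis
      unfolding \<Gamma>_def \<theta>_def using that by (simp add: gamma_param W_def)
  qed
  have \<theta>\<sigma>: "\<theta> (\<sigma> x) = x" if "x \<in> A" for x
    unfolding \<theta>_def \<beta>\<sigma>\<Gamma>[OF that] by (simp add: \<Gamma>_def param_gamma)
  define V where "V = {\<xi> \<in> W. \<theta> \<xi> \<in> A}"
  have V: "openin (zar X') V"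
    unfolding V_def by (rule morphism_sub_openin[OF X' W \<theta>_sub[OF order_refl] A])
  have VW: "V \<subseteq> W"
    by (auto simp: V_def)
  have \<sigma>V: "\<sigma> x \<in> V" if "x \<in> A" for x
    unfolding V_def W_def using \<theta>\<sigma>[OF that] \<sigma>_points[OF that] \<beta>\<sigma>\<Gamma>[OF that] that
    by (simp add: \<Gamma>_def coords_gamma_nonzero)
  have \<theta>A: "\<theta> \<xi> \<in> A" if "\<xi> \<in> V" for \<xi>
    using that by (simp add: V_def)
  have \<sigma>\<theta>: "\<sigma> (\<theta> \<xi>) = \<xi>" if "\<xi> \<in> V" for \<xi>
  proof -
    have "\<xi> \<in> W" "\<Gamma> (\<theta> \<xi>) \<in> U0"
      using that by (auto simp: V_def A_def)
    then show ?thesis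
      unfolding \<sigma>_def using \<Gamma>\<theta>[of \<xi>] \<sigma>\<beta>[of \<xi>] by (simp add: W_def)
  qed
  have x0A: "x0 \<in> A"
    using sep_x0 \<Gamma>x0 U0(2) by (simp add: A_def)

  text \<open>In this copy the centre of the second blow-up is the diagonal \<open>x \<A> = x \<B> = x \<C>\<close>.\<close>

  let ?Y = "proper_transform X' \<beta>\<^sub>1 (Z_locus K) (Y_locus K)"
  let ?Yopen = "{\<xi> \<in> points X'. \<beta>\<^sub>1 \<xi> \<in> Y_locus K - Z_locus K}"
  have Y1: "\<sigma> x \<in> ?Y" if "x \<in> A" "collapse x = x" for x
  proof -
    have "\<Gamma> x \<in> U0"
      using that by (simp add: A_def)
    then have "\<Gamma> x \<in> H_open_set K" "\<Gamma> x \<notin> Z_locus K"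
      using openin_subset[OF U0(1)] U0(3) by auto
    moreover have "collapse (\<Gamma> x) = \<Gamma> x"
      using that(2) unfolding collapse_eq_iff \<Gamma>_def by metis
    ultimately have "\<sigma> x \<in> ?Yopen"
      using collapsed_in_Y_locus[of "\<Gamma> x" K] \<beta>\<sigma>\<Gamma>[OF that(1)] \<sigma>_points[OF that(1)] by simp
    moreover have "?Yopen \<subseteq> zar X' closure_of ?Yopen"
      by (rule closure_of_subset) auto
    ultimately show ?thesis
      unfolding proper_transform_def by blast
  qed
  \<comment> \<open>The proper transform is a closure, so \<open>\<xi>\<close> is only a limit of
    points of \<open>?Yopen\<close>. But a nonzero coordinate difference at \<open>\<xi>\<close>
    stays nonzero on a neighbourhood, and this neighbourhood meets \<open>?Yopen\<close>, where
    \<open>separated_Y_locus\<close> makes the difference zero.\<close>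
  have Y2: "collapse (\<theta> \<xi>) = \<theta> \<xi>" if \<xi>: "\<xi> \<in> V" "\<xi> \<in> ?Y" for \<xi>
  proof -
    have "\<theta> \<xi> \<A> = \<theta> \<xi> j" if j: "j = \<B> \<or> j = \<C>" for j
    proof (rule ccontr)
      assume neq: "\<theta> \<xi> \<A> \<noteq> \<theta> \<xi> j"
      have r: "(\<lambda>\<zeta>. \<theta> \<zeta> i) \<in> reg X' V" for i
        by (rule reg_subset[OF X' \<theta>_reg V VW])
      have o: "openin (zar X') {\<zeta> \<in> V. \<theta> \<zeta> \<A> - \<theta> \<zeta> j \<noteq> 0}"
        by (rule reg_nonzero_openin[OF X' reg_diff[OF X' r r]])
      have "\<xi> \<in> {\<zeta> \<in> V. \<theta> \<zeta> \<A> - \<theta> \<zeta> j \<noteq> 0}"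
        using \<xi>(1) neq by simp
      from \<xi>(2)[unfolded proper_transform_def in_closure_of, THEN conjunct2, rule_format, OF conjI[OF this o]]
      obtain \<zeta> where \<zeta>: "\<zeta> \<in> ?Yopen" "\<zeta> \<in> V" "\<theta> \<zeta> \<A> \<noteq> \<theta> \<zeta> j"
        by auto
      have "separated (\<theta> \<zeta>)"
        using \<theta>A[OF \<zeta>(2)] by (simp add: A_def)
      then have "separated (\<beta>\<^sub>1 \<zeta>)"
        using \<Gamma>_sep[of "\<theta> \<zeta>"] \<Gamma>\<theta>[of \<zeta>] \<zeta>(2) VW by auto
      then have "collapse (\<beta>\<^sub>1 \<zeta>) = \<beta>\<^sub>1 \<zeta>"
        using separated_Y_locus[of "\<beta>\<^sub>1 \<zeta>" K] \<zeta>(1) by blast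
      then have "\<theta> \<zeta> \<A> = \<theta> \<zeta> \<B>" "\<theta> \<zeta> \<A> = \<theta> \<zeta> \<C>"
        unfolding collapse_eq_iff \<theta>_def by metis+
      then show False
        using \<zeta>(3) j by auto
    qed
    then show ?thesis
      unfolding collapse_eq_iff by blast
  qed
  obtain F where F: "fs_morphism (proj_space 1) X F"
    and \<beta>F: "\<And>p. p \<in> proj_points 1 \<Longrightarrow> \<beta>\<^sub>2 (F p) = \<sigma> x0"
    and F_surj: "\<And>\<xi>. \<xi> \<in> points X \<Longrightarrow> \<beta>\<^sub>2 \<xi> = \<sigma> x0 \<Longrightarrow> \<exists>p\<in>proj_points 1. \<xi> = F p"
    and F_arc: "\<And>p. p \<in> proj_points 1 \<Longrightarrow> \<exists>D c. open D \<and> 0 \<in> D \<and> fs_morphism (classical D) X c \<and> c 0 = F p \<and>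
      (\<forall>t\<in>D. arc x0 (hc p 0) (hc p 1) t \<in> A \<and> \<beta>\<^sub>2 (c t) = \<sigma> (arc x0 (hc p 0) (hc p 1) t))"
    by (rule blowup_diagonal_fibre[OF X' assms(3) A V \<sigma> \<theta>_sub[OF VW] \<sigma>V \<theta>A \<sigma>\<theta> \<theta>\<sigma> Y1 Y2 x0A collapse_x0])
      (assumption+, rule that)
  \<comment> \<open>The section \<open>\<sigma>1\<close> makes \<open>\<beta>\<^sub>1\<close>
    injective over \<open>U0\<close>, so \<open>h\<close> has a single preimage in
    \<open>X'\<close>.\<close>
  have fibre: "\<beta> \<xi> = h \<longleftrightarrow> \<beta>\<^sub>2 \<xi> = \<sigma> x0" if "\<xi> \<in> points X" for \<xi>
  proof
    assume "\<beta> \<xi> = h"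
    then have "\<beta>\<^sub>1 (\<beta>\<^sub>2 \<xi>) = h"
      by (simp add: assms(4))
    then show "\<beta>\<^sub>2 \<xi> = \<sigma> x0"
      using \<sigma>\<beta>[OF morphism_in_points[OF \<beta>2 that]] U0(2) \<Gamma>x0 by (simp add: \<sigma>_def)
  next
    assume "\<beta>\<^sub>2 \<xi> = \<sigma> x0"
    then show "\<beta> \<xi> = h"
      using \<beta>\<sigma>\<Gamma>[OF x0A] \<Gamma>x0 by (simp add: assms(4))
  qed

  have xyz: "x \<notin> {\<A>, \<B>, \<C>}" "y \<notin> {\<A>, \<B>, \<C>}" "z \<notin> {\<A>, \<B>, \<C>}"
  proof -
    have "x \<in> {\<D>, \<E>, \<F>}" "y \<in> {\<D>, \<E>, \<F>}" "z \<in> {\<D>, \<E>, \<F>}"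
      using assms(13) by blast+
    then show "x \<notin> {\<A>, \<B>, \<C>}" "y \<notin> {\<A>, \<B>, \<C>}" "z \<notin> {\<A>, \<B>, \<C>}"
      by auto
  qed
  have "card {x, y, z} = 3"
    unfolding assms(13) by simp
  then have xyz_ne: "x \<noteq> y" "x \<noteq> z" "y \<noteq> z"
    by (auto simp: card_insert_if split: if_splits)
  have dist: "distinct [\<A>, \<B>, \<C>, x, y, z]"
    using xyz xyz_ne by auto
  define b1 b2 b3 where "b1 = x0 x" and "b2 = x0 y" and "b3 = x0 z"
  have b: "b1 \<noteq> b2" "b1 \<noteq> b3" "b2 \<noteq> b3"
    using separatedD[OF sep_x0] xyz xyz_ne unfolding b1_def b2_def b3_def by blast+
  have q: "fs_morphism X dual_plane q"
    and q_pascal: "\<And>\<xi>. \<xi> \<in> points X \<Longrightarrow> inj (\<beta> \<xi>) \<Longrightarrow> q \<xi> = pascal_line (symbol \<A> \<B> \<C> x y z) (\<beta> \<xi>)"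
    using assms(14) unfolding extends_pascal_def by auto
  have swap': "frame l e"
    by (rule swap)

  text \<open>On the fibre \<open>q\<close> is computed as a limit of Pascal lines along arcs of injective sextuples.\<close>

  have qF: "q (F p) = line_of b1 b2 b3 p" if p: "p \<in> proj_points 1" for p
  proof -
    define u v where "u = hc p 0" and "v = hc p 1"
    obtain D c where D: "open D" "0 \<in> D" and c: "fs_morphism (classical D) X c" "c 0 = F p"
      and \<beta>c: "\<forall>t\<in>D. arc x0 u v t \<in> A \<and> \<beta>\<^sub>2 (c t) = \<sigma> (arc x0 u v t)"
      using F_arc[OF p, folded u_def v_def] by (elim exE conjE) (rule that)
    \<comment> \<open>At the removed parameters two of the entries at \<A>, \<B>, \<C> coincide:
      \<open>t = u\<close> and \<open>t = v / 2\<close> bring \<B> and \<C> back to \<A>, and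
      \<open>t = v - u\<close> identifies \<B> with \<C>. The value 0 stays, since the limit is
      taken there.\<close>
    define D' where "D' = D - ({u, v / 2, v - u} - {0})"
    have D': "open D'" "0 \<in> D'" "D' \<subseteq> D"
      using D by (auto simp: D'_def intro!: open_Diff finite_imp_closed)
    define L where "L = (\<lambda>t. comb l (arc_coeffs b1 b2 b3 (u - t) (v - 2 * t) t))"
    have qc: "fs_morphism (classical D') dual_plane (\<lambda>t. q (c t))"
      by (rule morphism_comp[OF morphism_classical_subset[OF D(1) D'(1,3) c(1)] q])
    have L: "q (c t) = proj_pt (L t)" if t: "t \<in> D'" "t \<noteq> 0" for t
    proof -
      let ?y = "arc x0 u v t"
      have tD: "t \<in> D"
        using t D'(3) by blast
      have y: "?y \<in> A" "\<beta>\<^sub>2 (c t) = \<sigma> ?y"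
        using \<beta>c tD by blast+
      have ne: "t \<noteq> u" "t \<noteq> v / 2" "t \<noteq> v - u"
        using t by (auto simp: D'_def)
      have inj: "inj ?y"
      proof (rule separated_injI)
        show "separated ?y"
          using y(1) by (simp add: A_def)
        show "?y \<A> \<noteq> ?y \<B>" "?y \<A> \<noteq> ?y \<C>"
          using ne t(2) by (auto simp: field_simps)
        have "?y \<B> - ?y \<C> = t * (v - u - t)"
          by (simp add: algebra_simps)
        moreover have "t * (v - u - t) \<noteq> 0"
          using ne t(2) by simp
        ultimately show "?y \<B> \<noteq> ?y \<C>"
          by auto
      qed
      have \<beta>ct: "\<beta> (c t) = (\<lambda>i. \<gamma> (?y i))"
        using \<beta>\<sigma>\<Gamma>[OF y(1)] y(2) by (simp add: assms(4) \<Gamma>_def)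
      have "inj (\<beta> (c t))"
        unfolding \<beta>ct using inj_compose[OF inj_gamma inj] by (simp add: comp_def)
      moreover have "c t \<in> points X"
        using morphism_in_points[OF c(1)] tD by simp
      ultimately have "q (c t) = pascal_line (symbol \<A> \<B> \<C> x y z) (\<lambda>i. \<gamma> (?y i))"
        using q_pascal \<beta>ct by simp
      also have "\<dots> = proj_pt (comb l (pascal_coeffs (?y \<A>) (?y \<B>) (?y \<C>) (?y x) (?y y) (?y z)))"
        by (rule pascal_line_gamma[OF inj dist])
      also have "\<dots> = proj_pt (comb l (pascal_coeffs 0 (0 - t * (u - t)) (0 - t * (v - 2 * t)) b1 b2 b3))"
      proof -
        have "?y i = x0 i" if "i \<notin> {\<A>, \<B>, \<C>}" for i
          using that by (cases i) simp_all
        then show ?thesis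
          using xyz by (simp add: x0M b1_def b2_def b3_def)
      qed
      also have "\<dots> = proj_pt (L t)"
        unfolding L_def by (rule frame.proj_pt_comb_eq[OF swap' t(2)]) (rule pascal_coeffs_arc)
      finally show ?thesis .
    qed
    \<comment> \<open>The unsimplified arguments and the factor 1 fit \<open>L 0\<close> and the
      shape of \<open>proj_pt_comb_eq\<close>.\<close>
    have eq0: "\<And>k. k \<le> 2 \<Longrightarrow> arc_coeffs b1 b2 b3 (u - 0) (v - 2 * 0) 0 k = 1 * limit_coeffs b1 b2 b3 u v k"
      using arc_coeffs_0 by simp
    have "q (c 0) = proj_pt (L 0)"
    proof -
      obtain k where k: "k \<le> 2" "limit_coeffs b1 b2 b3 u v k \<noteq> 0"
        using limit_coeffs_nonzero[OF b hc_P1_nonzero[OF p]] unfolding u_def v_def by blast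
      then have "arc_coeffs b1 b2 b3 (u - 0) (v - 2 * 0) 0 k \<noteq> 0"
        using eq0[OF k(1)] by simp
      then obtain j where j: "L 0 j \<noteq> 0"
        using frame.comb_nonzero[OF swap' k(1)] unfolding L_def by blast
      show ?thesis
      proof (rule curve_proj_limit[OF D'(1,2) qc L _ _ j])
        show "((\<lambda>t. L t i) \<longlongrightarrow> L 0 i) (at 0)" for i
        proof -
          have "continuous_on UNIV (\<lambda>t. L t i)"
            unfolding L_def comb_def by (intro continuous_intros continuous_arc_coeffs)
          then show ?thesis
            by (simp add: continuous_on_eq_continuous_at isCont_def)
        qed
        show "L 0 i = 0" if "i > 2" for i
          using that by (simp add: L_def comb_def support)
      qed
    qed
    also have "\<dots> = line_of b1 b2 b3 p"
      unfolding L_def line_of_def u_def[symmetric] v_def[symmetric]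
      by (rule frame.proj_pt_comb_eq[OF swap' one_neq_zero eq0])
    finally show ?thesis
      unfolding c(2) .
  qed

  let ?fib = "{\<xi> \<in> points X. \<beta> \<xi> = h}"
  have F_fib: "F p \<in> ?fib" if "p \<in> proj_points 1" for p
  proof -
    have "F p \<in> points X"
      using morphism_in_points[OF F] that by simp
    then show ?thesis
      using fibre \<beta>F[OF that] by simp
  qed
  have fib_F: "\<exists>p\<in>proj_points 1. \<xi> = F p" if "\<xi> \<in> ?fib" for \<xi>
    using that fibre F_surj by blast
  note dir = morphism_direction_of[OF b M]
  have dir_in: "direction_of b1 b2 b3 m \<in> proj_points 1" if "m \<in> pencil M" for m
    using morphism_in_points[OF dir] that by simp
  \<comment> \<open>The inverse of \<open>q\<close> runs through the line of directions, which makes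
    it a composition of morphisms.\<close>
  define G where "G = (\<lambda>m. F (direction_of b1 b2 b3 m))"
  show ?thesis
    unfolding fs_isomorphism_def
  proof (intro conjI exI ballI)
    show "fs_morphism (fs_sub X ?fib) (fs_sub dual_plane (pencil M)) q"
    proof (rule morphism_into_sub[OF swf_sub morphism_restrict[OF X _ q]])
      show "?fib \<subseteq> points X"
        by blast
      show "q \<xi> \<in> pencil M" if "\<xi> \<in> points (fs_sub X ?fib)" for \<xi>
        using fib_F[OF that[unfolded points_fs_sub]] qF line_of_in_pencil[OF b M] by metis
    qed
    show "fs_morphism (fs_sub dual_plane (pencil M)) (fs_sub X ?fib) G"
      unfolding G_def
      by (rule morphism_into_sub[OF swf_sub morphism_comp[OF dir F]])
        (rule F_fib, rule dir_in, simp)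
    show "G (q \<xi>) = \<xi>" if \<xi>: "\<xi> \<in> points (fs_sub X ?fib)" for \<xi>
    proof -
      obtain p where "p \<in> proj_points 1" "\<xi> = F p"
        using fib_F[OF \<xi>[unfolded points_fs_sub]] by (rule bexE)
      then show ?thesis
        unfolding G_def by (simp add: qF direction_of_line_of[OF b])
    qed
    show "q (G m) = m" if "m \<in> points (fs_sub dual_plane (pencil M))" for m
      using that qF[OF dir_in] line_of_direction_of[OF b M] by (simp add: G_def)
  qed
qed

end
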